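(* Let $\mathbb{X}=\{P_1,\dots,P_s\}\subseteq\mathbb{P}^n$ be a set of $s$ distinct $K$-rational points, and let $\nu\ge 1$. Then $\mathrm{HP}_{\Omega^{n+1}_{R_{(\nu+1)\mathbb{X}}/K}}(z)=\mathrm{HP}_{\nu\mathbb{X}}(z)$.
   Context: $K$ is a field of characteristic zero, $S=K[X_0,\dots,X_n]$ ($n\ge1$) with the standard grading is the homogeneous coordinate ring of $\mathbb{P}^n$ over $K$; coordinates are chosen so that no $P_j$ lies on $X_0=0$. With $\wp_j\subseteq S$ the homogeneous vanishing ideal of $P_j$ and $k\ge 1$, the equimultiple fat point scheme $k\mathbb{X}$ has homogeneous vanishing ideal $I_{k\mathbb{X}}=\wp_1^{k}\cap\cdots\cap\wp_s^{k}$ and coordinate ring $R_{k\mathbb{X}}=S/I_{k\mathbb{X}}$, whose Hilbert polynomial is denoted $\mathrm{HP}_{k\mathbb{X}}$. $\Omega^1_{R_{k\mathbb{X}}/K}$ is the module of Kähler differentials of $R_{k\mathbb{X}}/K$, graded with $\deg(dx_i)=1$ where $x_i$ is the image of $X_i$, and $\Omega^{m}_{R_{k\mathbb{X}}/K}=\bigwedge^{m}_{R_{k\mathbb{X}}}\Omega^1_{R_{k\mathbb{X}}/K}$. $\mathrm{HP}_M$ denotes the Hilbert polynomial of a finitely generated graded module $M$. *)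

theory Defs
  imports
    "HOL-Library.Poly_Mapping"
    "HOL-Library.FuncSet"
    "HOL-Computational_Algebra.Polynomial"
    "HOL-Algebra.QuotRing"
    "HOL-Algebra.Ideal_Product"
    "Jordan_Normal_Form.VS_Connect"
begin

section \<open>Modules and algebras\<close>

text \<open>
  A $K$-algebra is, as in the locale \<^locale>\<open>algebra\<close>, a \<^typ>\<open>('k, 'a) module\<close> record whose ring
  operations are meaningful.  For records that are only modules, the fields
  \<^const>\<open>monoid.mult\<close> and \<^const>\<open>monoid.one\<close> are junk and never used.
\<close>

text \<open>
  One definition serves both the quotient of a module by a submodule and the quotient of an
  algebra by an ideal.  Every set in the union is the coset of \<open>a \<odot> x\<close> for some representative
  \<open>x\<close> of \<open>C\<close>, and these cosets all coincide.
\<close>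

definition quot_module :: "('r, 'm) module \<Rightarrow> 'm set \<Rightarrow> ('r, 'm set) module" where
  "quot_module M N =
     ring.extend (M Quot N) (module.fields (\<lambda>a C. \<Union>x\<in>C. N +>\<^bsub>M\<^esub> (a \<odot>\<^bsub>M\<^esub> x)))"

definition restrict_scalars :: "('k, 'a) module \<Rightarrow> ('a, 'm) module \<Rightarrow> ('k, 'm) module" where
  "restrict_scalars A M =
     ring.extend (ring.truncate M) (module.fields (\<lambda>c x. (c \<odot>\<^bsub>A\<^esub> \<one>\<^bsub>A\<^esub>) \<odot>\<^bsub>M\<^esub> x))"

text \<open>Free module on the set \<open>B\<close>: finitely supported functions, zero off \<open>B\<close>.\<close>

definition free_module :: "('r, 'e) ring_scheme \<Rightarrow> 'b set \<Rightarrow> ('r, 'b \<Rightarrow> 'r) module" where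
  "free_module R B =
     \<lparr>carrier = {f. (\<forall>b\<in>B. f b \<in> carrier R) \<and> (\<forall>b. b \<notin> B \<longrightarrow> f b = \<zero>\<^bsub>R\<^esub>) \<and>
                    finite {b. f b \<noteq> \<zero>\<^bsub>R\<^esub>}},
      mult = undefined, one = undefined,
      zero = (\<lambda>_. \<zero>\<^bsub>R\<^esub>),
      add = (\<lambda>f g b. f b \<oplus>\<^bsub>R\<^esub> g b),
      smult = (\<lambda>a f b. a \<otimes>\<^bsub>R\<^esub> f b)\<rparr>"

definition free_gen :: "('r, 'e) ring_scheme \<Rightarrow> 'b \<Rightarrow> 'b \<Rightarrow> 'r" where
  "free_gen R b = (\<lambda>x. if x = b then \<one>\<^bsub>R\<^esub> else \<zero>\<^bsub>R\<^esub>)"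


section \<open>Kaehler differentials and exterior powers\<close>

text \<open>
  $\Omega^1_{A/K}$ is the $A$-module generated by symbols $d a$, one for each $a \in A$, subject to
  additivity, the Leibniz rule and $d(c \cdot 1) = 0$ for $c \in K$.
\<close>

definition kaehler_rels :: "('k, 'e) ring_scheme \<Rightarrow> ('k, 'a) module \<Rightarrow> ('a \<Rightarrow> 'a) set" where
  "kaehler_rels K A =
     (let F = free_module A (carrier A); e = free_gen A in
        {e (a \<oplus>\<^bsub>A\<^esub> b) \<ominus>\<^bsub>F\<^esub> (e a \<oplus>\<^bsub>F\<^esub> e b) | a b. a \<in> carrier A \<and> b \<in> carrier A}
      \<union> {e (a \<otimes>\<^bsub>A\<^esub> b) \<ominus>\<^bsub>F\<^esub> (a \<odot>\<^bsub>F\<^esub> e b \<oplus>\<^bsub>F\<^esub> b \<odot>\<^bsub>F\<^esub> e a) | a b. a \<in> carrier A \<and> b \<in> carrier A}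
      \<union> {e (c \<odot>\<^bsub>A\<^esub> \<one>\<^bsub>A\<^esub>) | c. c \<in> carrier K})"

definition kaehler_kernel :: "('k, 'e) ring_scheme \<Rightarrow> ('k, 'a) module \<Rightarrow> ('a \<Rightarrow> 'a) set" where
  "kaehler_kernel K A =
     LinearCombinations.module.span A (free_module A (carrier A)) (kaehler_rels K A)"

definition kaehler :: "('k, 'e) ring_scheme \<Rightarrow> ('k, 'a) module \<Rightarrow> ('a, ('a \<Rightarrow> 'a) set) module" where
  "kaehler K A = quot_module (free_module A (carrier A)) (kaehler_kernel K A)"

definition univ_deriv :: "('k, 'e) ring_scheme \<Rightarrow> ('k, 'a) module \<Rightarrow> 'a \<Rightarrow> ('a \<Rightarrow> 'a) set" where
  "univ_deriv K A a = kaehler_kernel K A +>\<^bsub>free_module A (carrier A)\<^esub> free_gen A a"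

text \<open>
  $\bigwedge^m_R M$ is the $R$-module generated by the $m$-tuples of elements of $M$ (lists of
  length $m$), subject to multilinearity and to the vanishing of tuples with a repeated entry.
\<close>

definition tuples :: "('r, 'm) module \<Rightarrow> nat \<Rightarrow> 'm list set" where
  "tuples M m = {xs. length xs = m \<and> set xs \<subseteq> carrier M}"

definition ext_rels ::
  "('r, 'e) ring_scheme \<Rightarrow> ('r, 'm) module \<Rightarrow> nat \<Rightarrow> ('m list \<Rightarrow> 'r) set" where
  "ext_rels R M m =
     (let F = free_module R (tuples M m); e = free_gen R in
        {e (xs[i := x \<oplus>\<^bsub>M\<^esub> y]) \<ominus>\<^bsub>F\<^esub> (e (xs[i := x]) \<oplus>\<^bsub>F\<^esub> e (xs[i := y])) | xs i x y.
           xs \<in> tuples M m \<and> i < m \<and> x \<in> carrier M \<and> y \<in> carrier M}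
      \<union> {e (xs[i := a \<odot>\<^bsub>M\<^esub> x]) \<ominus>\<^bsub>F\<^esub> (a \<odot>\<^bsub>F\<^esub> e (xs[i := x])) | xs i a x.
           xs \<in> tuples M m \<and> i < m \<and> a \<in> carrier R \<and> x \<in> carrier M}
      \<union> {e xs | xs. xs \<in> tuples M m \<and> (\<exists>i j. i < j \<and> j < m \<and> xs ! i = xs ! j)})"

definition ext_kernel ::
  "('r, 'e) ring_scheme \<Rightarrow> ('r, 'm) module \<Rightarrow> nat \<Rightarrow> ('m list \<Rightarrow> 'r) set" where
  "ext_kernel R M m =
     LinearCombinations.module.span R (free_module R (tuples M m)) (ext_rels R M m)"

definition ext_power ::
  "('r, 'e) ring_scheme \<Rightarrow> ('r, 'm) module \<Rightarrow> nat \<Rightarrow> ('r, ('m list \<Rightarrow> 'r) set) module" where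
  "ext_power R M m = quot_module (free_module R (tuples M m)) (ext_kernel R M m)"

definition wedge ::
  "('r, 'e) ring_scheme \<Rightarrow> ('r, 'm) module \<Rightarrow> 'm list \<Rightarrow> ('m list \<Rightarrow> 'r) set" where
  "wedge R M xs =
     ext_kernel R M (length xs) +>\<^bsub>free_module R (tuples M (length xs))\<^esub> free_gen R xs"


section \<open>Gradings and Hilbert polynomials\<close>

text \<open>
  A grading is given by its homogeneous components, indexed by \<^typ>\<open>nat\<close> since all components
  of negative degree vanish for the modules below.

  If the module $M$ over the graded $K$-algebra $A = \bigoplus_i A_i$ is generated by
  homogeneous elements $g$ of degree $e$, for $(g, e) \in G$, then $M_d$ is the $K$-span of the
  products $a g$ with $a \in A_i$, $(g, e) \in G$ and $i + e = d$.
\<close>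

definition grading_by_gens ::
  "('k, 'e) ring_scheme \<Rightarrow> ('k, 'a) module \<Rightarrow> (nat \<Rightarrow> 'a set) \<Rightarrow> ('a, 'm) module \<Rightarrow>
     ('m \<times> nat) set \<Rightarrow> nat \<Rightarrow> 'm set" where
  "grading_by_gens K A gr M G d =
     LinearCombinations.module.span K (restrict_scalars A M)
       {a \<odot>\<^bsub>M\<^esub> g | a g i e. a \<in> gr i \<and> (g, e) \<in> G \<and> i + e = d}"

definition ext_power_grading ::
  "('k, 'e) ring_scheme \<Rightarrow> ('k, 'a) module \<Rightarrow> (nat \<Rightarrow> 'a set) \<Rightarrow> ('a, 'm) module \<Rightarrow>
     (nat \<Rightarrow> 'm set) \<Rightarrow> nat \<Rightarrow> nat \<Rightarrow> ('m list \<Rightarrow> 'a) set set" where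
  "ext_power_grading K A gr M grM m =
     grading_by_gens K A gr (ext_power A M m)
       {(wedge A M xs, sum_list es) | xs es.
          length xs = m \<and> length es = m \<and> (\<forall>i<m. xs ! i \<in> grM (es ! i))}"

text \<open>
  \<open>V\<close> is the graded module viewed as a \<open>K\<close>-vector space and \<open>gr d\<close> its component of degree \<open>d\<close>.
  A polynomial with the defining property is unique, and it exists when \<open>V\<close> is finitely
  generated over a standard graded \<open>K\<close>-algebra.
\<close>

definition is_hilbert_poly ::
  "('k, 'e) ring_scheme \<Rightarrow> ('k, 'm) module \<Rightarrow> (nat \<Rightarrow> 'm set) \<Rightarrow> rat poly \<Rightarrow> bool" where
  "is_hilbert_poly K V gr p \<longleftrightarrow>
     (\<forall>\<^sub>F d in sequentially. poly p (of_nat d) = of_nat (vectorspace.dim K (V\<lparr>carrier := gr d\<rparr>)))"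

definition hilbert_poly ::
  "('k, 'e) ring_scheme \<Rightarrow> ('k, 'm) module \<Rightarrow> (nat \<Rightarrow> 'm set) \<Rightarrow> rat poly" where
  "hilbert_poly K V gr = (THE p. is_hilbert_poly K V gr p)"

lemma is_hilbert_poly_unique:
  assumes "is_hilbert_poly K V gr p" "is_hilbert_poly K V gr q"
  shows "p = q"
proof (rule ccontr)
  assume "p \<noteq> q"
  then have "finite {x. poly (p - q) x = 0}" by (intro poly_roots_finite) auto
  moreover have "\<forall>\<^sub>F d in sequentially. poly p (of_nat d) = poly q (of_nat d :: rat)"
    using assms unfolding is_hilbert_poly_def by eventually_elim simp
  then obtain N where N: "\<And>d. d \<ge> N \<Longrightarrow> poly p (of_nat d) = poly q (of_nat d :: rat)"
    unfolding eventually_sequentially by blast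
  then have "of_nat ` {N..} \<subseteq> {x. poly (p - q) x = 0}" by auto
  moreover have "infinite (of_nat ` {N..} :: rat set)"
    by (simp add: finite_image_iff inj_on_def infinite_Ici)
  ultimately show False using finite_subset by blast
qed


section \<open>Polynomials and projective space\<close>

type_synonym 'k mpoly = "(nat \<Rightarrow>\<^sub>0 nat) \<Rightarrow>\<^sub>0 'k"

text \<open>The polynomial algebra $K[X_0,\dots,X_n]$ inside $K[X_0,X_1,\dots]$.\<close>

definition poly_alg :: "nat \<Rightarrow> ('k::field, 'k mpoly) module" where
  "poly_alg n =
     \<lparr>carrier = {f. \<forall>t\<in>Poly_Mapping.keys f. Poly_Mapping.keys t \<subseteq> {..n}},
      mult = (*), one = 1, zero = 0, add = (+),
      smult = (\<lambda>c f. Poly_Mapping.single 0 c * f)\<rparr>"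

definition poly_var :: "nat \<Rightarrow> 'k::field mpoly" where
  "poly_var i = Poly_Mapping.single (Poly_Mapping.single i 1) 1"

definition mon_degree :: "(nat \<Rightarrow>\<^sub>0 nat) \<Rightarrow> nat" where
  "mon_degree t = (\<Sum>i\<in>Poly_Mapping.keys t. Poly_Mapping.lookup t i)"

definition hom_polys :: "nat \<Rightarrow> nat \<Rightarrow> 'k::field mpoly set" where
  "hom_polys n d = {f \<in> carrier (poly_alg n). \<forall>t\<in>Poly_Mapping.keys f. mon_degree t = d}"

definition poly_eval :: "'k::field mpoly \<Rightarrow> (nat \<Rightarrow> 'k) \<Rightarrow> 'k" where
  "poly_eval f v =
     (\<Sum>t\<in>Poly_Mapping.keys f. Poly_Mapping.lookup f t *
        (\<Prod>i\<in>Poly_Mapping.keys t. v i ^ Poly_Mapping.lookup t i))"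

text \<open>
  The $K$-rational points of $\mathbb{P}^n$: a point is the set of all its homogeneous
  coordinate vectors.
\<close>

definition coord_vectors :: "nat \<Rightarrow> (nat \<Rightarrow> 'k::field) set" where
  "coord_vectors n = {v \<in> {..n} \<rightarrow>\<^sub>E UNIV. \<exists>i\<le>n. v i \<noteq> 0}"

definition proj_space :: "nat \<Rightarrow> (nat \<Rightarrow> 'k::field) set set" where
  "proj_space n =
     coord_vectors n //
       {(v, w) \<in> coord_vectors n \<times> coord_vectors n. \<exists>c. c \<noteq> 0 \<and> (\<forall>i\<le>n. w i = c * v i)}"

definition point_ideal :: "nat \<Rightarrow> (nat \<Rightarrow> 'k::field) set \<Rightarrow> 'k mpoly set" where
  "point_ideal n P =
     Idl\<^bsub>poly_alg n\<^esub> {f. (\<exists>d. f \<in> hom_polys n d) \<and> (\<forall>v\<in>P. poly_eval f v = 0)}"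


section \<open>Equimultiple fat point schemes\<close>

text \<open>
  The intersection of the \<open>k\<close>-th powers of the point ideals; \<^const>\<open>ideals_set\<close> is the monoid of
  ideals under \<^const>\<open>ideal_prod\<close>.  Relativised to the polynomial ring, so that \<open>X = {}\<close> gives the
  unit ideal.
\<close>

definition fat_ideal :: "nat \<Rightarrow> nat \<Rightarrow> (nat \<Rightarrow> 'k::field) set set \<Rightarrow> 'k mpoly set" where
  "fat_ideal n k X =
     {f \<in> carrier (poly_alg n). \<forall>P\<in>X. f \<in> point_ideal n P [^]\<^bsub>ideals_set (poly_alg n)\<^esub> k}"

definition fat_ring :: "nat \<Rightarrow> nat \<Rightarrow> (nat \<Rightarrow> 'k::field) set set \<Rightarrow> ('k, 'k mpoly set) module" where
  "fat_ring n k X = quot_module (poly_alg n) (fat_ideal n k X)"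

definition fat_class :: "nat \<Rightarrow> nat \<Rightarrow> (nat \<Rightarrow> 'k::field) set set \<Rightarrow> 'k mpoly \<Rightarrow> 'k mpoly set" where
  "fat_class n k X f = fat_ideal n k X +>\<^bsub>poly_alg n\<^esub> f"

definition fat_grading ::
  "nat \<Rightarrow> nat \<Rightarrow> (nat \<Rightarrow> 'k::field) set set \<Rightarrow> nat \<Rightarrow> 'k mpoly set set" where
  "fat_grading n k X d = fat_class n k X ` hom_polys n d"

definition HP_fat :: "nat \<Rightarrow> nat \<Rightarrow> (nat \<Rightarrow> 'k::field) set set \<Rightarrow> rat poly" where
  "HP_fat n k X = hilbert_poly class_ring (fat_ring n k X) (fat_grading n k X)"

type_synonym 'k form1 = "('k mpoly set \<Rightarrow> 'k mpoly set) set"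
type_synonym 'k form = "('k form1 list \<Rightarrow> 'k mpoly set) set"

definition Omega1 ::
  "nat \<Rightarrow> nat \<Rightarrow> (nat \<Rightarrow> 'k::field) set set \<Rightarrow> ('k mpoly set, 'k form1) module" where
  "Omega1 n k X = kaehler class_ring (fat_ring n k X)"

definition Omega1_grading ::
  "nat \<Rightarrow> nat \<Rightarrow> (nat \<Rightarrow> 'k::field) set set \<Rightarrow> nat \<Rightarrow> 'k form1 set" where
  "Omega1_grading n k X =
     grading_by_gens class_ring (fat_ring n k X) (fat_grading n k X) (Omega1 n k X)
       {(univ_deriv class_ring (fat_ring n k X) (fat_class n k X (poly_var i)), 1) | i. i \<le> n}"

definition Omega ::
  "nat \<Rightarrow> nat \<Rightarrow> (nat \<Rightarrow> 'k::field) set set \<Rightarrow> nat \<Rightarrow> ('k mpoly set, 'k form) module" where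
  "Omega n k X m = ext_power (fat_ring n k X) (Omega1 n k X) m"

definition Omega_grading ::
  "nat \<Rightarrow> nat \<Rightarrow> (nat \<Rightarrow> 'k::field) set set \<Rightarrow> nat \<Rightarrow> nat \<Rightarrow> 'k form set" where
  "Omega_grading n k X m =
     ext_power_grading class_ring (fat_ring n k X) (fat_grading n k X)
       (Omega1 n k X) (Omega1_grading n k X) m"

definition HP_Omega :: "nat \<Rightarrow> nat \<Rightarrow> (nat \<Rightarrow> 'k::field) set set \<Rightarrow> nat \<Rightarrow> rat poly" where
  "HP_Omega n k X m =
     hilbert_poly class_ring (restrict_scalars (fat_ring n k X) (Omega n k X m))
       (Omega_grading n k X m)"

end

theory Submission
  imports Defs
begin

text \<open>
  Write $I_k$ for the ideal of $k\mathbb{X}$ and $w = dx_0 \wedge \dots \wedge dx_n$.  The module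
  $\Omega^{n+1}$ of $R = S/I_{\nu+1}$ is generated by $w$, so it is $S/J$ up to a shift of degrees by
  $n+1$, where $J$ is the annihilator of $w$ in $S$.  Wedging $dg = 0$ for $g \in I_{\nu+1}$ with the other
  $dx_j$ gives $I_{\nu+1} \subseteq J$ and $\partial_i I_{\nu+1} \subseteq J$; conversely the Jacobian
  determinant is a well-defined map $\Omega^{n+1} \to S/I_\nu$, because $\partial_i I_{\nu+1} \subseteq I_\nu$,
  and it sends $w$ to $1$, so $J \subseteq I_\nu$.

  In large degrees $J = I_\nu$.  If $f \in I_\nu$ and $u$ vanishes to order $\nu + 2$ at all points but
  $P_j$, then $\sum_i \partial_i (u f Y_i) \equiv (n + \nu) u f$ modulo $I_{\nu+1}$ in coordinates $Y_i$ centred at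
  $P_j$, so $u f \in J$ in characteristic $0$.  A power of $X_0$ is a sum of such $u$, and $S$ is finite over
  $K[X_0]$ modulo $I_{\nu+1}$ because no point lies on $X_0 = 0$; since $X_0$ is a nonzerodivisor modulo
  $I_\nu$, this gives the claim.  The same two facts show that multiplication by $X_0^{n+1}$ is an isomorphism
  $(S/I_\nu)_{d-n-1} \to (S/I_\nu)_d$ for large $d$, which absorbs the shift.
\<close>

section \<open>Multivariate polynomials\<close>

text \<open>The J of the overview is \<open>top_ann\<close>. In \<open>X0_power_colon\<close> and
  \<open>fat_ideal_eventually_subset\<close> it is replaced by an ideal containing I_{\<nu>+1} and
  its partial derivatives, whereas in \<open>poly_quotient_form\<close> and
  \<open>poly_quotient_pair\<close> the letter J denotes the ideal modulo which the Jacobian takes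
  its values, later I_\<nu>. The obstacle is that ring elements are cosets and top forms are cosets
  of functions on lists of cosets. Maps out of these modules are therefore not built as
  homomorphisms: they are computed on chosen representatives with values in polynomials, and each
  law holds as a congruence modulo J. In the factor n + \<nu>, the n is the divergence of the
  coordinates Y_i and the \<nu> is Euler's identity on functions vanishing to order \<nu>. Order
  \<nu> + 2 is asked of u because its first derivatives must still vanish to order \<nu> + 1. The
  final isomorphism in large degree is never written as a map: both graded pieces are images of one
  space of polynomials under maps with the same fibres.\<close>

lemma poly_mapping_eq_sum_single:
  fixes f :: "'a \<Rightarrow>\<^sub>0 'b::comm_monoid_add"
  shows "f = (\<Sum>t\<in>Poly_Mapping.keys f. Poly_Mapping.single t (Poly_Mapping.lookup f t))"
proof (rule poly_mapping_eqI)
  fix s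
  have "(\<Sum>t\<in>Poly_Mapping.keys f. Poly_Mapping.lookup (Poly_Mapping.single t (Poly_Mapping.lookup f t)) s)
      = (\<Sum>t\<in>Poly_Mapping.keys f. if t = s then Poly_Mapping.lookup f t else 0)"
    by (intro sum.cong) (auto simp: lookup_single)
  also have "\<dots> = Poly_Mapping.lookup f s"
    by (simp add: in_keys_iff)
  finally show "Poly_Mapping.lookup f s =
    Poly_Mapping.lookup (\<Sum>t\<in>Poly_Mapping.keys f. Poly_Mapping.single t (Poly_Mapping.lookup f t)) s"
    by (simp add: lookup_sum)
qed

text \<open>The last premise concerns only terms that occur in \<open>f\<close>, so conditions on
  the support of \<open>f\<close>, such as its variables or its degree, remain available
  there.\<close>

lemma poly_mapping_single_induct:
  fixes f :: "'a \<Rightarrow>\<^sub>0 'b::comm_monoid_add"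
  assumes "Q 0" and "\<And>f g. Q f \<Longrightarrow> Q g \<Longrightarrow> Q (f + g)"
    and "\<And>t. t \<in> Poly_Mapping.keys f \<Longrightarrow> Q (Poly_Mapping.single t (Poly_Mapping.lookup f t))"
  shows "Q f"
proof -
  have "Q (\<Sum>t\<in>T. Poly_Mapping.single t (Poly_Mapping.lookup f t))"
    if "finite T" "T \<subseteq> Poly_Mapping.keys f" for T
    using that by (induction T) (auto intro: assms)
  then show ?thesis by (subst poly_mapping_eq_sum_single) auto
qed

abbreviation polys :: "nat \<Rightarrow> 'k::field mpoly set" where
  "polys n \<equiv> carrier (poly_alg n)"

lemma polys_iff: "f \<in> polys n \<longleftrightarrow> (\<forall>t\<in>Poly_Mapping.keys f. Poly_Mapping.keys t \<subseteq> {..n})"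
  by (simp add: poly_alg_def)

lemma poly_alg_simps [simp]:
  "mult (poly_alg n) = (*)" "one (poly_alg n) = 1" "zero (poly_alg n) = 0" "add (poly_alg n) = (+)"
  "smult (poly_alg n) = (\<lambda>c f. Poly_Mapping.single 0 c * f)"
  by (simp_all add: poly_alg_def)

lemma polys_add [intro, simp]: "f \<in> polys n \<Longrightarrow> g \<in> polys n \<Longrightarrow> f + g \<in> polys n"
  using Poly_Mapping.keys_add[of f g] by (auto simp: polys_iff)

lemma polys_zero [intro, simp]: "0 \<in> polys n"
  by (simp add: polys_iff)

lemma polys_one [intro, simp]: "1 \<in> polys n"
  by (auto simp: polys_iff)

lemma polys_uminus [intro, simp]: "f \<in> polys n \<Longrightarrow> - f \<in> polys n"
  by (simp add: polys_iff)

lemma polys_diff [intro, simp]: "f \<in> polys n \<Longrightarrow> g \<in> polys n \<Longrightarrow> f - g \<in> polys n"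
  using polys_add[of f n "- g"] by simp

lemma keys_nat_add: "Poly_Mapping.keys (s + t) = Poly_Mapping.keys s \<union> Poly_Mapping.keys (t :: 'a \<Rightarrow>\<^sub>0 nat)"
  by (auto simp: in_keys_iff lookup_add)

lemma polys_mult [intro, simp]: "f \<in> polys n \<Longrightarrow> g \<in> polys n \<Longrightarrow> f * g \<in> polys n"
  using keys_mult[of f g] by (force simp: polys_iff keys_nat_add dest!: subsetD)

lemma polys_single: "Poly_Mapping.keys t \<subseteq> {..n} \<Longrightarrow> Poly_Mapping.single t c \<in> polys n"
  by (simp add: polys_iff)

lemma polys_const [intro, simp]: "Poly_Mapping.single 0 c \<in> polys n"
  by (simp add: polys_iff)

lemma polys_var [intro, simp]: "i \<le> n \<Longrightarrow> poly_var i \<in> polys n"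
  by (simp add: polys_iff poly_var_def)

lemma polys_sum [intro]: "(\<And>i. i \<in> A \<Longrightarrow> f i \<in> polys n) \<Longrightarrow> sum f A \<in> polys n"
  by (induction A rule: infinite_finite_induct) auto

lemma polys_prod [intro]: "(\<And>i. i \<in> A \<Longrightarrow> f i \<in> polys n) \<Longrightarrow> prod f A \<in> polys n"
  by (induction A rule: infinite_finite_induct) auto

lemma polys_power [intro, simp]: "f \<in> polys n \<Longrightarrow> f ^ k \<in> polys n"
  by (induction k) auto

lemma poly_alg_cring: "cring (poly_alg n)"
proof (rule cringI)
  show "abelian_group (poly_alg n)"
  proof (rule abelian_groupI)
    fix x assume "x \<in> polys n"
    then show "\<exists>y\<in>polys n. y \<oplus>\<^bsub>poly_alg n\<^esub> x = \<zero>\<^bsub>poly_alg n\<^esub>"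
      by (intro bexI[of _ "- x"]) auto
  qed (auto simp: algebra_simps)
  show "comm_monoid (poly_alg n)"
    by (rule comm_monoidI) (auto simp: algebra_simps)
qed (auto simp: algebra_simps)

lemma poly_alg_uminus: "x \<in> polys n \<Longrightarrow> \<ominus>\<^bsub>poly_alg n\<^esub> x = - x"
proof -
  interpret cring "poly_alg n" by (rule poly_alg_cring)
  assume "x \<in> polys n"
  then show ?thesis using add.inv_equality[of "- x" x] by (simp add: a_inv_def)
qed

lemma poly_alg_induct [consumes 1, case_names zero add single]:
  assumes "f \<in> polys n" and "Q 0"
    and "\<And>f g. f \<in> polys n \<Longrightarrow> g \<in> polys n \<Longrightarrow> Q f \<Longrightarrow> Q g \<Longrightarrow> Q (f + g)"
    and "\<And>t c. Poly_Mapping.keys t \<subseteq> {..n} \<Longrightarrow> Q (Poly_Mapping.single t c)"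
  shows "Q f"
proof -
  \<comment> \<open>Membership is carried along because the \<open>add\<close> case may assume it
    for both summands.\<close>
  have "Q f \<and> f \<in> polys n"
  proof (rule poly_mapping_single_induct)
    fix t assume "t \<in> Poly_Mapping.keys f"
    then have "Poly_Mapping.keys t \<subseteq> {..n}"
      using assms(1) by (auto simp: polys_iff)
    then show "Q (Poly_Mapping.single t (Poly_Mapping.lookup f t)) \<and>
        Poly_Mapping.single t (Poly_Mapping.lookup f t) \<in> polys n"
      using assms(4) polys_single by blast
  qed (use assms(2,3) in auto)
  then show ?thesis ..
qed

subsection \<open>Homogeneous polynomials\<close>

lemma mon_degree_superset:
  assumes "finite A" "Poly_Mapping.keys t \<subseteq> A"
  shows "mon_degree t = (\<Sum>i\<in>A. Poly_Mapping.lookup t i)"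
  unfolding mon_degree_def using assms by (intro sum.mono_neutral_left) (auto simp: in_keys_iff)

lemma mon_degree_add [simp]: "mon_degree (s + t) = mon_degree s + mon_degree t"
proof -
  let ?A = "Poly_Mapping.keys s \<union> Poly_Mapping.keys t"
  have "mon_degree (s + t) = (\<Sum>i\<in>?A. Poly_Mapping.lookup (s + t) i)"
    by (rule mon_degree_superset) (auto simp: keys_nat_add)
  moreover have "mon_degree s = (\<Sum>i\<in>?A. Poly_Mapping.lookup s i)"
    by (rule mon_degree_superset) auto
  moreover have "mon_degree t = (\<Sum>i\<in>?A. Poly_Mapping.lookup t i)"
    by (rule mon_degree_superset) auto
  ultimately show ?thesis by (simp add: lookup_add sum.distrib)
qed

lemma mon_degree_zero [simp]: "mon_degree 0 = 0"
  by (simp add: mon_degree_def)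

lemma mon_degree_single [simp]: "mon_degree (Poly_Mapping.single i k) = k"
  by (simp add: mon_degree_def)

lemma hom_polysD: "f \<in> hom_polys n d \<Longrightarrow> f \<in> polys n"
  by (simp add: hom_polys_def)

lemma hom_polys_zero [intro, simp]: "0 \<in> hom_polys n d"
  by (simp add: hom_polys_def)

lemma hom_polys_add [intro]: "f \<in> hom_polys n d \<Longrightarrow> g \<in> hom_polys n d \<Longrightarrow> f + g \<in> hom_polys n d"
  using Poly_Mapping.keys_add[of f g] by (auto simp: hom_polys_def)

lemma hom_polys_uminus [intro]: "f \<in> hom_polys n d \<Longrightarrow> - f \<in> hom_polys n d"
  by (auto simp: hom_polys_def)

lemma hom_polys_diff [intro]: "f \<in> hom_polys n d \<Longrightarrow> g \<in> hom_polys n d \<Longrightarrow> f - g \<in> hom_polys n d"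
  using hom_polys_add[of f n d "- g"] by auto

lemma hom_polys_mult: "f \<in> hom_polys n d \<Longrightarrow> g \<in> hom_polys n e \<Longrightarrow> f * g \<in> hom_polys n (d + e)"
  using keys_mult[of f g] by (fastforce simp: hom_polys_def)

lemma hom_polys_single:
  "Poly_Mapping.keys t \<subseteq> {..n} \<Longrightarrow> mon_degree t = d \<Longrightarrow> Poly_Mapping.single t c \<in> hom_polys n d"
  by (simp add: hom_polys_def polys_single)

lemma hom_polys_const: "Poly_Mapping.single 0 c \<in> hom_polys n 0"
  by (simp add: hom_polys_def)

lemma hom_polys_one: "1 \<in> hom_polys n 0"
  using hom_polys_const[of 1 n] by simp

lemma hom_polys_smult: "f \<in> hom_polys n d \<Longrightarrow> Poly_Mapping.single 0 c * f \<in> hom_polys n d"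
  using hom_polys_mult[OF hom_polys_const] by force

lemma hom_polys_var: "i \<le> n \<Longrightarrow> poly_var i \<in> hom_polys n 1"
  unfolding poly_var_def by (rule hom_polys_single) auto

lemma hom_polys_power: "f \<in> hom_polys n d \<Longrightarrow> f ^ k \<in> hom_polys n (k * d)"
  by (induction k) (auto simp: hom_polys_one intro: hom_polys_mult)

lemma hom_polys_induct [consumes 1, case_names zero add single]:
  assumes "f \<in> hom_polys n d" and "Q 0"
    and "\<And>f g. f \<in> hom_polys n d \<Longrightarrow> g \<in> hom_polys n d \<Longrightarrow> Q f \<Longrightarrow> Q g \<Longrightarrow> Q (f + g)"
    and "\<And>t c. Poly_Mapping.keys t \<subseteq> {..n} \<Longrightarrow> mon_degree t = d \<Longrightarrow> Q (Poly_Mapping.single t c)"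
  shows "Q f"
proof -
  have "Q f \<and> f \<in> hom_polys n d"
  proof (rule poly_mapping_single_induct)
    fix t assume "t \<in> Poly_Mapping.keys f"
    then have "Poly_Mapping.keys t \<subseteq> {..n}" "mon_degree t = d"
      using assms(1) by (auto simp: hom_polys_def polys_iff)
    then show "Q (Poly_Mapping.single t (Poly_Mapping.lookup f t)) \<and>
        Poly_Mapping.single t (Poly_Mapping.lookup f t) \<in> hom_polys n d"
      using assms(4) hom_polys_single by blast
  qed (use assms(2,3) in auto)
  then show ?thesis ..
qed

subsection \<open>Partial derivatives\<close>

text \<open>The exponent subtraction truncates at 0. In a term free of \<open>X_i\<close> it leaves
  the exponent unchanged, and the coefficient factor is then 0.\<close>

definition partial :: "nat \<Rightarrow> 'k::field mpoly \<Rightarrow> 'k mpoly" where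
  "partial i f = (\<Sum>t\<in>Poly_Mapping.keys f. Poly_Mapping.single (t - Poly_Mapping.single i 1)
     (Poly_Mapping.lookup f t * of_nat (Poly_Mapping.lookup t i)))"

lemma partial_zero [simp]: "partial i 0 = 0"
  by (simp add: partial_def)

lemma partial_add [simp]: "partial i (f + g) = partial i f + partial i g"
  unfolding partial_def
  by (rule setsum_keys_plus_distrib[where f = "\<lambda>t c. Poly_Mapping.single (t - Poly_Mapping.single i 1)
     (c * of_nat (Poly_Mapping.lookup t i))"]) (auto simp: single_add algebra_simps)

lemma partial_single:
  "partial i (Poly_Mapping.single t c) =
     Poly_Mapping.single (t - Poly_Mapping.single i 1) (c * of_nat (Poly_Mapping.lookup t i))"
  by (simp add: partial_def)

lemma partial_uminus [simp]: "partial i (- f) = - partial i f"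
  using partial_add[of i f "- f"] by (simp add: eq_neg_iff_add_eq_0 add.commute)

lemma partial_diff [simp]: "partial i (f - g) = partial i f - partial i g"
  using partial_add[of i f "- g"] by simp

lemma partial_mult_single:
  fixes s t :: "nat \<Rightarrow>\<^sub>0 nat"
  shows "partial i (Poly_Mapping.single s a * Poly_Mapping.single t b) =
    partial i (Poly_Mapping.single s a) * Poly_Mapping.single t b
    + Poly_Mapping.single s a * partial i (Poly_Mapping.single t b)"
proof -
  let ?e = "Poly_Mapping.single i 1 :: nat \<Rightarrow>\<^sub>0 nat"
  have 1: "(s - ?e) + t = s + t - ?e" if "Poly_Mapping.lookup s i \<noteq> 0" for s t
    using that by (intro poly_mapping_eqI) (auto simp: lookup_add lookup_minus lookup_single when_def)
  \<comment> \<open>Without the condition of \<open>1\<close> the exponents may differ, but then the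
    coefficient is 0 and both terms vanish.\<close>
  have 2: "Poly_Mapping.single (s - ?e + t) (a * of_nat (Poly_Mapping.lookup s i) * b) =
      Poly_Mapping.single (s + t - ?e) (a * of_nat (Poly_Mapping.lookup s i) * b)" for s t :: "nat \<Rightarrow>\<^sub>0 nat" and a b :: 'a
    using 1[of s t] by (cases "Poly_Mapping.lookup s i = 0") auto
  show ?thesis
    using 2[of s t a b] 2[of t s b a]
    by (simp add: partial_single mult_single lookup_add algebra_simps flip: single_add)
qed

lemma partial_mult: "partial i (f * g) = partial i f * g + f * partial i g"
proof (rule poly_mapping_single_induct[of _ f])
  fix s
  let ?m = "Poly_Mapping.single s (Poly_Mapping.lookup f s)"
  show "partial i (?m * g) = partial i ?m * g + ?m * partial i g"
    by (rule poly_mapping_single_induct[of _ g])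
      (auto simp: algebra_simps partial_mult_single)
qed (auto simp: algebra_simps)

lemma partial_const [simp]: "partial i (Poly_Mapping.single 0 c) = 0"
  by (simp add: partial_single)

lemma partial_var: "partial i (poly_var j) = (if i = j then 1 else 0)"
  by (auto simp: poly_var_def partial_single lookup_single when_def)

lemma keys_minus_subset: "Poly_Mapping.keys (t - s) \<subseteq> Poly_Mapping.keys (t :: 'a \<Rightarrow>\<^sub>0 nat)"
  by (auto simp: in_keys_iff lookup_minus)

lemma partial_polys [intro, simp]: "f \<in> polys n \<Longrightarrow> partial i f \<in> polys n"
proof (induction rule: poly_alg_induct)
  case (single t c)
  then show ?case
    using keys_minus_subset[of t "Poly_Mapping.single i 1"]
    by (auto simp: partial_single intro!: polys_single)
qed auto

lemma mon_degree_minus_single: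
  assumes "Poly_Mapping.lookup t i \<noteq> 0"
  shows "mon_degree (t - Poly_Mapping.single i 1) = mon_degree t - 1"
proof -
  have "t = (t - Poly_Mapping.single i 1) + Poly_Mapping.single i 1"
    using assms by (intro poly_mapping_eqI) (auto simp: lookup_add lookup_minus lookup_single when_def)
  then have "mon_degree t = mon_degree (t - Poly_Mapping.single i 1) + 1"
    by (metis mon_degree_add mon_degree_single)
  then show ?thesis by simp
qed

text \<open>The truncation in \<open>d - 1\<close> is harmless: for \<open>d = 0\<close> the
  derivative is 0, which is homogeneous of every degree.\<close>

lemma partial_hom_polys: "f \<in> hom_polys n d \<Longrightarrow> partial i f \<in> hom_polys n (d - 1)"
proof (induction rule: hom_polys_induct)
  case (single t c)
  show ?case
  proof (cases "Poly_Mapping.lookup t i = 0")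
    case False
    then show ?thesis unfolding partial_single
      using single keys_minus_subset[of t "Poly_Mapping.single i 1"]
      by (intro hom_polys_single) (auto simp: mon_degree_minus_single[unfolded One_nat_def])
  qed (auto simp: partial_single)
qed auto

subsection \<open>Evaluation\<close>

lemma poly_eval_zero [simp]: "poly_eval 0 v = 0"
  by (simp add: poly_eval_def)

lemma poly_eval_add [simp]: "poly_eval (f + g) v = poly_eval f v + poly_eval g v"
  unfolding poly_eval_def
  by (rule setsum_keys_plus_distrib[where f = "\<lambda>t c. c * (\<Prod>i\<in>Poly_Mapping.keys t. v i ^ Poly_Mapping.lookup t i)"])
    (auto simp: algebra_simps)

lemma poly_eval_single:
  "poly_eval (Poly_Mapping.single t c) v = c * (\<Prod>i\<in>Poly_Mapping.keys t. v i ^ Poly_Mapping.lookup t i)"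
  by (simp add: poly_eval_def)

lemma poly_eval_mult_single:
  "poly_eval (Poly_Mapping.single s a * Poly_Mapping.single t b) v
     = poly_eval (Poly_Mapping.single s a) v * poly_eval (Poly_Mapping.single t b) v"
proof -
  let ?A = "Poly_Mapping.keys s \<union> Poly_Mapping.keys t"
  have *: "(\<Prod>i\<in>Poly_Mapping.keys u. v i ^ Poly_Mapping.lookup u i) = (\<Prod>i\<in>?A. v i ^ Poly_Mapping.lookup u i)"
    if "Poly_Mapping.keys u \<subseteq> ?A" for u
    using that by (intro prod.mono_neutral_left) (auto simp: in_keys_iff)
  show ?thesis
    by (simp add: mult_single poly_eval_single * keys_nat_add lookup_add power_add prod.distrib)
qed

lemma poly_eval_mult [simp]: "poly_eval (f * g) v = poly_eval f v * poly_eval g v"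
proof (rule poly_mapping_single_induct[of _ f])
  fix s
  let ?m = "Poly_Mapping.single s (Poly_Mapping.lookup f s)"
  show "poly_eval (?m * g) v = poly_eval ?m v * poly_eval g v"
    by (rule poly_mapping_single_induct[of _ g])
      (auto simp: algebra_simps poly_eval_mult_single)
qed (auto simp: algebra_simps)

lemma poly_eval_uminus [simp]: "poly_eval (- f) v = - poly_eval f v"
  using poly_eval_add[of f "- f" v] by (simp add: eq_neg_iff_add_eq_0 add.commute)

lemma poly_eval_diff [simp]: "poly_eval (f - g) v = poly_eval f v - poly_eval g v"
  using poly_eval_add[of f "- g" v] by simp

lemma poly_eval_const [simp]: "poly_eval (Poly_Mapping.single 0 c) v = c"
  by (simp add: poly_eval_single)

lemma poly_eval_var [simp]: "poly_eval (poly_var i) v = v i"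
  by (simp add: poly_var_def poly_eval_single)

lemma poly_eval_sum: "poly_eval (sum f A) v = (\<Sum>a\<in>A. poly_eval (f a) v)"
  by (induction A rule: infinite_finite_induct) auto

lemma poly_eval_scale:
  assumes "f \<in> hom_polys n d" and "\<forall>i\<le>n. w i = c * v i"
  shows "poly_eval f w = c ^ d * poly_eval f v"
  using assms(1)
proof (induction rule: hom_polys_induct)
  case (single t a)
  have "(\<Prod>i\<in>Poly_Mapping.keys t. w i ^ Poly_Mapping.lookup t i)
      = (\<Prod>i\<in>Poly_Mapping.keys t. c ^ Poly_Mapping.lookup t i * v i ^ Poly_Mapping.lookup t i)"
    using single assms(2) by (intro prod.cong) (auto simp: power_mult_distrib)
  also have "\<dots> = c ^ mon_degree t * (\<Prod>i\<in>Poly_Mapping.keys t. v i ^ Poly_Mapping.lookup t i)"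
    by (simp add: prod.distrib mon_degree_def power_sum)
  finally show ?case using single by (simp add: poly_eval_single)
qed (auto simp: algebra_simps)

section \<open>Powers of the ideal of a point\<close>

lemma poly_idealI:
  fixes I :: "'k::field mpoly set"
  assumes "I \<subseteq> polys n" "0 \<in> I" "\<And>f g. f \<in> I \<Longrightarrow> g \<in> I \<Longrightarrow> f + g \<in> I"
    and "\<And>a f. a \<in> polys n \<Longrightarrow> f \<in> I \<Longrightarrow> a * f \<in> I"
  shows "ideal I (poly_alg n)"
proof -
  interpret cring "poly_alg n :: ('k, 'k mpoly) module" by (rule poly_alg_cring)
  show ?thesis
  proof (rule idealI)
    show "subgroup I (add_monoid (poly_alg n))"
    proof (rule add.subgroupI)
      fix a assume a: "a \<in> I"
      then have "(-1) * a \<in> I" by (intro assms) auto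
      then have "- a \<in> I" by simp
      then show "\<ominus>\<^bsub>poly_alg n\<^esub> a \<in> I"
        using a assms(1) by (simp add: poly_alg_uminus subset_iff)
    qed (use assms in auto)
  next
    fix a x :: "'k mpoly" assume "a \<in> I" "x \<in> polys n"
    then have "x * a \<in> I" by (intro assms)
    then show "x \<otimes>\<^bsub>poly_alg n\<^esub> a \<in> I" "a \<otimes>\<^bsub>poly_alg n\<^esub> x \<in> I"
      by (simp_all add: mult.commute)
  qed (rule ring_axioms)
qed

lemma poly_ideal_subset: "ideal I (poly_alg n) \<Longrightarrow> f \<in> I \<Longrightarrow> f \<in> polys n"
  using ideal.Icarr by fastforce

lemma poly_ideal_zero [simp]: "ideal I (poly_alg n) \<Longrightarrow> 0 \<in> I"
  using additive_subgroup.zero_closed[OF ideal.axioms(1)] by fastforce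

lemma poly_ideal_add: "ideal I (poly_alg n) \<Longrightarrow> f \<in> I \<Longrightarrow> g \<in> I \<Longrightarrow> f + g \<in> I"
  using additive_subgroup.a_closed[OF ideal.axioms(1)] by fastforce

lemma poly_ideal_mult: "ideal I (poly_alg n) \<Longrightarrow> a \<in> polys n \<Longrightarrow> f \<in> I \<Longrightarrow> a * f \<in> I"
  using ideal.I_l_closed by fastforce

lemma poly_ideal_mult2: "ideal I (poly_alg n) \<Longrightarrow> a \<in> polys n \<Longrightarrow> f \<in> I \<Longrightarrow> f * a \<in> I"
  using poly_ideal_mult by (metis mult.commute)

lemma poly_ideal_uminus: "ideal I (poly_alg n) \<Longrightarrow> f \<in> I \<Longrightarrow> - f \<in> I"
  using poly_ideal_mult[of I n "-1" f] by auto

lemma poly_ideal_diff: "ideal I (poly_alg n) \<Longrightarrow> f \<in> I \<Longrightarrow> g \<in> I \<Longrightarrow> f - g \<in> I"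
  using poly_ideal_add[of I n f "- g"] by (simp add: poly_ideal_uminus)

lemma poly_ideal_sum:
  "ideal I (poly_alg n) \<Longrightarrow> (\<And>a. a \<in> A \<Longrightarrow> f a \<in> I) \<Longrightarrow> sum f A \<in> I"
  by (induction A rule: infinite_finite_induct) (auto intro: poly_ideal_add)

lemma poly_ideal_minus_commute: "ideal I (poly_alg n) \<Longrightarrow> f - g \<in> I \<Longrightarrow> g - f \<in> I"
  using poly_ideal_uminus by fastforce

lemma poly_ideal_trans: "ideal I (poly_alg n) \<Longrightarrow> f - g \<in> I \<Longrightarrow> g - h \<in> I \<Longrightarrow> f - h \<in> I"
  using poly_ideal_add[of I n "f - g" "g - h"] by simp

lemma poly_ideal_cong_mult:
  assumes "ideal I (poly_alg n)" "f - f' \<in> I" "g - g' \<in> I" "g \<in> polys n" "f' \<in> polys n"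
  shows "f * g - f' * g' \<in> I"
proof -
  have "f * g - f' * g' = (f - f') * g + f' * (g - g')" by (simp add: algebra_simps)
  then show ?thesis using assms by (metis poly_ideal_add poly_ideal_mult poly_ideal_mult2)
qed

text \<open>Characteristic 0 enters here: a positive integer is an invertible constant. The two uses
  divide by the vanishing order in Euler's identity and by n + \<nu> in the divergence
  identity.\<close>

lemma poly_ideal_of_nat_cancel:
  fixes I :: "'k::field_char_0 mpoly set"
  assumes "ideal I (poly_alg n)" "of_nat (Suc k) * f \<in> I"
  shows "f \<in> I"
proof -
  have "Poly_Mapping.single 0 (inverse (of_nat (Suc k))) * (of_nat (Suc k) * f) \<in> I"
    by (rule poly_ideal_mult[OF assms(1) _ assms(2)]) auto
  moreover have "Poly_Mapping.single 0 (inverse (of_nat (Suc k))) * of_nat (Suc k) = (1 :: 'k mpoly)"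
  proof -
    have "(of_nat (Suc k) :: 'k mpoly) = Poly_Mapping.single 0 (of_nat (Suc k))"
      by (simp only: single_of_nat)
    then show ?thesis
      by (simp add: mult_single del: single_of_nat of_nat_Suc)
  qed
  ultimately show ?thesis by (simp flip: mult.assoc del: of_nat_Suc)
qed

section \<open>Powers of a point ideal and their behaviour under differentiation\<close>

definition point_power :: "nat \<Rightarrow> (nat \<Rightarrow> 'k::field) set \<Rightarrow> nat \<Rightarrow> 'k mpoly set" where
  "point_power n P k = point_ideal n P [^]\<^bsub>ideals_set (poly_alg n)\<^esub> k"

lemma point_power_0 [simp]: "point_power n P 0 = polys n"
  by (simp add: point_power_def nat_pow_def ideals_set_def)

lemma point_power_Suc: "point_power n P (Suc k) = ideal_prod (poly_alg n) (point_power n P k) (point_ideal n P)"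
  by (simp add: point_power_def nat_pow_def ideals_set_def)

lemma ideal_point_ideal: "ideal (point_ideal n P) (poly_alg n)"
proof -
  interpret cring "poly_alg n" by (rule poly_alg_cring)
  show ?thesis unfolding point_ideal_def
    by (rule genideal_ideal) (auto simp: hom_polys_def)
qed

lemma ideal_point_power: "ideal (point_power n P k) (poly_alg n)"
proof -
  interpret cring "poly_alg n" by (rule poly_alg_cring)
  show ?thesis
    by (induction k) (auto simp: point_power_Suc oneideal ideal_point_ideal intro: ideal_prod_is_ideal)
qed

lemma point_power_decr: "f \<in> point_power n P (Suc k) \<Longrightarrow> f \<in> point_power n P k"
proof -
  interpret cring "poly_alg n" by (rule poly_alg_cring)
  show "f \<in> point_power n P (Suc k) \<Longrightarrow> f \<in> point_power n P k" for f :: "'a mpoly"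
    unfolding point_power_Suc
    using ideal_prod_inter[OF ideal_point_power[of n P k] ideal_point_ideal[of n P]] by blast
qed

lemma point_power_antimono: "j \<le> k \<Longrightarrow> f \<in> point_power n P k \<Longrightarrow> f \<in> point_power n P j"
  by (induction rule: dec_induct) (auto dest: point_power_decr)

lemma point_power_SucI:
  "f \<in> point_power n P k \<Longrightarrow> g \<in> point_ideal n P \<Longrightarrow> f * g \<in> point_power n P (Suc k)"
  unfolding point_power_Suc using ideal_prod.prod[of f _ g _ "poly_alg n"] by auto

text \<open>A product of ideals is the additive closure of products of two elements, so additive
  properties need checking only on \<open>g * h\<close>.\<close>

lemma point_power_Suc_induct [consumes 1, case_names mult add]:
  assumes "f \<in> point_power n P (Suc k)"
    and "\<And>g h. g \<in> point_power n P k \<Longrightarrow> h \<in> point_ideal n P \<Longrightarrow> Q (g * h)"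
    and "\<And>f g. f \<in> point_power n P (Suc k) \<Longrightarrow> g \<in> point_power n P (Suc k) \<Longrightarrow> Q f \<Longrightarrow> Q g \<Longrightarrow> Q (f + g)"
  shows "Q f"
  using assms(1) unfolding point_power_Suc
  by (induction rule: ideal_prod.induct) (use assms(2,3) in \<open>auto simp: point_power_Suc\<close>)

lemma point_power_one [simp]: "point_power n P (Suc 0) = point_ideal n P"
proof (intro equalityI subsetI)
  fix f assume "f \<in> point_power n P (Suc 0)"
  then show "f \<in> point_ideal n P"
    by (induction rule: point_power_Suc_induct)
      (auto intro: poly_ideal_add poly_ideal_mult ideal_point_ideal)
next
  fix f assume "f \<in> point_ideal n P"
  then have "1 * f \<in> point_power n P (Suc 0)" by (intro point_power_SucI) auto
  then show "f \<in> point_power n P (Suc 0)" by simp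
qed

lemma point_power_mult:
  "f \<in> point_power n P j \<Longrightarrow> g \<in> point_power n P k \<Longrightarrow> f * g \<in> point_power n P (j + k)"
proof (induction k arbitrary: g)
  case 0
  then show ?case by (auto intro: poly_ideal_mult2 ideal_point_power)
next
  case (Suc k)
  show ?case using Suc.prems(2)
  proof (induction rule: point_power_Suc_induct)
    case (mult g h)
    then have "(f * g) * h \<in> point_power n P (Suc (j + k))"
      by (intro point_power_SucI Suc.IH Suc.prems)
    then show ?case by (simp add: mult.assoc)
  next
    case (add g h)
    then show ?case by (simp add: algebra_simps poly_ideal_add[OF ideal_point_power])
  qed
qed

lemma point_power_power: "f \<in> point_ideal n P \<Longrightarrow> f ^ k \<in> point_power n P k"
proof (induction k)
  case (Suc k)
  then have "f ^ k * f \<in> point_power n P (Suc k)" by (intro point_power_SucI) auto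
  then show ?case by (simp add: mult.commute)
qed auto

text \<open>By the product rule on \<open>g * h\<close>: differentiating \<open>g\<close> loses one
  order, which the factor \<open>h\<close> restores, and differentiating \<open>h\<close> leaves the
  order of \<open>g\<close> intact.\<close>

lemma partial_point_power:
  "f \<in> point_power n P (Suc k) \<Longrightarrow> partial i f \<in> point_power n P k"
proof (induction k arbitrary: f)
  case 0
  then have "f \<in> polys n" by (rule poly_ideal_subset[OF ideal_point_power])
  then show ?case by simp
next
  case (Suc k)
  show ?case using Suc.prems
  proof (induction rule: point_power_Suc_induct)
    case (mult g h)
    then have "partial i g * h \<in> point_power n P (Suc k)"
      by (intro point_power_SucI Suc.IH)
    moreover have "g * partial i h \<in> point_power n P (Suc k)"
      using mult poly_ideal_subset[OF ideal_point_ideal]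
      by (intro poly_ideal_mult2[OF ideal_point_power]) auto
    ultimately show ?case by (simp add: partial_mult poly_ideal_add[OF ideal_point_power])
  qed (simp add: poly_ideal_add[OF ideal_point_power])
qed

text \<open>A point off the hyperplane X_0 = 0 has a unique coordinate vector with first entry 1.
  Fixing it as \<open>p\<close> turns the other entries into affine coordinates.\<close>

locale affine_point =
  fixes n :: nat and P :: "(nat \<Rightarrow> 'k::field_char_0) set" and p :: "nat \<Rightarrow> 'k"
  assumes coord0 [simp]: "p 0 = 1"
    and rep_mem: "p \<in> P"
    and rep: "\<And>w. w \<in> P \<Longrightarrow> \<exists>c. \<forall>i\<le>n. w i = c * p i"
begin

text \<open>These are the homogeneous versions of the affine coordinates centred at the point. Since
  \<open>Y 0\<close> is 0, a sum over all \<open>i \<le> n\<close> has effectively only n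
  terms.\<close>

definition Y :: "nat \<Rightarrow> 'k mpoly" where
  "Y i = poly_var i - Poly_Mapping.single 0 (p i) * poly_var 0"

lemma Y_0 [simp]: "Y 0 = 0"
  by (simp add: Y_def)

lemma Y_hom: "i \<le> n \<Longrightarrow> Y i \<in> hom_polys n 1"
  unfolding Y_def using hom_polys_smult[OF hom_polys_var[of 0 n]]
  by (auto intro!: hom_polys_diff hom_polys_var[unfolded One_nat_def])

lemma Y_polys [simp]: "i \<le> n \<Longrightarrow> Y i \<in> polys n"
  by (rule hom_polysD[OF Y_hom])

lemma poly_eval_Y: "i \<le> n \<Longrightarrow> \<forall>i\<le>n. w i = c * p i \<Longrightarrow> poly_eval (Y i) w = 0"
  by (auto simp: Y_def)

lemma point_ideal_homI:
  assumes "f \<in> hom_polys n d" "poly_eval f p = 0"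
  shows "f \<in> point_ideal n P"
proof -
  interpret cring "poly_alg n :: ('k, 'k mpoly) module" by (rule poly_alg_cring)
  have "poly_eval f v = 0" if "v \<in> P" for v
    using rep[OF that] poly_eval_scale[OF assms(1), of v _ p] assms(2) by auto
  then have "f \<in> {f. (\<exists>d. f \<in> hom_polys n d) \<and> (\<forall>v\<in>P. poly_eval f v = 0)}"
    using assms by auto
  then show ?thesis unfolding point_ideal_def
    using genideal_self[of "{f. (\<exists>d. f \<in> hom_polys n d) \<and> (\<forall>v\<in>P. poly_eval f v = 0)}"]
    by (auto simp: hom_polys_def)
qed

lemma Y_mem: "i \<le> n \<Longrightarrow> Y i \<in> point_ideal n P"
  using poly_eval_Y[of i p 1] by (intro point_ideal_homI[OF Y_hom]) auto

text \<open>The ideal generated by the \<open>Y i\<close>, written so that membership yields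
  coefficients. It turns out to contain the point ideal, and the Euler derivation is computed on
  this form.\<close>

definition L :: "'k mpoly set" where
  "L = {f. \<exists>a. (\<forall>i\<le>n. a i \<in> polys n) \<and> f = (\<Sum>i\<le>n. a i * Y i)}"

lemma LI: "(\<And>i. i \<le> n \<Longrightarrow> a i \<in> polys n) \<Longrightarrow> (\<Sum>i\<le>n. a i * Y i) \<in> L"
  by (auto simp: L_def)

lemma ideal_L: "ideal L (poly_alg n)"
proof (rule poly_idealI)
  show "L \<subseteq> polys n" by (auto simp: L_def intro!: polys_sum)
  show "0 \<in> L" using LI[of "\<lambda>_. 0"] by simp
next
  fix f g assume "f \<in> L" "g \<in> L"
  then obtain a b where "\<forall>i\<le>n. a i \<in> polys n" "f = (\<Sum>i\<le>n. a i * Y i)"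
      "\<forall>i\<le>n. b i \<in> polys n" "g = (\<Sum>i\<le>n. b i * Y i)"
    by (auto simp: L_def)
  then show "f + g \<in> L"
    using LI[of "\<lambda>i. a i + b i"] by (simp add: algebra_simps sum.distrib)
next
  fix c f :: "'k mpoly" assume c: "c \<in> polys n" and "f \<in> L"
  then obtain a where "\<forall>i\<le>n. a i \<in> polys n" "f = (\<Sum>i\<le>n. a i * Y i)"
    by (auto simp: L_def)
  then show "c * f \<in> L"
    using LI[of "\<lambda>i. c * a i"] c by (simp add: algebra_simps sum_distrib_left)
qed

lemma Y_L:
  assumes "i \<le> n" shows "Y i \<in> L"
proof -
  have "(\<Sum>j\<le>n. (if j = i then 1 else 0) * Y j) = (\<Sum>j\<le>n. if j = i then Y j else 0)"
    by (intro sum.cong) auto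
  then show ?thesis using LI[of "\<lambda>j. if j = i then 1 else 0"] assms by simp
qed

text \<open>Modulo \<open>L\<close> each variable X_i equals p_i X_0, so a monomial of degree d
  collapses to its value at \<open>p\<close> times X_0^d. The induction trades one variable at a
  time.\<close>

lemma monomial_cong_L:
  assumes "Poly_Mapping.keys t \<subseteq> {..n}" "mon_degree t = d"
  shows "Poly_Mapping.single t c - Poly_Mapping.single 0 (poly_eval (Poly_Mapping.single t c) p) * poly_var 0 ^ d \<in> L"
  using assms
proof (induction d arbitrary: t)
  case 0
  then have "t = 0"
    by (intro poly_mapping_eqI) (auto simp: mon_degree_def in_keys_iff)
  then show ?case using poly_ideal_zero[OF ideal_L] by simp
next
  case (Suc d)
  then obtain i where i: "i \<in> Poly_Mapping.keys t"
    by (metis Zero_not_Suc all_not_in_conv mon_degree_def sum.empty)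
  define s where "s = t - Poly_Mapping.single i 1"
  have nz: "Poly_Mapping.lookup t i \<noteq> 0" using i by (simp add: in_keys_iff)
  then have t: "t = Poly_Mapping.single i 1 + s"
    unfolding s_def
    by (intro poly_mapping_eqI) (auto simp: lookup_add lookup_minus lookup_single when_def)
  have in_le: "i \<le> n" using i Suc.prems by auto
  let ?m = "Poly_Mapping.single s c"
  have m: "Poly_Mapping.single t c = poly_var i * ?m"
    by (simp add: t poly_var_def mult_single)
  have s: "Poly_Mapping.keys s \<subseteq> {..n}" "mon_degree s = d"
    using Suc.prems keys_minus_subset[of t "Poly_Mapping.single i 1"] mon_degree_minus_single[OF nz]
    by (auto simp: s_def)
  have ev: "Poly_Mapping.single 0 (poly_eval (Poly_Mapping.single t c) p)
      = Poly_Mapping.single 0 (p i) * Poly_Mapping.single 0 (poly_eval ?m p)"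
    by (simp only: m poly_eval_mult poly_eval_var mult_single add_0)
  \<comment> \<open>This is X_i = Y_i + p_i X_0 applied to the variable split off, followed by the
    induction hypothesis for the remaining monomial.\<close>
  have "Poly_Mapping.single t c - Poly_Mapping.single 0 (poly_eval (Poly_Mapping.single t c) p) * poly_var 0 ^ Suc d
     = ?m * Y i + (Poly_Mapping.single 0 (p i) * poly_var 0) *
       (?m - Poly_Mapping.single 0 (poly_eval ?m p) * poly_var 0 ^ d)"
    unfolding ev unfolding m by (simp add: Y_def algebra_simps)
  moreover have "?m * Y i \<in> L"
    using Y_L[OF in_le] polys_single[OF s(1)] by (intro poly_ideal_mult[OF ideal_L]) auto
  moreover have "(Poly_Mapping.single 0 (p i) * poly_var 0) *
       (?m - Poly_Mapping.single 0 (poly_eval ?m p) * poly_var 0 ^ d) \<in> L"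
    by (intro poly_ideal_mult[OF ideal_L] Suc.IH s) auto
  ultimately show ?case by (simp add: poly_ideal_add[OF ideal_L])
qed

lemma hom_cong_L:
  "f \<in> hom_polys n d \<Longrightarrow> f - Poly_Mapping.single 0 (poly_eval f p) * poly_var 0 ^ d \<in> L"
proof (induction rule: hom_polys_induct)
  case (add f g)
  have "f + g - Poly_Mapping.single 0 (poly_eval (f + g) p) * poly_var 0 ^ d =
    (f - Poly_Mapping.single 0 (poly_eval f p) * poly_var 0 ^ d) +
    (g - Poly_Mapping.single 0 (poly_eval g p) * poly_var 0 ^ d)"
    by (simp add: single_add algebra_simps)
  then show ?case using add poly_ideal_add[OF ideal_L] by metis
qed (auto intro: monomial_cong_L poly_ideal_zero[OF ideal_L])

text \<open>A homogeneous generator vanishes at \<open>p\<close>, so the X_0^d term in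
  \<open>hom_cong_L\<close> drops out.\<close>

lemma point_ideal_subset_L: "point_ideal n P \<subseteq> L"
proof -
  interpret cring "poly_alg n :: ('k, 'k mpoly) module" by (rule poly_alg_cring)
  have "f \<in> L" if "(f :: 'k mpoly) \<in> hom_polys n d" "\<forall>v\<in>P. poly_eval f v = 0" for f d
    using hom_cong_L[OF that(1)] that(2) rep_mem by simp
  then show ?thesis unfolding point_ideal_def
    by (intro genideal_minimal ideal_L) auto
qed

lemma point_ideal_eval: "f \<in> point_ideal n P \<Longrightarrow> poly_eval f p = 0"
  using point_ideal_subset_L poly_eval_Y[of _ p 1] by (auto simp: L_def poly_eval_sum)

text \<open>The Euler derivation of the coordinates centred at the point acts on the successive
  quotients of the powers of the point ideal as multiplication by the exponent.\<close>

definition euler :: "'k mpoly \<Rightarrow> 'k mpoly" where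
  "euler f = (\<Sum>i\<le>n. Y i * partial i f)"

lemma euler_add [simp]: "euler (f + g) = euler f + euler g"
  by (simp add: euler_def algebra_simps sum.distrib)

lemma euler_mult: "euler (f * g) = f * euler g + euler f * g"
  by (simp add: euler_def partial_mult algebra_simps sum.distrib sum_distrib_left)

lemma euler_sum: "euler (sum f A) = (\<Sum>a\<in>A. euler (f a))"
  by (induction A rule: infinite_finite_induct) (simp_all, simp_all add: euler_def)

lemma euler_mem: "f \<in> polys n \<Longrightarrow> euler f \<in> point_ideal n P"
  unfolding euler_def
  by (intro poly_ideal_sum[OF ideal_point_ideal] poly_ideal_mult2[OF ideal_point_ideal] Y_mem) auto

lemma partial_Y: "partial j (Y i) = (if j = i then 1 else 0) - Poly_Mapping.single 0 (p i) * (if j = 0 then 1 else 0)"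
  by (simp add: Y_def partial_mult partial_var)

lemma euler_Y: assumes "i \<le> n" shows "euler (Y i) = Y i"
proof -
  \<comment> \<open>The second part is the dependence of \<open>Y i\<close> on X_0; it is multiplied
    by \<open>Y 0\<close>, which is 0.\<close>
  have "euler (Y i) = (\<Sum>j\<le>n. (if j = i then Y j else 0) - (if j = 0 then Poly_Mapping.single 0 (p i) * Y 0 else 0))"
    unfolding euler_def partial_Y by (intro sum.cong) (auto simp: algebra_simps)
  then show ?thesis using assms by (simp add: sum_subtractf)
qed

text \<open>With f a sum of a_i Y_i and \<open>euler\<close> fixing each Y_i, the difference is the
  sum of \<open>euler\<close> (a_i) Y_i, and \<open>euler\<close> always lands in the point
  ideal.\<close>

lemma euler_point_ideal:
  assumes "f \<in> point_ideal n P"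
  shows "euler f - f \<in> point_power n P 2"
proof -
  obtain a where a: "\<forall>i\<le>n. a i \<in> polys n" "f = (\<Sum>i\<le>n. a i * Y i)"
    using assms point_ideal_subset_L by (auto simp: L_def)
  have "euler f - f = (\<Sum>i\<le>n. euler (a i) * Y i)"
    unfolding a(2) by (simp add: euler_sum euler_mult euler_Y sum.distrib)
  moreover have "euler (a i) * Y i \<in> point_power n P (Suc (Suc 0))" if "i \<le> n" for i
    using that a by (intro point_power_SucI) (auto intro: euler_mem Y_mem)
  ultimately show ?thesis
    by (auto simp: numeral_2_eq_2 intro: poly_ideal_sum[OF ideal_point_power])
qed

text \<open>On a product \<open>g * h\<close> the product rule adds the exponents: \<open>g\<close>
  contributes k and \<open>h\<close> contributes 1, and each error term has one order more.\<close>

lemma euler_point_power: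
  "f \<in> point_power n P k \<Longrightarrow> euler f - of_nat k * f \<in> point_power n P (Suc k)"
proof (induction k arbitrary: f)
  case 0
  then show ?case by (auto intro: euler_mem)
next
  case (Suc k)
  show ?case using Suc.prems
  proof (induction rule: point_power_Suc_induct)
    case (mult g h)
    have "g * (euler h - h) \<in> point_power n P (k + 2)"
      using mult by (intro point_power_mult euler_point_ideal)
    moreover have "(euler g - of_nat k * g) * h \<in> point_power n P (Suc (Suc k))"
      using mult by (intro point_power_SucI Suc.IH)
    moreover have "euler (g * h) - of_nat (Suc k) * (g * h) =
        g * (euler h - h) + (euler g - of_nat k * g) * h"
      by (simp add: euler_mult algebra_simps)
    ultimately show ?case by (simp add: poly_ideal_add[OF ideal_point_power])
  next
    case (add f g)
    have "euler (f + g) - of_nat (Suc k) * (f + g) =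
       (euler f - of_nat (Suc k) * f) + (euler g - of_nat (Suc k) * g)"
      by (simp add: algebra_simps)
    then show ?case using add by (metis poly_ideal_add[OF ideal_point_power])
  qed
qed

text \<open>For i different from 0 the derivative \<open>partial i\<close> commutes with
  multiplication by X_0, so the induction hypothesis puts these derivatives of h in the k-th power;
  the index 0 does not matter since \<open>Y 0\<close> is 0. Hence \<open>euler h\<close> lies in
  the next power, and Euler's identity recovers h after division by k.\<close>

lemma point_power_cancel_X0:
  "h \<in> hom_polys n d \<Longrightarrow> poly_var 0 * h \<in> point_power n P k \<Longrightarrow> h \<in> point_power n P k"
proof (induction k arbitrary: h d)
  case 0
  then show ?case by (simp add: hom_polysD)
next
  case (Suc k)
  have h: "h \<in> point_power n P k"
    using Suc.IH[OF Suc.prems(1)] point_power_decr[OF Suc.prems(2)] .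
  \<comment> \<open>Division by k is impossible for k = 0; there it suffices to evaluate at
    \<open>p\<close>, where X_0 takes the value 1.\<close>
  show ?case
  proof (cases k)
    case 0
    then have "poly_eval (poly_var 0 * h) p = 0"
      using Suc.prems by (intro point_ideal_eval) auto
    then have "poly_eval h p = 0" by simp
    then show ?thesis using 0 point_ideal_homI[OF Suc.prems(1)] by simp
  next
    case k: (Suc k')
    have "Y i * partial i h \<in> point_power n P (Suc k)" if i: "i \<le> n" for i
    proof (cases "i = 0")
      case True
      then show ?thesis using poly_ideal_zero[OF ideal_point_power] by simp
    next
      case False
      have "partial i (poly_var 0 * h) = poly_var 0 * partial i h"
        using False by (simp add: partial_mult partial_var)
      then have "poly_var 0 * partial i h \<in> point_power n P k"
        using partial_point_power[OF Suc.prems(2), of i] by simp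
      then have "partial i h \<in> point_power n P k"
        by (rule Suc.IH[OF partial_hom_polys[OF Suc.prems(1)]])
      then have "partial i h * Y i \<in> point_power n P (Suc k)"
        by (rule point_power_SucI[OF _ Y_mem[OF i]])
      then show ?thesis by (simp add: mult.commute)
    qed
    then have "euler h \<in> point_power n P (Suc k)"
      unfolding euler_def by (intro poly_ideal_sum[OF ideal_point_power]) auto
    moreover have "euler h - of_nat k * h \<in> point_power n P (Suc k)"
      by (rule euler_point_power[OF h])
    ultimately have "of_nat k * h \<in> point_power n P (Suc k)"
      using poly_ideal_diff[OF ideal_point_power] by fastforce
    then show ?thesis unfolding k by (rule poly_ideal_of_nat_cancel[OF ideal_point_power])
  qed
qed

text \<open>The divergence of the Euler field is n and not n + 1, because \<open>Y 0\<close> is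
  0.\<close>

lemma sum_partial_Y: "(\<Sum>i\<le>n. partial i (Y i)) = of_nat n"
proof -
  have "(\<Sum>i\<le>n. partial i (Y i)) = (\<Sum>i\<le>n. 1 - (if i = 0 then 1 else 0))"
    unfolding partial_Y by (intro sum.cong) auto
  then show ?thesis by (simp add: sum_subtractf)
qed

end

section \<open>Ideals of fat points\<close>

lemma polys_of_nat [simp, intro]: "of_nat k \<in> polys n"
  by (induction k) auto

lemma fat_ideal_iff: "f \<in> fat_ideal n k X \<longleftrightarrow> f \<in> polys n \<and> (\<forall>P\<in>X. f \<in> point_power n P k)"
  by (simp add: fat_ideal_def point_power_def)

lemma ideal_fat_ideal: "ideal (fat_ideal n k X) (poly_alg n)"
  by (rule poly_idealI)
    (auto simp: fat_ideal_iff poly_ideal_zero[OF ideal_point_power] poly_ideal_add[OF ideal_point_power]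
      poly_ideal_mult[OF ideal_point_power])

lemma fat_ideal_decr: "f \<in> fat_ideal n (Suc k) X \<Longrightarrow> f \<in> fat_ideal n k X"
  by (auto simp: fat_ideal_iff intro: point_power_decr)

lemma partial_fat_ideal: "f \<in> fat_ideal n (Suc k) X \<Longrightarrow> partial i f \<in> fat_ideal n k X"
  by (auto simp: fat_ideal_iff intro: partial_point_power)

text \<open>The case \<open>h = 0\<close> is separate because the degree \<open>m - 1\<close> would be truncated for \<open>m = 0\<close>.\<close>

definition monic_mod_X0 :: "nat \<Rightarrow> nat \<Rightarrow> nat \<Rightarrow> 'k::field mpoly \<Rightarrow> bool" where
  "monic_mod_X0 n i m f \<longleftrightarrow> (\<exists>h. f = poly_var i ^ m - poly_var 0 * h \<and>
     (h = 0 \<or> (\<exists>m'. m = Suc m' \<and> h \<in> hom_polys n m')))"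

lemma monic_mod_X0_one: "monic_mod_X0 n i 0 1"
  by (auto simp: monic_mod_X0_def)

lemma monic_mod_X0_mult:
  assumes i: "i \<le> n" and f: "monic_mod_X0 n i m f" and g: "monic_mod_X0 n i l g"
  shows "monic_mod_X0 n i (m + l) (f * g)"
proof -
  obtain h h' where h: "f = poly_var i ^ m - poly_var 0 * h" "h = 0 \<or> (\<exists>m'. m = Suc m' \<and> h \<in> hom_polys n m')"
    and h': "g = poly_var i ^ l - poly_var 0 * h'" "h' = 0 \<or> (\<exists>l'. l = Suc l' \<and> h' \<in> hom_polys n l')"
    using f g by (auto simp: monic_mod_X0_def)
  \<comment> \<open>Obtained by expanding the product of the two factors and taking one X_0 out of
    everything except the leading power.\<close>
  define k where "k = h * poly_var i ^ l + poly_var i ^ m * h' - poly_var 0 * (h * h')"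
  have pow: "poly_var i ^ j \<in> hom_polys n j" for j
    using hom_polys_power[OF hom_polys_var[OF i], of j] by simp
  have a: "h * poly_var i ^ l \<in> hom_polys n (m + l - 1)"
    using h(2) hom_polys_mult[OF _ pow[of l]] by auto
  have b: "poly_var i ^ m * h' \<in> hom_polys n (m + l - 1)"
    using h'(2) hom_polys_mult[OF pow[of m]] by auto
  have c: "poly_var 0 * (h * h') \<in> hom_polys n (m + l - 1)"
  proof (cases "h = 0 \<or> h' = 0")
    case False
    then obtain m' l' where "m = Suc m'" "l = Suc l'" "h \<in> hom_polys n m'" "h' \<in> hom_polys n l'"
      using h(2) h'(2) by auto
    then show ?thesis
      using hom_polys_mult[OF hom_polys_var[of 0 n] hom_polys_mult[of h n m' h' l']] by simp
  qed auto
  have "k \<in> hom_polys n (m + l - 1)"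
    unfolding k_def by (intro hom_polys_add hom_polys_diff a b c)
  \<comment> \<open>In total degree 0 the exponent \<open>m + l - 1\<close> is truncated, so
    membership in \<open>hom_polys\<close> alone would not give the second alternative.\<close>
  moreover have "k = 0" if "m + l = 0"
    using h(2) h'(2) that by (auto simp: k_def)
  ultimately have "k = 0 \<or> (\<exists>m'. m + l = Suc m' \<and> k \<in> hom_polys n m')"
    by (cases "m + l") auto
  moreover have "f * g = poly_var i ^ (m + l) - poly_var 0 * k"
    by (simp add: h(1) h'(1) k_def power_add algebra_simps)
  ultimately show ?thesis by (auto simp: monic_mod_X0_def)
qed

lemma monic_mod_X0_power: "i \<le> n \<Longrightarrow> monic_mod_X0 n i m f \<Longrightarrow> monic_mod_X0 n i (k * m) (f ^ k)"
proof (induction k)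
  case (Suc k)
  then show ?case using monic_mod_X0_mult[of i n m f "k * m" "f ^ k"] by simp
qed (simp add: monic_mod_X0_one)

lemma monic_mod_X0_prod:
  assumes "i \<le> n" "finite A" "\<And>a. a \<in> A \<Longrightarrow> monic_mod_X0 n i m (f a)"
  shows "monic_mod_X0 n i (card A * m) (prod f A)"
  using assms(2,3)
proof (induction A)
  case (insert a A)
  then show ?case
    using monic_mod_X0_mult[OF assms(1), of m "f a" "card A * m" "prod f A"] by simp
qed (simp add: monic_mod_X0_one)

lemma single_split:
  assumes "e \<le> Poly_Mapping.lookup t i" "Poly_Mapping.keys t \<subseteq> {..n}"
  obtains s where "Poly_Mapping.keys s \<subseteq> {..n}" "mon_degree t = e + mon_degree s"
    "Poly_Mapping.single t c = poly_var i ^ e * Poly_Mapping.single s (c :: 'k::field)"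
proof -
  define s where "s = t - Poly_Mapping.single i e"
  have t: "t = Poly_Mapping.single i e + s"
    unfolding s_def using assms(1)
    by (intro poly_mapping_eqI) (auto simp: lookup_add lookup_minus lookup_single when_def)
  have pow: "poly_var i ^ e = (Poly_Mapping.single (Poly_Mapping.single i e) 1 :: 'k mpoly)" for e
    by (induction e) (auto simp: poly_var_def mult_single simp flip: single_add)
  show ?thesis
  proof
    show "Poly_Mapping.keys s \<subseteq> {..n}"
      using assms(2) keys_minus_subset[of t "Poly_Mapping.single i e"] by (auto simp: s_def)
    show "mon_degree t = e + mon_degree s" by (subst t) simp
    show "Poly_Mapping.single t c = poly_var i ^ e * Poly_Mapping.single s c"
      by (subst t) (simp add: pow mult_single)
  qed
qed

text \<open>With normalised representatives, distinctness of points becomes a difference of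
  coordinates rather than non-proportionality of vectors.\<close>

locale fat_points =
  fixes n :: nat and X :: "(nat \<Rightarrow> 'k::field_char_0) set set" and p :: "(nat \<Rightarrow> 'k) set \<Rightarrow> nat \<Rightarrow> 'k"
  assumes finite_X: "finite X"
    and affine_point: "\<And>P. P \<in> X \<Longrightarrow> affine_point n P (p P)"
    and distinct: "\<And>P Q. P \<in> X \<Longrightarrow> Q \<in> X \<Longrightarrow> P \<noteq> Q \<Longrightarrow> \<exists>i\<le>n. p P i \<noteq> p Q i"
begin

abbreviation "X0 \<equiv> poly_var 0 :: 'k mpoly"

text \<open>If the points differ in coordinate i, the two forms Y_i differ by a nonzero multiple of
  X_0. So X_0 = a + b with a in one point ideal and b in the other, and every term of the binomial
  expansion of (a + b)^(2e) contains a^e or b^e.\<close>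

lemma X0_power_separation:
  assumes "P \<in> X" "Q \<in> X" "P \<noteq> Q"
  obtains a b where "a \<in> point_power n P e" "b \<in> point_power n Q e" "X0 ^ (2 * e) = a + b"
proof -
  interpret P: affine_point n P "p P" using assms(1) by (rule affine_point)
  interpret Q: affine_point n Q "p Q" using assms(2) by (rule affine_point)
  obtain i where i: "i \<le> n" "p P i \<noteq> p Q i" using distinct[OF assms] by auto
  define c where "c = Poly_Mapping.single (0 :: nat \<Rightarrow>\<^sub>0 nat) (inverse (p Q i - p P i))"
  have c: "c \<in> polys n" by (simp add: c_def)
  define a where "a = c * P.Y i"
  define b where "b = - c * Q.Y i"
  have a: "a \<in> point_ideal n P" unfolding a_def
    by (intro poly_ideal_mult[OF ideal_point_ideal] c P.Y_mem i)
  have b: "b \<in> point_ideal n Q" unfolding b_def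
    by (intro poly_ideal_mult[OF ideal_point_ideal] polys_uminus c Q.Y_mem i)
  have "P.Y i - Q.Y i = Poly_Mapping.single 0 (p Q i - p P i) * X0"
    by (simp add: P.Y_def Q.Y_def single_diff algebra_simps)
  then have "c * (P.Y i - Q.Y i) = (c * Poly_Mapping.single 0 (p Q i - p P i)) * X0"
    by (simp only: mult.assoc)
  also have "c * Poly_Mapping.single 0 (p Q i - p P i) = 1"
    using i(2) by (simp add: c_def mult_single)
  finally have "X0 = a + b" by (simp add: a_def b_def algebra_simps)
  then have "X0 ^ (2 * e) = (\<Sum>j\<le>2 * e. of_nat (2 * e choose j) * a ^ j * b ^ (2 * e - j))"
    by (simp add: binomial_ring)
  also have "\<dots> = (\<Sum>j\<in>{e..2 * e}. of_nat (2 * e choose j) * a ^ j * b ^ (2 * e - j))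
      + (\<Sum>j<e. of_nat (2 * e choose j) * a ^ j * b ^ (2 * e - j))"
  proof -
    have "{..2 * e} = {e..2 * e} \<union> {..<e}" by auto
    then show ?thesis by (simp add: sum.union_disjoint Int_def)
  qed
  finally have split: "X0 ^ (2 * e) = (\<Sum>j\<in>{e..2 * e}. of_nat (2 * e choose j) * a ^ j * b ^ (2 * e - j))
      + (\<Sum>j<e. of_nat (2 * e choose j) * a ^ j * b ^ (2 * e - j))" .
  have pol: "a \<in> polys n" "b \<in> polys n"
    using a b poly_ideal_subset[OF ideal_point_ideal] by blast+
  have "of_nat (2 * e choose j) * a ^ j * b ^ (2 * e - j) \<in> point_power n P e" if "j \<in> {e..2 * e}" for j
  proof -
    have "a ^ j \<in> point_power n P e"
      using that point_power_antimono[of e j, OF _ point_power_power[OF a]] by auto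
    then have "of_nat (2 * e choose j) * a ^ j \<in> point_power n P e"
      by (rule poly_ideal_mult[OF ideal_point_power polys_of_nat])
    then show ?thesis by (rule poly_ideal_mult2[OF ideal_point_power polys_power[OF pol(2)]])
  qed
  then have 1: "(\<Sum>j\<in>{e..2 * e}. of_nat (2 * e choose j) * a ^ j * b ^ (2 * e - j)) \<in> point_power n P e"
    by (intro poly_ideal_sum[OF ideal_point_power])
  have "of_nat (2 * e choose j) * a ^ j * b ^ (2 * e - j) \<in> point_power n Q e" if "j \<in> {..<e}" for j
  proof -
    have "b ^ (2 * e - j) \<in> point_power n Q e"
      using that point_power_antimono[of e "2 * e - j", OF _ point_power_power[OF b]] by auto
    then show ?thesis
      by (rule poly_ideal_mult[OF ideal_point_power polys_mult[OF polys_of_nat polys_power[OF pol(1)]]])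
  qed
  then have "(\<Sum>j<e. of_nat (2 * e choose j) * a ^ j * b ^ (2 * e - j)) \<in> point_power n Q e"
    by (intro poly_ideal_sum[OF ideal_point_power])
  then show ?thesis using that 1 split by blast
qed

text \<open>A power of X_0 is a sum of polynomials each vanishing to order e at all points but one.
  Phrasing this by an arbitrary additively closed \<open>A\<close> allows the induction to change
  \<open>A\<close> when a point is added. For a single point the vanishing condition is void and 1
  already lies in \<open>A\<close>.\<close>

lemma X0_power_decomposition:
  assumes "finite T" "T \<noteq> {}" "T \<subseteq> X"
    and "\<And>u v. u \<in> A \<Longrightarrow> v \<in> A \<Longrightarrow> u + v \<in> A"
    and "\<And>P u. P \<in> T \<Longrightarrow> u \<in> polys n \<Longrightarrow> (\<And>Q. Q \<in> T - {P} \<Longrightarrow> u \<in> point_power n Q e) \<Longrightarrow> u \<in> A"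
  shows "\<exists>N. X0 ^ N \<in> A"
  using assms
proof (induction T arbitrary: A rule: finite_ne_induct)
  case (singleton P)
  have "X0 ^ 0 \<in> A" by (rule singleton(3)[of P]) auto
  then show ?case ..
next
  case (insert P T)
  \<comment> \<open>Let \<open>u\<close> vanish at all of \<open>T\<close> but Q. Multiplying by
    X_0^(2e) = a + b, split between the new point P and Q, gives \<open>a * u\<close>, vanishing at
    all points but Q, and \<open>b * u\<close>, vanishing at all points but P.\<close>
  define A' where "A' = {u \<in> polys n. X0 ^ (2 * e) * u \<in> A}"
  have "\<exists>N. X0 ^ N \<in> A'"
  proof (rule insert.IH)
    show "T \<subseteq> X" using insert.prems by auto
    show "u + v \<in> A'" if "u \<in> A'" "v \<in> A'" for u v
      using that insert.prems(2) by (auto simp: A'_def algebra_simps)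
  next
    fix Q u assume Q: "Q \<in> T" and u: "u \<in> polys n" "\<And>R. R \<in> T - {Q} \<Longrightarrow> u \<in> point_power n R e"
    have "P \<noteq> Q" using Q insert.hyps by auto
    then obtain a b where ab: "a \<in> point_power n P e" "b \<in> point_power n Q e" "X0 ^ (2 * e) = a + b"
      using X0_power_separation[of P Q e] Q insert.prems(1) by auto
    have pol: "a \<in> polys n" "b \<in> polys n"
      using ab poly_ideal_subset[OF ideal_point_power] by blast+
    have "a * u \<in> A"
    proof (rule insert.prems(3)[of Q])
      show "Q \<in> insert P T" using Q by simp
      show "a * u \<in> polys n" using pol u by simp
      fix R assume "R \<in> insert P T - {Q}"
      then show "a * u \<in> point_power n R e"
        using ab u pol by (cases "R = P")
          (auto intro: poly_ideal_mult[OF ideal_point_power] poly_ideal_mult2[OF ideal_point_power])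
    qed
    moreover have "b * u \<in> A"
    proof (rule insert.prems(3)[of P])
      show "P \<in> insert P T" by simp
      show "b * u \<in> polys n" using pol u by simp
      fix R assume "R \<in> insert P T - {P}"
      then show "b * u \<in> point_power n R e"
        using ab u pol by (cases "R = Q")
          (auto intro: poly_ideal_mult[OF ideal_point_power] poly_ideal_mult2[OF ideal_point_power])
    qed
    ultimately have "a * u + b * u \<in> A" by (rule insert.prems(2))
    then show "u \<in> A'" using u by (simp add: A'_def ab(3) distrib_right)
  qed
  then obtain N where "X0 ^ (2 * e) * X0 ^ N \<in> A" by (auto simp: A'_def)
  then have "X0 ^ (2 * e + N) \<in> A" by (simp add: power_add)
  then show ?case ..
qed

text \<open>The multipliers u that carry I_\<nu> into \<open>J\<close> are closed under addition, so
  by \<open>X0_power_decomposition\<close> it is enough to treat u concentrated at a single point.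
  There the derivatives of u f Y_i are known to lie in \<open>J\<close>, and u f can be recovered
  from them.\<close>

lemma X0_power_colon:
  assumes J: "ideal J (poly_alg n)" and sub: "fat_ideal n (Suc \<nu>) X \<subseteq> J"
    and der: "\<And>f i. f \<in> fat_ideal n (Suc \<nu>) X \<Longrightarrow> i \<le> n \<Longrightarrow> partial i f \<in> J"
    and nu: "\<nu> \<ge> 1"
  shows "\<exists>N. \<forall>f\<in>fat_ideal n \<nu> X. X0 ^ N * f \<in> J"
proof (cases "X = {}")
  case True
  then have "J = polys n" using sub poly_ideal_subset[OF J] by (auto simp: fat_ideal_iff)
  then show ?thesis using True by (intro exI[of _ 0]) (auto simp: fat_ideal_iff)
next
  case False
  let ?A = "{u. \<forall>f\<in>fat_ideal n \<nu> X. u * f \<in> J}"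
  have "\<exists>N. X0 ^ N \<in> ?A"
  proof (rule X0_power_decomposition[OF finite_X False subset_refl])
    show "u + v \<in> ?A" if "u \<in> ?A" "v \<in> ?A" for u v
      using that poly_ideal_add[OF J] by (auto simp: algebra_simps)
  next
    fix P u assume P: "P \<in> X" and u: "u \<in> polys n" "\<And>Q. Q \<in> X - {P} \<Longrightarrow> u \<in> point_power n Q (Suc (Suc \<nu>))"
    interpret P: affine_point n P "p P" using P by (rule affine_point)
    have "u * f \<in> J" if f: "f \<in> fat_ideal n \<nu> X" for f
    proof -
      have fp: "f \<in> polys n" "f \<in> point_power n P \<nu>" using f P by (auto simp: fat_ideal_iff)
      have memI: "a * g \<in> fat_ideal n (Suc \<nu>) X"
        if "a \<in> polys n" "\<And>Q. Q \<in> X - {P} \<Longrightarrow> a \<in> point_power n Q (Suc \<nu>)" "g \<in> point_power n P (Suc \<nu>)" for a g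
        using that poly_ideal_subset[OF ideal_point_power that(3)]
        by (auto simp: fat_ideal_iff intro: poly_ideal_mult[OF ideal_point_power] poly_ideal_mult2[OF ideal_point_power])
      have u': "u \<in> point_power n Q (Suc \<nu>)" if "Q \<in> X - {P}" for Q
        using u(2)[OF that] by (rule point_power_decr)
      have Yf: "f * P.Y i \<in> point_power n P (Suc \<nu>)" if "i \<le> n" for i
        using fp that by (intro point_power_SucI P.Y_mem)
      have d: "partial i (u * (f * P.Y i)) \<in> J" if "i \<le> n" for i
        using that by (intro der memI u u' Yf)
      have d': "partial i u * (f * P.Y i) \<in> J" if "i \<le> n" for i
        using that by (intro subsetD[OF sub] memI Yf partial_polys u partial_point_power)
      have e: "u * (P.euler f - of_nat \<nu> * f) \<in> J"
        by (intro subsetD[OF sub] memI u u' P.euler_point_power fp)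
      \<comment> \<open>Three groups from the product rule: derivatives of \<open>u\<close>,
        absorbed by I_{\<nu>+1}; derivatives of the Y_i, giving n; derivatives of \<open>f\<close>,
        giving the Euler derivation and hence \<nu>.\<close>
      have "(\<Sum>i\<le>n. partial i (u * (f * P.Y i))) =
          (\<Sum>i\<le>n. partial i u * (f * P.Y i)) + u * f * (\<Sum>i\<le>n. partial i (P.Y i)) + u * P.euler f"
        by (simp add: partial_mult P.euler_def algebra_simps sum.distrib sum_distrib_left)
      then have "of_nat (\<nu> + n) * (u * f) = (\<Sum>i\<le>n. partial i (u * (f * P.Y i)))
          - (\<Sum>i\<le>n. partial i u * (f * P.Y i)) - u * (P.euler f - of_nat \<nu> * f)"
        by (simp add: P.sum_partial_Y algebra_simps)
      also have "\<dots> \<in> J"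
        by (intro poly_ideal_diff[OF J] poly_ideal_sum[OF J] e) (auto intro: d d')
      finally have "of_nat (\<nu> + n) * (u * f) \<in> J" .
      \<comment> \<open>The cancellation lemma expects a successor; \<open>\<nu> + n\<close> is one
        because \<nu> is positive.\<close>
      then show ?thesis using poly_ideal_of_nat_cancel[OF J, of "\<nu> + n - 1"] nu by simp
    qed
    then show "u \<in> ?A" by auto
  qed
  then show ?thesis by auto
qed

section \<open>Cancelling X_0, and reducing to multiples of X_0 in large degree\<close>

lemma fat_ideal_cancel_X0:
  assumes "h \<in> hom_polys n d" "X0 ^ q * h \<in> fat_ideal n k X"
  shows "h \<in> fat_ideal n k X"
  using assms(2)
proof (induction q)
  case (Suc q)
  have hom: "X0 ^ q * h \<in> hom_polys n (q * 1 + d)"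
    by (intro hom_polys_mult hom_polys_power hom_polys_var assms) auto
  have "X0 ^ q * h \<in> fat_ideal n k X"
    unfolding fat_ideal_iff
  proof (intro conjI ballI)
    show "X0 ^ q * h \<in> polys n" using hom by (rule hom_polysD)
    fix P assume P: "P \<in> X"
    interpret P: affine_point n P "p P" using P by (rule affine_point)
    show "X0 ^ q * h \<in> point_power n P k"
      using Suc.prems P by (intro P.point_power_cancel_X0[OF hom]) (auto simp: fat_ideal_iff mult.assoc)
  qed
  then show ?case by (rule Suc.IH)
qed simp

text \<open>Take the product over all points P of (X_i - p_i X_0)^k: the factor belonging to P
  vanishes to order k at P, and modulo X_0 every factor is X_i^k.\<close>

lemma fat_ideal_monic:
  assumes "i \<le> n" "i \<noteq> 0"
  obtains G where "G \<in> fat_ideal n k X" "monic_mod_X0 n i (card X * k) G"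
proof -
  define Z where "Z P = poly_var i - Poly_Mapping.single 0 (p P i) * X0" for P
  have Z_mem: "Z P ^ k \<in> point_power n P k" if "P \<in> X" for P
  proof -
    interpret P: affine_point n P "p P" using that by (rule affine_point)
    show ?thesis using point_power_power[OF P.Y_mem[OF assms(1)]] by (simp add: Z_def P.Y_def)
  qed
  have Z_pol: "Z P \<in> polys n" for P
    using assms unfolding Z_def by auto
  have "monic_mod_X0 n i (Suc 0) (Z P)" for P
    unfolding monic_mod_X0_def Z_def
    by (intro exI[of _ "Poly_Mapping.single 0 (p P i)"]) (auto simp: mult.commute hom_polys_const)
  from monic_mod_X0_power[OF assms(1) this, of k]
  have "monic_mod_X0 n i (card X * k) (\<Prod>P\<in>X. Z P ^ k)"
    using monic_mod_X0_prod[OF assms(1) finite_X, of k "\<lambda>P. Z P ^ k"] by simp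
  moreover have "(\<Prod>P\<in>X. Z P ^ k) \<in> fat_ideal n k X"
  proof -
    have "(\<Prod>P\<in>X. Z P ^ k) \<in> point_power n P k" if P: "P \<in> X" for P
    proof -
      have "(\<Prod>P\<in>X. Z P ^ k) = Z P ^ k * (\<Prod>P\<in>X - {P}. Z P ^ k)"
        using P finite_X by (rule prod.remove[rotated])
      then show ?thesis using Z_mem[OF P] Z_pol
        by (auto intro!: poly_ideal_mult2[OF ideal_point_power] polys_prod)
    qed
    then show ?thesis using Z_pol by (auto simp: fat_ideal_iff intro!: polys_prod)
  qed
  ultimately show ?thesis using that by blast
qed

text \<open>The bound is a pigeonhole: a monomial in X_1, ..., X_n of degree above n times
  \<open>card X * k\<close> has an exponent of at least \<open>card X * k\<close>, and that power is
  rewritten as a multiple of X_0 by the polynomial of \<open>fat_ideal_monic\<close>. Monomials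
  containing X_0 need no rewriting.\<close>

lemma fat_ideal_reduce_one:
  assumes f: "f \<in> hom_polys n d" and d: "d > n * (card X * k)" and k: "k \<ge> 1"
  shows "\<exists>h\<in>hom_polys n (d - 1). f - X0 * h \<in> fat_ideal n k X"
proof (cases "X = {}")
  case True
  then have "f - X0 * 0 \<in> fat_ideal n k X" using f by (simp add: fat_ideal_iff hom_polysD)
  then show ?thesis by blast
next
  case False
  define E where "E = card X * k"
  \<comment> \<open>Positivity makes \<open>E - 1\<close> the true degree of the cofactor
    \<open>h\<close> below; for empty \<open>X\<close> it fails, hence the separate case.\<close>
  have E: "E \<ge> 1" using False k finite_X by (simp add: E_def Suc_le_eq card_gt_0_iff)
  note I = ideal_fat_ideal[of n k X]
  show ?thesis using f
  proof (induction rule: hom_polys_induct)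
    case zero
    then show ?case using poly_ideal_zero[OF I] by (intro bexI[of _ 0]) auto
  next
    case (add f g)
    then obtain h h' where h: "h \<in> hom_polys n (d - 1)" "f - X0 * h \<in> fat_ideal n k X"
      "h' \<in> hom_polys n (d - 1)" "g - X0 * h' \<in> fat_ideal n k X" by auto
    have "f + g - X0 * (h + h') = (f - X0 * h) + (g - X0 * h')" by (simp add: algebra_simps)
    then have "f + g - X0 * (h + h') \<in> fat_ideal n k X" using poly_ideal_add[OF I h(2,4)] by metis
    then show ?case using h by blast
  next
    case (single t c)
    show ?case
    proof (cases "Poly_Mapping.lookup t 0 = 0")
      case False
      obtain s where "Poly_Mapping.keys s \<subseteq> {..n}" "mon_degree t = 1 + mon_degree s"
          "Poly_Mapping.single t c = X0 ^ 1 * Poly_Mapping.single s c"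
        by (rule single_split[of 1 t 0 n c]) (use False single in auto)
      then have "Poly_Mapping.single t c - X0 * Poly_Mapping.single s c \<in> fat_ideal n k X"
          "Poly_Mapping.single s c \<in> hom_polys n (d - 1)"
        using single(2) poly_ideal_zero[OF I] by (simp_all add: hom_polys_single)
      then show ?thesis by blast
    next
      case t0: True
      have "\<exists>i\<in>{1..n}. E \<le> Poly_Mapping.lookup t i"
      proof (rule ccontr)
        assume "\<not> ?thesis"
        then have "Poly_Mapping.lookup t i \<le> (if i = 0 then 0 else E)" if "i \<le> n" for i
          using t0 that by (cases "i = 0") (auto simp: not_le intro: less_imp_le)
        then have "(\<Sum>i\<le>n. Poly_Mapping.lookup t i) \<le> (\<Sum>i\<le>n. if i = 0 then 0 else E)"
          by (intro sum_mono) simp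
        then have "mon_degree t \<le> (\<Sum>i\<le>n. if i = 0 then 0 else E)"
          using mon_degree_superset[OF _ single(1)] by simp
        also have "\<dots> = (\<Sum>i\<in>{1..n}. E)"
          by (intro sum.mono_neutral_cong_right) auto
        finally show False using d single by (simp add: E_def)
      qed
      then obtain i where i: "i \<le> n" "i \<noteq> 0" "E \<le> Poly_Mapping.lookup t i" by auto
      obtain s where s: "Poly_Mapping.keys s \<subseteq> {..n}" "mon_degree t = E + mon_degree s"
          "Poly_Mapping.single t c = poly_var i ^ E * Poly_Mapping.single s c"
        by (rule single_split[OF i(3) single(1)])
      obtain G where G: "G \<in> fat_ideal n k X" "monic_mod_X0 n i E G"
        by (rule fat_ideal_monic[OF i(1,2), of k, folded E_def])
      obtain h where h: "G = poly_var i ^ E - X0 * h"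
          and "h = 0 \<or> (\<exists>m. E = Suc m \<and> h \<in> hom_polys n m)"
        using G(2) unfolding monic_mod_X0_def by blast
      then have h2: "h \<in> hom_polys n (E - 1)" by auto
      \<comment> \<open>Replacing X_i^E by X_0 h changes the monomial by a multiple of
        \<open>G\<close>.\<close>
      have "Poly_Mapping.single t c - X0 * (h * Poly_Mapping.single s c) = G * Poly_Mapping.single s c"
        by (simp add: s(3) h algebra_simps)
      also have "\<dots> \<in> fat_ideal n k X"
        by (intro poly_ideal_mult2[OF I] G polys_single s)
      finally have "Poly_Mapping.single t c - X0 * (h * Poly_Mapping.single s c) \<in> fat_ideal n k X" .
      moreover have "h * Poly_Mapping.single s c \<in> hom_polys n (d - 1)"
        using hom_polys_mult[OF h2 hom_polys_single[OF s(1) refl, of c]] s(2) single E by simp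
      ultimately show ?thesis by blast
    qed
  qed
qed

lemma fat_ideal_reduce:
  assumes f: "f \<in> hom_polys n d" and k: "k \<ge> 1" and d: "d \<ge> n * (card X * k) + q"
  shows "\<exists>h\<in>hom_polys n (d - q). f - X0 ^ q * h \<in> fat_ideal n k X"
  using d
proof (induction q)
  case 0
  then show ?case using f poly_ideal_zero[OF ideal_fat_ideal] by (intro bexI[of _ f]) auto
next
  case (Suc q)
  note I = ideal_fat_ideal[of n k X]
  obtain h where h: "h \<in> hom_polys n (d - q)" "f - X0 ^ q * h \<in> fat_ideal n k X"
    using Suc by auto
  obtain h' where h': "h' \<in> hom_polys n (d - q - 1)" "h - X0 * h' \<in> fat_ideal n k X"
  proof -
    have "n * (card X * k) < d - q" using Suc.prems by linarith
    then show thesis using that fat_ideal_reduce_one[OF h(1) _ k] by blast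
  qed
  have "f - X0 ^ Suc q * h' = (f - X0 ^ q * h) + X0 ^ q * (h - X0 * h')"
    by (simp add: algebra_simps)
  also have "\<dots> \<in> fat_ideal n k X"
    by (intro poly_ideal_add[OF I] poly_ideal_mult[OF I] h h') auto
  finally show ?case using h'(1) by auto
qed

text \<open>Reduce f to X_0^N h modulo I_{\<nu>+1}, not merely modulo I_\<nu>, so that the remainder
  lies in \<open>J\<close>. Since I_{\<nu>+1} is inside I_\<nu>, cancelling X_0^N shows h in
  I_\<nu>, and the choice of N returns X_0^N h to \<open>J\<close>.\<close>

lemma fat_ideal_eventually_subset:
  assumes J: "ideal J (poly_alg n)" and sub: "fat_ideal n (Suc \<nu>) X \<subseteq> J"
    and der: "\<And>f i. f \<in> fat_ideal n (Suc \<nu>) X \<Longrightarrow> i \<le> n \<Longrightarrow> partial i f \<in> J"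
    and nu: "\<nu> \<ge> 1" and sup: "J \<subseteq> fat_ideal n \<nu> X"
  obtains D where "\<And>d f. d \<ge> D \<Longrightarrow> f \<in> hom_polys n d \<Longrightarrow> f \<in> fat_ideal n \<nu> X \<Longrightarrow> f \<in> J"
proof -
  obtain N where N: "\<forall>f\<in>fat_ideal n \<nu> X. X0 ^ N * f \<in> J"
    using X0_power_colon[OF J sub der nu] by blast
  show ?thesis
  proof (rule that[of "n * (card X * Suc \<nu>) + N"])
    fix d f assume d: "d \<ge> n * (card X * Suc \<nu>) + N" and f: "f \<in> hom_polys n d" "f \<in> fat_ideal n \<nu> X"
    obtain h where h: "h \<in> hom_polys n (d - N)" "f - X0 ^ N * h \<in> fat_ideal n (Suc \<nu>) X"
    proof -
      have "1 \<le> Suc \<nu>" by simp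
      from fat_ideal_reduce[OF f(1) this d] show thesis using that by blast
    qed
    have "f - (f - X0 ^ N * h) \<in> fat_ideal n \<nu> X"
      by (rule poly_ideal_diff[OF ideal_fat_ideal f(2) fat_ideal_decr[OF h(2)]])
    then have "X0 ^ N * h \<in> fat_ideal n \<nu> X" by simp
    then have "h \<in> fat_ideal n \<nu> X" by (rule fat_ideal_cancel_X0[OF h(1)])
    then have "X0 ^ N * h \<in> J" using N by blast
    then have "(f - X0 ^ N * h) + X0 ^ N * h \<in> J"
      by (rule poly_ideal_add[OF J subsetD[OF sub h(2)]])
    then show "f \<in> J" by simp
  qed
qed

end

text \<open>Dividing a coordinate vector by its first entry, nonzero by hypothesis, gives the
  normalised representative; the class of the point is unchanged by this scaling.\<close>

lemma fat_points_ex: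
  fixes X :: "(nat \<Rightarrow> 'k::field_char_0) set set"
  assumes X: "X \<subseteq> proj_space n" "finite X" and nz: "\<forall>P\<in>X. \<forall>v\<in>P. v 0 \<noteq> 0"
  shows "\<exists>p. fat_points n X p"
proof -
  define C :: "(nat \<Rightarrow> 'k) \<Rightarrow> (nat \<Rightarrow> 'k) set"
    where "C v = {w \<in> coord_vectors n. \<exists>c. c \<noteq> 0 \<and> (\<forall>i\<le>n. w i = c * v i)}" for v
  have CI: "w \<in> C v" if "w \<in> coord_vectors n" "c \<noteq> 0" "\<And>i. i \<le> n \<Longrightarrow> w i = c * v i" for v w c
    using that unfolding C_def by blast
  have CE: thesis if "w \<in> C v" "\<And>c. w \<in> coord_vectors n \<Longrightarrow> c \<noteq> 0 \<Longrightarrow> (\<And>i. i \<le> n \<Longrightarrow> w i = c * v i) \<Longrightarrow> thesis"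
    for v w thesis using that unfolding C_def by blast
  have "\<exists>p. affine_point n P p \<and> p \<in> coord_vectors n \<and> P = C p" if P: "P \<in> X" for P
  proof -
    have "P \<in> proj_space n" using P X by blast
    then obtain v where v: "v \<in> coord_vectors n" and
        Pv: "P = {(v, w) \<in> coord_vectors n \<times> coord_vectors n. \<exists>c. c \<noteq> 0 \<and> (\<forall>i\<le>n. w i = c * v i)} `` {v}"
      unfolding proj_space_def by (rule quotientE)
    have v: "v \<in> coord_vectors n" "P = C v"
      using v unfolding Pv C_def by blast+
    have "v \<in> P" unfolding v(2) by (rule CI[of _ 1]) (simp_all add: v(1))
    then have v0: "v 0 \<noteq> 0" using nz P by blast
    \<comment> \<open>Coordinate vectors are undefined beyond n. The restriction keeps
      \<open>p\<close> among them, so that agreement of coordinates up to n implies equality of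
      representatives.\<close>
    define p where "p = restrict (\<lambda>i. inverse (v 0) * v i) {..n}"
    have p_eq: "p i = inverse (v 0) * v i" if "i \<le> n" for i
      using that by (simp add: p_def)
    have v_eq: "v i = v 0 * p i" if "i \<le> n" for i
      using that v0 by (simp add: p_def)
    have p0: "p 0 = 1" using v0 p_eq[of 0] by simp
    have p: "p \<in> coord_vectors n"
      unfolding coord_vectors_def
    proof (intro CollectI conjI)
      show "p \<in> {..n} \<rightarrow>\<^sub>E UNIV" by (simp add: p_def)
      show "\<exists>i\<le>n. p i \<noteq> 0" using p0 by (intro exI[of _ 0]) simp
    qed
    have PC: "P = C p"
    proof (intro equalityI subsetI)
      fix w assume "w \<in> P"
      then show "w \<in> C p" unfolding v(2)
      proof (rule CE)
        fix c assume c: "w \<in> coord_vectors n" "c \<noteq> 0" "\<And>i. i \<le> n \<Longrightarrow> w i = c * v i"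
        have *: "w i = c * v 0 * p i" if "i \<le> n" for i
          unfolding c(3)[OF that] by (subst v_eq[OF that]) (rule mult.assoc[symmetric])
        have "c * v 0 \<noteq> 0" using c(2) v0 by simp
        then show "w \<in> C p" using CI[OF c(1) _ *] by blast
      qed
    next
      fix w assume "w \<in> C p"
      then show "w \<in> P" unfolding v(2)
      proof (rule CE)
        fix c assume c: "w \<in> coord_vectors n" "c \<noteq> 0" "\<And>i. i \<le> n \<Longrightarrow> w i = c * p i"
        have *: "w i = c * inverse (v 0) * v i" if "i \<le> n" for i
          unfolding c(3)[OF that] by (subst p_eq[OF that]) (rule mult.assoc[symmetric])
        have "c * inverse (v 0) \<noteq> 0" using c(2) v0 by simp
        then show "w \<in> C v" using CI[OF c(1) _ *] by blast
      qed
    qed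
    have "affine_point n P p"
    proof
      show "p 0 = 1" by (rule p0)
      show "p \<in> P" unfolding PC by (rule CI[of _ 1]) (simp_all add: p)
      show "\<exists>c. \<forall>i\<le>n. w i = c * p i" if "w \<in> P" for w
        using that unfolding PC C_def by blast
    qed
    then show ?thesis using p PC by blast
  qed
  then have "\<exists>p. \<forall>P\<in>X. affine_point n P (p P) \<and> p P \<in> coord_vectors n \<and> P = C (p P)"
    by (intro bchoice) blast
  then obtain p where p: "\<And>P. P \<in> X \<Longrightarrow> affine_point n P (p P)"
      "\<And>P. P \<in> X \<Longrightarrow> p P \<in> coord_vectors n" "\<And>P. P \<in> X \<Longrightarrow> P = C (p P)"
    by blast
  have "fat_points n X p"
  proof (rule fat_points.intro)
    show "finite X" by (rule X(2))
    show "affine_point n P (p P)" if "P \<in> X" for P using that by (rule p(1))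
    fix P Q assume PQ: "P \<in> X" "Q \<in> X" "P \<noteq> Q"
    show "\<exists>i\<le>n. p P i \<noteq> p Q i"
    proof (rule ccontr)
      assume "\<not> ?thesis"
      then have "p P = p Q"
        using p(2)[OF PQ(1)] p(2)[OF PQ(2)]
        by (intro PiE_ext[of _ "{..n}" "\<lambda>_. UNIV"]) (auto simp: coord_vectors_def)
      then have "C (p P) = C (p Q)" by (rule arg_cong)
      then have "P = Q" unfolding p(3)[OF PQ(1), symmetric] p(3)[OF PQ(2), symmetric] .
      then show False using PQ(3) by simp
    qed
  qed
  then show ?thesis by (rule exI[of _ p])
qed

section \<open>Modules\<close>

lemma free_module_simps [simp]:
  "carrier (free_module R B) = {f. (\<forall>b\<in>B. f b \<in> carrier R) \<and> (\<forall>b. b \<notin> B \<longrightarrow> f b = \<zero>\<^bsub>R\<^esub>) \<and> finite {b. f b \<noteq> \<zero>\<^bsub>R\<^esub>}}"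
  "zero (free_module R B) = (\<lambda>_. \<zero>\<^bsub>R\<^esub>)"
  "add (free_module R B) = (\<lambda>f g b. f b \<oplus>\<^bsub>R\<^esub> g b)"
  "smult (free_module R B) = (\<lambda>a f b. a \<otimes>\<^bsub>R\<^esub> f b)"
  by (simp_all add: free_module_def)

lemma (in cring) free_module_coeff:
  assumes "f \<in> carrier (free_module R B)" shows "f b \<in> carrier R"
  using assms by (cases "b \<in> B") auto

lemma (in cring) module_free_module: "module R (free_module R B)"
proof (rule module_criteria)
  show "cring R" by (rule is_cring)
  show "\<forall>f g. f \<in> carrier (free_module R B) \<and> g \<in> carrier (free_module R B) \<longrightarrow>
      f \<oplus>\<^bsub>free_module R B\<^esub> g \<in> carrier (free_module R B)"
  proof (intro allI impI, elim conjE)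
    fix f g assume fg: "f \<in> carrier (free_module R B)" "g \<in> carrier (free_module R B)"
    then have "{b. f b \<oplus> g b \<noteq> \<zero>} \<subseteq> {b. f b \<noteq> \<zero>} \<union> {b. g b \<noteq> \<zero>}" by auto
    then have "finite {b. f b \<oplus> g b \<noteq> \<zero>}" by (rule finite_subset) (use fg in auto)
    then show "f \<oplus>\<^bsub>free_module R B\<^esub> g \<in> carrier (free_module R B)" using fg by simp
  qed
  show smult: "\<forall>a f. a \<in> carrier R \<and> f \<in> carrier (free_module R B) \<longrightarrow>
      a \<odot>\<^bsub>free_module R B\<^esub> f \<in> carrier (free_module R B)"
  proof (intro allI impI, elim conjE)
    fix a f assume f: "a \<in> carrier R" "f \<in> carrier (free_module R B)"
    then have "{b. a \<otimes> f b \<noteq> \<zero>} \<subseteq> {b. f b \<noteq> \<zero>}" by auto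
    then have "finite {b. a \<otimes> f b \<noteq> \<zero>}" by (rule finite_subset) (use f in auto)
    then show "a \<odot>\<^bsub>free_module R B\<^esub> f \<in> carrier (free_module R B)" using f by simp
  qed
  show "\<forall>f\<in>carrier (free_module R B). \<exists>g\<in>carrier (free_module R B).
      f \<oplus>\<^bsub>free_module R B\<^esub> g = \<zero>\<^bsub>free_module R B\<^esub>"
  proof
    fix f assume f: "f \<in> carrier (free_module R B)"
    have "(\<ominus> \<one>) \<odot>\<^bsub>free_module R B\<^esub> f \<in> carrier (free_module R B)"
      using smult f by blast
    moreover have "f \<oplus>\<^bsub>free_module R B\<^esub> ((\<ominus> \<one>) \<odot>\<^bsub>free_module R B\<^esub> f) = \<zero>\<^bsub>free_module R B\<^esub>"
      using free_module_coeff[OF f] by (simp add: l_minus r_neg)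
    ultimately show "\<exists>g\<in>carrier (free_module R B). f \<oplus>\<^bsub>free_module R B\<^esub> g = \<zero>\<^bsub>free_module R B\<^esub>" by blast
  qed
  show "\<zero>\<^bsub>free_module R B\<^esub> \<in> carrier (free_module R B)" by simp
  show "\<forall>f g. f \<in> carrier (free_module R B) \<and> g \<in> carrier (free_module R B) \<longrightarrow>
      f \<oplus>\<^bsub>free_module R B\<^esub> g = g \<oplus>\<^bsub>free_module R B\<^esub> f"
    by (auto simp del: free_module_simps(1) simp: free_module_coeff a_comm intro!: ext)
qed (auto simp del: free_module_simps(1) simp: free_module_coeff a_assoc l_distr r_distr m_assoc intro!: ext)

lemma (in cring) free_gen_carrier [simp]: "b \<in> B \<Longrightarrow> free_gen R b \<in> carrier (free_module R B)"
  by (auto simp: free_gen_def intro: finite_subset[of _ "{b}"])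

subsection \<open>Quotient modules\<close>

lemma quot_module_fields:
  "carrier (quot_module M N) = a_rcosets\<^bsub>M\<^esub> N" "zero (quot_module M N) = N"
  "add (quot_module M N) = set_add M" "mult (quot_module M N) = rcoset_mult M N"
  "one (quot_module M N) = N +>\<^bsub>M\<^esub> \<one>\<^bsub>M\<^esub>"
  "smult (quot_module M N) = (\<lambda>a C. \<Union>x\<in>C. N +>\<^bsub>M\<^esub> (a \<odot>\<^bsub>M\<^esub> x))"
  by (simp_all add: quot_module_def ring.defs module.defs FactRing_def)

text \<open>Serves three quotients: the polynomial ring by an ideal as a vector space, the Kaehler
  module, and the exterior power. All later computation passes through the projection
  \<open>\<pi>\<close>.\<close>

locale quotient_module = M?: Module.module R M
  for R :: "('r, 'e) ring_scheme" and M :: "('r, 'm) module" (structure) and N +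
  assumes submodule: "submodule R N M"
begin

abbreviation Q where "Q \<equiv> quot_module M N"
abbreviation \<pi> where "\<pi> x \<equiv> N +>\<^bsub>M\<^esub> x"

lemma N_carrier: "x \<in> N \<Longrightarrow> x \<in> carrier M"
  using submodule by (auto simp: submodule_def)

sublocale N: abelian_subgroup N M
proof (rule abelian_subgroupI3)
  show "abelian_group M" by (rule M.M.abelian_group_axioms)
  show "additive_subgroup N M"
  proof (rule additive_subgroupI, rule M.M.add.subgroupI)
    show "N \<subseteq> carrier M" "N \<noteq> {}" using submodule by (auto simp: submodule_def)
    show "\<ominus>\<^bsub>M\<^esub> x \<in> N" if "x \<in> N" for x
    proof -
      have "\<ominus>\<^bsub>M\<^esub> x = (\<ominus>\<^bsub>R\<^esub> \<one>\<^bsub>R\<^esub>) \<odot>\<^bsub>M\<^esub> x"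
        using M.smult_minus_1[OF N_carrier[OF that]] by simp
      then show ?thesis using submodule that by (simp add: submodule_def)
    qed
    show "x \<oplus>\<^bsub>M\<^esub> y \<in> N" if "x \<in> N" "y \<in> N" for x y
      using submodule that by (simp add: submodule_def)
  qed
qed

lemma carrier_Q: "carrier Q = \<pi> ` carrier M"
  by (auto simp: quot_module_fields A_RCOSETS_def')

lemma \<pi>_carrier [simp, intro]: "x \<in> carrier M \<Longrightarrow> \<pi> x \<in> carrier Q"
  by (simp add: carrier_Q)

lemma \<pi>_add [simp]: "x \<in> carrier M \<Longrightarrow> y \<in> carrier M \<Longrightarrow> \<pi> x \<oplus>\<^bsub>Q\<^esub> \<pi> y = \<pi> (x \<oplus>\<^bsub>M\<^esub> y)"
  by (simp add: quot_module_fields N.a_rcos_sum)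

lemma zero_Q: "\<zero>\<^bsub>Q\<^esub> = \<pi> \<zero>\<^bsub>M\<^esub>"
  by (simp add: quot_module_fields M.M.a_coset_add_zero[OF N.a_subset])

lemma \<pi>_eq_iff: "x \<in> carrier M \<Longrightarrow> y \<in> carrier M \<Longrightarrow> \<pi> x = \<pi> y \<longleftrightarrow> x \<ominus>\<^bsub>M\<^esub> y \<in> N"
  (is "?x \<Longrightarrow> ?y \<Longrightarrow> _")
proof -
  assume x: ?x and y: ?y
  have "\<pi> x = \<pi> y \<longleftrightarrow> x \<in> \<pi> y"
    using N.a_rcos_self[OF x] N.a_repr_independence'[OF _ y] by auto
  also have "\<dots> \<longleftrightarrow> x \<ominus>\<^bsub>M\<^esub> y \<in> N"
    unfolding a_minus_def using y x by (rule N.a_rcos_module)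
  finally show ?thesis .
qed

lemma \<pi>_zero_iff: "x \<in> carrier M \<Longrightarrow> \<pi> x = \<zero>\<^bsub>Q\<^esub> \<longleftrightarrow> x \<in> N"
  unfolding quot_module_fields using N.a_rcos_const[of x] N.a_rcos_self[of x] by metis

text \<open>Scaling a difference in \<open>N\<close> stays in \<open>N\<close>, so the union
  defining the scalar multiplication is taken over one and the same coset.\<close>

lemma \<pi>_smult [simp]:
  assumes a: "a \<in> carrier R" and x: "x \<in> carrier M"
  shows "a \<odot>\<^bsub>Q\<^esub> \<pi> x = \<pi> (a \<odot>\<^bsub>M\<^esub> x)"
proof -
  have "\<pi> (a \<odot>\<^bsub>M\<^esub> y) = \<pi> (a \<odot>\<^bsub>M\<^esub> x)" if y: "y \<in> \<pi> x" for y
  proof -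
    have yc: "y \<in> carrier M" using x y by (rule N.a_elemrcos_carrier)
    have "y \<oplus>\<^bsub>M\<^esub> \<ominus>\<^bsub>M\<^esub> x \<in> N" using y x yc by (simp add: N.a_rcos_module)
    then have "a \<odot>\<^bsub>M\<^esub> (y \<oplus>\<^bsub>M\<^esub> \<ominus>\<^bsub>M\<^esub> x) \<in> N"
      using submodule a by (simp add: submodule_def)
    moreover have "a \<odot>\<^bsub>M\<^esub> (y \<oplus>\<^bsub>M\<^esub> \<ominus>\<^bsub>M\<^esub> x) = a \<odot>\<^bsub>M\<^esub> y \<ominus>\<^bsub>M\<^esub> a \<odot>\<^bsub>M\<^esub> x"
      using a x yc by (simp add: M.smult_r_distr M.smult_r_minus a_minus_def)
    ultimately show ?thesis using a x yc by (simp add: \<pi>_eq_iff)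
  qed
  then have "(\<Union>y\<in>\<pi> x. \<pi> (a \<odot>\<^bsub>M\<^esub> y)) = \<pi> (a \<odot>\<^bsub>M\<^esub> x)"
    by (intro UN_constant_eq[OF N.a_rcos_self[OF x]] ballI)
  then show ?thesis by (simp only: quot_module_fields)
qed

lemma Q_cases: assumes "C \<in> carrier Q" obtains x where "x \<in> carrier M" "C = \<pi> x"
  using assms by (auto simp: carrier_Q)

lemma module_Q: "Module.module R Q"
proof (rule module_criteria)
  show "cring R" by (rule M.R.is_cring)
  show "\<zero>\<^bsub>Q\<^esub> \<in> carrier Q" by (simp add: zero_Q)
  show "\<forall>v\<in>carrier Q. \<exists>w\<in>carrier Q. v \<oplus>\<^bsub>Q\<^esub> w = \<zero>\<^bsub>Q\<^esub>"
  proof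
    fix v assume "v \<in> carrier Q"
    then obtain x where x: "x \<in> carrier M" "v = \<pi> x" by (rule Q_cases)
    then have "v \<oplus>\<^bsub>Q\<^esub> \<pi> (\<ominus>\<^bsub>M\<^esub> x) = \<zero>\<^bsub>Q\<^esub>" by (simp add: zero_Q M.M.r_neg)
    then show "\<exists>w\<in>carrier Q. v \<oplus>\<^bsub>Q\<^esub> w = \<zero>\<^bsub>Q\<^esub>" using x by blast
  qed
  show "\<forall>v w. v \<in> carrier Q \<and> w \<in> carrier Q \<longrightarrow> v \<oplus>\<^bsub>Q\<^esub> w \<in> carrier Q"
    by (auto elim!: Q_cases)
  show "\<forall>c v. c \<in> carrier R \<and> v \<in> carrier Q \<longrightarrow> c \<odot>\<^bsub>Q\<^esub> v \<in> carrier Q"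
    by (auto elim!: Q_cases)
  show "\<forall>v w. v \<in> carrier Q \<and> w \<in> carrier Q \<longrightarrow> v \<oplus>\<^bsub>Q\<^esub> w = w \<oplus>\<^bsub>Q\<^esub> v"
    by (auto elim!: Q_cases simp: M.M.a_comm)
  show "\<forall>u v w. u \<in> carrier Q \<and> v \<in> carrier Q \<and> w \<in> carrier Q \<longrightarrow>
      u \<oplus>\<^bsub>Q\<^esub> v \<oplus>\<^bsub>Q\<^esub> w = u \<oplus>\<^bsub>Q\<^esub> (v \<oplus>\<^bsub>Q\<^esub> w)"
    by (auto elim!: Q_cases simp: M.M.a_assoc)
  show "\<forall>v\<in>carrier Q. v \<oplus>\<^bsub>Q\<^esub> \<zero>\<^bsub>Q\<^esub> = v"
    by (auto elim!: Q_cases simp: zero_Q)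
  show "\<forall>a b v. a \<in> carrier R \<and> b \<in> carrier R \<and> v \<in> carrier Q \<longrightarrow>
      (a \<otimes>\<^bsub>R\<^esub> b) \<odot>\<^bsub>Q\<^esub> v = a \<odot>\<^bsub>Q\<^esub> (b \<odot>\<^bsub>Q\<^esub> v)"
    by (auto elim!: Q_cases simp: M.smult_assoc1)
  show "\<forall>v\<in>carrier Q. \<one>\<^bsub>R\<^esub> \<odot>\<^bsub>Q\<^esub> v = v"
    by (auto elim!: Q_cases)
  show "\<forall>a b v. a \<in> carrier R \<and> b \<in> carrier R \<and> v \<in> carrier Q \<longrightarrow>
      (a \<oplus>\<^bsub>R\<^esub> b) \<odot>\<^bsub>Q\<^esub> v = a \<odot>\<^bsub>Q\<^esub> v \<oplus>\<^bsub>Q\<^esub> b \<odot>\<^bsub>Q\<^esub> v"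
    by (auto elim!: Q_cases simp: M.smult_l_distr)
  show "\<forall>a v w. a \<in> carrier R \<and> v \<in> carrier Q \<and> w \<in> carrier Q \<longrightarrow>
      a \<odot>\<^bsub>Q\<^esub> (v \<oplus>\<^bsub>Q\<^esub> w) = a \<odot>\<^bsub>Q\<^esub> v \<oplus>\<^bsub>Q\<^esub> a \<odot>\<^bsub>Q\<^esub> w"
    by (auto elim!: Q_cases simp: M.smult_r_distr)
qed

end

lemma quotient_moduleI: "submodule R N M \<Longrightarrow> quotient_module R M N"
  by (simp add: quotient_module_def quotient_module_axioms_def submodule_def)

subsection \<open>Restriction of scalars\<close>

lemma restrict_scalars_fields [simp]:
  "carrier (restrict_scalars A M) = carrier M" "zero (restrict_scalars A M) = zero M"
  "add (restrict_scalars A M) = add M"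
  "smult (restrict_scalars A M) = (\<lambda>c x. (c \<odot>\<^bsub>A\<^esub> \<one>\<^bsub>A\<^esub>) \<odot>\<^bsub>M\<^esub> x)"
  by (simp_all add: restrict_scalars_def ring.defs module.defs)

lemma module_restrict_scalars:
  assumes "algebra K A" and "Module.module A M"
  shows "Module.module K (restrict_scalars A M)"
proof -
  interpret A: algebra K A by fact
  interpret M: Module.module A M by fact
  have s: "c \<odot>\<^bsub>A\<^esub> \<one>\<^bsub>A\<^esub> \<in> carrier A" if "c \<in> carrier K" for c using that by simp
  show ?thesis
  proof (rule module_criteria)
    show "\<forall>v\<in>carrier (restrict_scalars A M). \<exists>w\<in>carrier (restrict_scalars A M).
        v \<oplus>\<^bsub>restrict_scalars A M\<^esub> w = \<zero>\<^bsub>restrict_scalars A M\<^esub>"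
    proof
      fix v assume "v \<in> carrier (restrict_scalars A M)"
      then show "\<exists>w\<in>carrier (restrict_scalars A M).
          v \<oplus>\<^bsub>restrict_scalars A M\<^esub> w = \<zero>\<^bsub>restrict_scalars A M\<^esub>"
        by (intro bexI[of _ "\<ominus>\<^bsub>M\<^esub> v"]) (simp_all add: M.M.r_neg)
    qed
    show "\<forall>a b v. a \<in> carrier K \<and> b \<in> carrier K \<and> v \<in> carrier (restrict_scalars A M) \<longrightarrow>
       (a \<otimes>\<^bsub>K\<^esub> b) \<odot>\<^bsub>restrict_scalars A M\<^esub> v = a \<odot>\<^bsub>restrict_scalars A M\<^esub> (b \<odot>\<^bsub>restrict_scalars A M\<^esub> v)"
    proof (intro allI impI, elim conjE)
      fix a b v assume *: "a \<in> carrier K" "b \<in> carrier K" "v \<in> carrier (restrict_scalars A M)"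
      have v: "v \<in> carrier M" using *(3) by simp
      have "(a \<odot>\<^bsub>A\<^esub> \<one>\<^bsub>A\<^esub>) \<otimes>\<^bsub>A\<^esub> (b \<odot>\<^bsub>A\<^esub> \<one>\<^bsub>A\<^esub>) = a \<odot>\<^bsub>A\<^esub> (\<one>\<^bsub>A\<^esub> \<otimes>\<^bsub>A\<^esub> (b \<odot>\<^bsub>A\<^esub> \<one>\<^bsub>A\<^esub>))"
        by (rule A.smult_assoc2[OF *(1) _ s[OF *(2)]]) simp
      also have "\<one>\<^bsub>A\<^esub> \<otimes>\<^bsub>A\<^esub> (b \<odot>\<^bsub>A\<^esub> \<one>\<^bsub>A\<^esub>) = b \<odot>\<^bsub>A\<^esub> \<one>\<^bsub>A\<^esub>"
        using s[OF *(2)] by simp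
      also have "a \<odot>\<^bsub>A\<^esub> (b \<odot>\<^bsub>A\<^esub> \<one>\<^bsub>A\<^esub>) = (a \<otimes>\<^bsub>K\<^esub> b) \<odot>\<^bsub>A\<^esub> \<one>\<^bsub>A\<^esub>"
        by (rule A.smult_assoc1[OF *(1,2), symmetric]) simp
      finally have "(a \<otimes>\<^bsub>K\<^esub> b) \<odot>\<^bsub>A\<^esub> \<one>\<^bsub>A\<^esub> = (a \<odot>\<^bsub>A\<^esub> \<one>\<^bsub>A\<^esub>) \<otimes>\<^bsub>A\<^esub> (b \<odot>\<^bsub>A\<^esub> \<one>\<^bsub>A\<^esub>)" ..
      then have "((a \<otimes>\<^bsub>K\<^esub> b) \<odot>\<^bsub>A\<^esub> \<one>\<^bsub>A\<^esub>) \<odot>\<^bsub>M\<^esub> v = (a \<odot>\<^bsub>A\<^esub> \<one>\<^bsub>A\<^esub>) \<odot>\<^bsub>M\<^esub> ((b \<odot>\<^bsub>A\<^esub> \<one>\<^bsub>A\<^esub>) \<odot>\<^bsub>M\<^esub> v)"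
        by (simp only: M.smult_assoc1[OF s[OF *(1)] s[OF *(2)] v])
      then show "(a \<otimes>\<^bsub>K\<^esub> b) \<odot>\<^bsub>restrict_scalars A M\<^esub> v = a \<odot>\<^bsub>restrict_scalars A M\<^esub> (b \<odot>\<^bsub>restrict_scalars A M\<^esub> v)"
        by (simp only: restrict_scalars_fields)
    qed
    show "cring K" by (rule A.R_cring)
    show "\<forall>v w. v \<in> carrier (restrict_scalars A M) \<and> w \<in> carrier (restrict_scalars A M) \<longrightarrow>
        v \<oplus>\<^bsub>restrict_scalars A M\<^esub> w = w \<oplus>\<^bsub>restrict_scalars A M\<^esub> v"
      by (simp add: M.M.a_comm)
    show "\<forall>u v w. u \<in> carrier (restrict_scalars A M) \<and> v \<in> carrier (restrict_scalars A M) \<and>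
        w \<in> carrier (restrict_scalars A M) \<longrightarrow>
        u \<oplus>\<^bsub>restrict_scalars A M\<^esub> v \<oplus>\<^bsub>restrict_scalars A M\<^esub> w =
        u \<oplus>\<^bsub>restrict_scalars A M\<^esub> (v \<oplus>\<^bsub>restrict_scalars A M\<^esub> w)"
      by (simp add: M.M.a_assoc)
    show "\<forall>v\<in>carrier (restrict_scalars A M). \<one>\<^bsub>K\<^esub> \<odot>\<^bsub>restrict_scalars A M\<^esub> v = v"
      by simp
    show "\<forall>a b v. a \<in> carrier K \<and> b \<in> carrier K \<and> v \<in> carrier (restrict_scalars A M) \<longrightarrow>
        (a \<oplus>\<^bsub>K\<^esub> b) \<odot>\<^bsub>restrict_scalars A M\<^esub> v =
        a \<odot>\<^bsub>restrict_scalars A M\<^esub> v \<oplus>\<^bsub>restrict_scalars A M\<^esub> b \<odot>\<^bsub>restrict_scalars A M\<^esub> v"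
      using s by (simp add: A.smult_l_distr M.smult_l_distr)
    show "\<forall>a v w. a \<in> carrier K \<and> v \<in> carrier (restrict_scalars A M) \<and> w \<in> carrier (restrict_scalars A M) \<longrightarrow>
        a \<odot>\<^bsub>restrict_scalars A M\<^esub> (v \<oplus>\<^bsub>restrict_scalars A M\<^esub> w) =
        a \<odot>\<^bsub>restrict_scalars A M\<^esub> v \<oplus>\<^bsub>restrict_scalars A M\<^esub> a \<odot>\<^bsub>restrict_scalars A M\<^esub> w"
      using s by (simp add: M.smult_r_distr)
  qed (use s in simp_all)
qed

subsection \<open>Kaehler differentials\<close>

locale kaehler_algebra = A?: algebra K A
  for K :: "('k, 'e) ring_scheme" and A :: "('k, 'a) module" (structure)
begin

abbreviation FA where "FA \<equiv> free_module A (carrier A)"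
abbreviation d where "d \<equiv> univ_deriv K A"
abbreviation \<Omega> where "\<Omega> \<equiv> kaehler K A"

sublocale FA: Module.module A FA
  by (rule cring.module_free_module[OF A.M_cring])

lemma gen_carrier: "a \<in> carrier A \<Longrightarrow> free_gen A a \<in> carrier FA"
  by (rule cring.free_gen_carrier[OF A.M_cring])

lemma kaehler_rels_carrier: "kaehler_rels K A \<subseteq> carrier FA"
  unfolding kaehler_rels_def Let_def
  using gen_carrier by (auto simp del: free_module_simps intro!: FA.M.minus_closed FA.M.a_closed FA.smult_closed)

sublocale \<Omega>: quotient_module A FA "kaehler_kernel K A"
  unfolding kaehler_kernel_def
  by (intro quotient_moduleI FA.span_is_submodule kaehler_rels_carrier)

lemma module_kaehler: "Module.module A \<Omega>"
  using \<Omega>.module_Q by (simp add: kaehler_def)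

lemma rel_in_kernel: "r \<in> kaehler_rels K A \<Longrightarrow> r \<in> kaehler_kernel K A"
  unfolding kaehler_kernel_def using FA.in_own_span[OF kaehler_rels_carrier] by blast

lemma d_carrier: "a \<in> carrier A \<Longrightarrow> d a \<in> carrier \<Omega>"
  using \<Omega>.\<pi>_carrier[OF gen_carrier] by (simp add: univ_deriv_def kaehler_def)

lemma d_add:
  assumes "a \<in> carrier A" "b \<in> carrier A"
  shows "d (a \<oplus>\<^bsub>A\<^esub> b) = d a \<oplus>\<^bsub>\<Omega>\<^esub> d b"
proof -
  have "free_gen A (a \<oplus>\<^bsub>A\<^esub> b) \<ominus>\<^bsub>FA\<^esub> (free_gen A a \<oplus>\<^bsub>FA\<^esub> free_gen A b) \<in> kaehler_kernel K A"
    by (rule rel_in_kernel) (use assms in \<open>unfold kaehler_rels_def Let_def, blast\<close>)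
  then have "\<Omega>.\<pi> (free_gen A (a \<oplus>\<^bsub>A\<^esub> b)) = \<Omega>.\<pi> (free_gen A a \<oplus>\<^bsub>FA\<^esub> free_gen A b)"
    using assms by (subst \<Omega>.\<pi>_eq_iff) (auto intro!: gen_carrier FA.M.a_closed simp del: free_module_simps)
  also have "\<dots> = \<Omega>.\<pi> (free_gen A a) \<oplus>\<^bsub>\<Omega>\<^esub> \<Omega>.\<pi> (free_gen A b)"
    unfolding kaehler_def using assms by (intro \<Omega>.\<pi>_add[symmetric] gen_carrier)
  finally show ?thesis by (simp add: univ_deriv_def)
qed

lemma d_mult:
  assumes "a \<in> carrier A" "b \<in> carrier A"
  shows "d (a \<otimes>\<^bsub>A\<^esub> b) = a \<odot>\<^bsub>\<Omega>\<^esub> d b \<oplus>\<^bsub>\<Omega>\<^esub> b \<odot>\<^bsub>\<Omega>\<^esub> d a"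
proof -
  have "free_gen A (a \<otimes>\<^bsub>A\<^esub> b) \<ominus>\<^bsub>FA\<^esub> (a \<odot>\<^bsub>FA\<^esub> free_gen A b \<oplus>\<^bsub>FA\<^esub> b \<odot>\<^bsub>FA\<^esub> free_gen A a) \<in> kaehler_kernel K A"
    by (rule rel_in_kernel) (use assms in \<open>unfold kaehler_rels_def Let_def, blast\<close>)
  then have "\<Omega>.\<pi> (free_gen A (a \<otimes>\<^bsub>A\<^esub> b)) = \<Omega>.\<pi> (a \<odot>\<^bsub>FA\<^esub> free_gen A b \<oplus>\<^bsub>FA\<^esub> b \<odot>\<^bsub>FA\<^esub> free_gen A a)"
    using assms by (subst \<Omega>.\<pi>_eq_iff)
      (auto intro!: gen_carrier FA.M.a_closed FA.smult_closed simp del: free_module_simps)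
  also have "\<dots> = a \<odot>\<^bsub>\<Omega>\<^esub> \<Omega>.\<pi> (free_gen A b) \<oplus>\<^bsub>\<Omega>\<^esub> b \<odot>\<^bsub>\<Omega>\<^esub> \<Omega>.\<pi> (free_gen A a)"
    unfolding kaehler_def using assms
    by (simp add: gen_carrier FA.smult_closed del: free_module_simps)
  finally show ?thesis by (simp add: univ_deriv_def)
qed

lemma d_scalar:
  assumes "c \<in> carrier K"
  shows "d (c \<odot>\<^bsub>A\<^esub> \<one>\<^bsub>A\<^esub>) = \<zero>\<^bsub>\<Omega>\<^esub>"
proof -
  have "free_gen A (c \<odot>\<^bsub>A\<^esub> \<one>\<^bsub>A\<^esub>) \<in> kaehler_kernel K A"
    by (rule rel_in_kernel) (use assms in \<open>unfold kaehler_rels_def Let_def, blast\<close>)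
  then show ?thesis unfolding univ_deriv_def kaehler_def
    using assms by (subst \<Omega>.\<pi>_zero_iff) (auto intro!: gen_carrier A.smult_closed simp del: free_module_simps)
qed

end

subsection \<open>Exterior powers\<close>

locale exterior_power = M?: Module.module R M
  for R :: "('r, 'e) ring_scheme" and M :: "('r, 'm) module" (structure) +
  fixes m :: nat
begin

abbreviation FT where "FT \<equiv> free_module R (tuples M m)"
abbreviation E where "E \<equiv> ext_power R M m"

sublocale FT: Module.module R FT
  by (rule cring.module_free_module[OF M.R.is_cring])

lemma gen_carrier: "xs \<in> tuples M m \<Longrightarrow> free_gen R xs \<in> carrier FT"
  by (rule cring.free_gen_carrier[OF M.R.is_cring])

lemma tuples_update: "xs \<in> tuples M m \<Longrightarrow> x \<in> carrier M \<Longrightarrow> xs[i := x] \<in> tuples M m"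
  using set_update_subset_insert[of xs i x] by (auto simp: tuples_def)

lemma ext_rels_carrier: "ext_rels R M m \<subseteq> carrier FT"
  unfolding ext_rels_def Let_def
  by (auto simp del: free_module_simps intro!: FT.M.minus_closed FT.M.a_closed FT.smult_closed
      gen_carrier tuples_update)

sublocale E: quotient_module R FT "ext_kernel R M m"
  unfolding ext_kernel_def
  by (intro quotient_moduleI FT.span_is_submodule ext_rels_carrier)

lemma module_ext_power: "Module.module R E"
  using E.module_Q by (simp add: ext_power_def)

lemma rel_in_kernel: "r \<in> ext_rels R M m \<Longrightarrow> r \<in> ext_kernel R M m"
  unfolding ext_kernel_def using FT.in_own_span[OF ext_rels_carrier] by blast

lemma wedge_eq: "xs \<in> tuples M m \<Longrightarrow> wedge R M xs = E.\<pi> (free_gen R xs)"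
  by (auto simp: wedge_def tuples_def)

lemma wedge_carrier: "xs \<in> tuples M m \<Longrightarrow> wedge R M xs \<in> carrier E"
  using E.\<pi>_carrier[OF gen_carrier] by (simp add: wedge_eq ext_power_def)

lemma wedge_add:
  assumes xs: "xs \<in> tuples M m" and i: "i < m" and x: "x \<in> carrier M" and y: "y \<in> carrier M"
  shows "wedge R M (xs[i := x \<oplus>\<^bsub>M\<^esub> y]) = wedge R M (xs[i := x]) \<oplus>\<^bsub>E\<^esub> wedge R M (xs[i := y])"
proof -
  have c: "free_gen R (xs[i := z]) \<in> carrier FT" if "z \<in> carrier M" for z
    using that xs by (intro gen_carrier tuples_update)
  have "free_gen R (xs[i := x \<oplus>\<^bsub>M\<^esub> y]) \<ominus>\<^bsub>FT\<^esub> (free_gen R (xs[i := x]) \<oplus>\<^bsub>FT\<^esub> free_gen R (xs[i := y])) \<in> ext_kernel R M m"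
    by (rule rel_in_kernel) (use assms in \<open>unfold ext_rels_def Let_def, blast\<close>)
  then have "E.\<pi> (free_gen R (xs[i := x \<oplus>\<^bsub>M\<^esub> y])) = E.\<pi> (free_gen R (xs[i := x]) \<oplus>\<^bsub>FT\<^esub> free_gen R (xs[i := y]))"
    using x y by (subst E.\<pi>_eq_iff) (auto intro!: c FT.M.a_closed simp del: free_module_simps)
  also have "\<dots> = E.\<pi> (free_gen R (xs[i := x])) \<oplus>\<^bsub>E\<^esub> E.\<pi> (free_gen R (xs[i := y]))"
    unfolding ext_power_def using x y by (intro E.\<pi>_add[symmetric] c)
  finally show ?thesis using x y xs by (simp add: wedge_eq tuples_update)
qed

lemma wedge_smult:
  assumes xs: "xs \<in> tuples M m" and i: "i < m" and a: "a \<in> carrier R" and x: "x \<in> carrier M"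
  shows "wedge R M (xs[i := a \<odot>\<^bsub>M\<^esub> x]) = a \<odot>\<^bsub>E\<^esub> wedge R M (xs[i := x])"
proof -
  have c: "free_gen R (xs[i := z]) \<in> carrier FT" if "z \<in> carrier M" for z
    using that xs by (intro gen_carrier tuples_update)
  have "free_gen R (xs[i := a \<odot>\<^bsub>M\<^esub> x]) \<ominus>\<^bsub>FT\<^esub> (a \<odot>\<^bsub>FT\<^esub> free_gen R (xs[i := x])) \<in> ext_kernel R M m"
    by (rule rel_in_kernel) (use assms in \<open>unfold ext_rels_def Let_def, blast\<close>)
  then have "E.\<pi> (free_gen R (xs[i := a \<odot>\<^bsub>M\<^esub> x])) = E.\<pi> (a \<odot>\<^bsub>FT\<^esub> free_gen R (xs[i := x]))"
    using x a by (subst E.\<pi>_eq_iff) (auto intro!: c FT.smult_closed simp del: free_module_simps)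
  also have "\<dots> = a \<odot>\<^bsub>E\<^esub> E.\<pi> (free_gen R (xs[i := x]))"
    unfolding ext_power_def using x a by (intro E.\<pi>_smult[symmetric] c)
  finally show ?thesis using x a xs by (simp add: wedge_eq tuples_update)
qed

lemma wedge_repeat:
  assumes xs: "xs \<in> tuples M m" and ij: "i < m" "j < m" "i \<noteq> j" "xs ! i = xs ! j"
  shows "wedge R M xs = \<zero>\<^bsub>E\<^esub>"
proof -
  have "\<exists>i j. i < j \<and> j < m \<and> xs ! i = xs ! j"
    using ij by (metis linorder_neqE_nat)
  then have "free_gen R xs \<in> ext_kernel R M m"
    by (intro rel_in_kernel) (use xs in \<open>unfold ext_rels_def Let_def, blast\<close>)
  then show ?thesis unfolding wedge_eq[OF xs] ext_power_def
    by (subst E.\<pi>_zero_iff) (auto intro!: gen_carrier xs simp del: free_module_simps)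
qed

end

section \<open>The Jacobian determinant on top forms\<close>

locale poly_quotient =
  fixes n :: nat and I :: "'k::field mpoly set"
  assumes ideal_I: "ideal I (poly_alg n)"
begin

abbreviation R where "R \<equiv> quot_module (poly_alg n) I"
abbreviation cl where "cl f \<equiv> I +>\<^bsub>poly_alg n\<^esub> f"

lemma module_poly_alg: "Module.module class_ring (poly_alg n :: ('k, 'k mpoly) module)"
proof (rule module_criteria)
  show "cring (class_ring :: 'k ring)"
    by (rule class_cring.is_cring)
  show "\<forall>v\<in>polys n. \<exists>w\<in>polys n. v \<oplus>\<^bsub>poly_alg n\<^esub> w = \<zero>\<^bsub>(poly_alg n :: ('k, 'k mpoly) module)\<^esub>"
  proof
    fix v :: "'k mpoly" assume "v \<in> polys n"
    then show "\<exists>w\<in>polys n. v \<oplus>\<^bsub>poly_alg n\<^esub> w = \<zero>\<^bsub>(poly_alg n :: ('k, 'k mpoly) module)\<^esub>"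
      by (intro bexI[of _ "- v"]) simp_all
  qed
  show "\<forall>a b v. a \<in> carrier class_ring \<and> b \<in> carrier class_ring \<and> v \<in> polys n \<longrightarrow>
     (a \<otimes>\<^bsub>class_ring\<^esub> b) \<odot>\<^bsub>poly_alg n\<^esub> v = a \<odot>\<^bsub>poly_alg n\<^esub> (b \<odot>\<^bsub>(poly_alg n :: ('k, 'k mpoly) module)\<^esub> v)"
    by (simp add: mult_single flip: mult.assoc)
qed (simp_all add: algebra_simps single_add)

sublocale quotient_module class_ring "poly_alg n :: ('k, 'k mpoly) module" I
proof (rule quotient_moduleI)
  show "submodule class_ring I (poly_alg n)"
    unfolding submodule_def
    using module_poly_alg poly_ideal_subset[OF ideal_I] poly_ideal_add[OF ideal_I] poly_ideal_zero[OF ideal_I]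
      poly_ideal_mult[OF ideal_I polys_const]
    by auto
qed

lemma cl_eq_iff: "f \<in> polys n \<Longrightarrow> g \<in> polys n \<Longrightarrow> cl f = cl g \<longleftrightarrow> f - g \<in> I"
  by (simp add: \<pi>_eq_iff a_minus_def poly_alg_uminus)

lemma cl_add: "f \<in> polys n \<Longrightarrow> g \<in> polys n \<Longrightarrow> cl f \<oplus>\<^bsub>R\<^esub> cl g = cl (f + g)"
  by simp

lemma cl_mult: "f \<in> polys n \<Longrightarrow> g \<in> polys n \<Longrightarrow> cl f \<otimes>\<^bsub>R\<^esub> cl g = cl (f * g)"
  using ideal.rcoset_mult_add[OF ideal_I, of f g] by (simp add: quot_module_fields)

lemma cl_smult: "f \<in> polys n \<Longrightarrow> c \<odot>\<^bsub>R\<^esub> cl f = cl (Poly_Mapping.single 0 c * f)"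
  by simp

lemma one_R: "\<one>\<^bsub>R\<^esub> = cl 1"
  by (simp add: quot_module_fields)

lemma zero_R: "\<zero>\<^bsub>R\<^esub> = cl 0"
  by (simp add: zero_Q)

lemma cl_zero_iff: "f \<in> polys n \<Longrightarrow> cl f = \<zero>\<^bsub>R\<^esub> \<longleftrightarrow> f \<in> I"
  by (rule \<pi>_zero_iff)

lemma algebra_R: "algebra class_ring R"
proof -
  interpret R: Module.module class_ring R by (rule module_Q)
  have cm: "comm_monoid R"
    by (rule comm_monoidI) (auto elim!: Q_cases simp: one_R cl_mult algebra_simps)
  have "cring R"
    by (rule cringI[OF R.M.abelian_group_axioms cm])
      (auto elim!: Q_cases simp: cl_mult algebra_simps)
  then show ?thesis
    unfolding algebra_def algebra_axioms_def
    using module_Q by (auto elim!: Q_cases simp: cl_mult algebra_simps)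
qed

sublocale RA: kaehler_algebra class_ring R
  unfolding kaehler_algebra_def by (rule algebra_R)

text \<open>The zero class must be represented by 0 itself: the finite sums in \<open>lift\<close>
  can then be extended to any finite set containing the support.\<close>

definition rep :: "'k mpoly set \<Rightarrow> 'k mpoly" where
  "rep C = (if C = \<zero>\<^bsub>R\<^esub> then 0 else SOME f. f \<in> polys n \<and> cl f = C)"

lemma rep:
  assumes "C \<in> carrier R"
  shows rep_polys: "rep C \<in> polys n" and cl_rep: "cl (rep C) = C"
proof -
  obtain f where "f \<in> polys n \<and> cl f = C" using assms Q_cases by metis
  then have "(SOME f. f \<in> polys n \<and> cl f = C) \<in> polys n \<and> cl (SOME f. f \<in> polys n \<and> cl f = C) = C"
    by (rule someI)
  then show "rep C \<in> polys n" "cl (rep C) = C" by (simp_all add: rep_def zero_R)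
qed

lemma rep_zero [simp]: "rep \<zero>\<^bsub>R\<^esub> = 0"
  by (simp add: rep_def)

lemma rep_cl: "f \<in> polys n \<Longrightarrow> rep (cl f) - f \<in> I"
  using cl_eq_iff[of "rep (cl f)" f] rep[of "cl f"] by simp

text \<open>Modulo any ideal containing \<open>I\<close>, \<open>lift g\<close> is the linear form on a free module over the quotient
  ring that takes the value \<open>g b\<close> at the generator \<open>b\<close>.\<close>

definition lift :: "('b \<Rightarrow> 'k mpoly) \<Rightarrow> ('b \<Rightarrow> 'k mpoly set) \<Rightarrow> 'k mpoly" where
  "lift g F = (\<Sum>b\<in>{b. F b \<noteq> \<zero>\<^bsub>R\<^esub>}. rep (F b) * g b)"

lemma lift_superset:
  assumes "finite A" "{b. F b \<noteq> \<zero>\<^bsub>R\<^esub>} \<subseteq> A"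
  shows "lift g F = (\<Sum>b\<in>A. rep (F b) * g b)"
  unfolding lift_def using assms by (intro sum.mono_neutral_left) auto

end

text \<open>\<open>rep\<close> respects sums and products only modulo \<open>I\<close>, hence laws
  of \<open>lift\<close> hold only modulo \<open>J\<close>. Two instances are used: partial
  derivatives on the generators of the Kaehler module, and the Jacobian determinant on tuples of
  1-forms.\<close>

locale poly_quotient_form = poly_quotient n I for n and I :: "'k::field mpoly set" +
  fixes J :: "'k mpoly set" and B :: "'b set" and g :: "'b \<Rightarrow> 'k mpoly"
  assumes ideal_J: "ideal J (poly_alg n)" and I_subset_J: "I \<subseteq> J"
    and g_polys: "\<And>b. b \<in> B \<Longrightarrow> g b \<in> polys n"
begin

abbreviation F where "F \<equiv> free_module R B"

sublocale F: Module.module R F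
  by (rule cring.module_free_module[OF RA.M_cring])

lemma finite_support: "x \<in> carrier F \<Longrightarrow> finite {b. x b \<noteq> \<zero>\<^bsub>R\<^esub>}"
  by simp

lemma coeff: "x \<in> carrier F \<Longrightarrow> x b \<in> carrier R"
  by (rule cring.free_module_coeff[OF RA.M_cring])

lemma support_subset: "x \<in> carrier F \<Longrightarrow> {b. x b \<noteq> \<zero>\<^bsub>R\<^esub>} \<subseteq> B"
  by auto

lemma lift_polys: "x \<in> carrier F \<Longrightarrow> lift g x \<in> polys n"
  unfolding lift_def using support_subset[of x]
  by (intro polys_sum polys_mult rep_polys coeff g_polys) auto

lemma lift_add:
  assumes x: "x \<in> carrier F" and y: "y \<in> carrier F"
  shows "lift g (x \<oplus>\<^bsub>F\<^esub> y) - (lift g x + lift g y) \<in> J"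
proof -
  define A where "A = {b. x b \<noteq> \<zero>\<^bsub>R\<^esub>} \<union> {b. y b \<noteq> \<zero>\<^bsub>R\<^esub>}"
  have A: "finite A" "A \<subseteq> B"
    using finite_support[OF x] finite_support[OF y] support_subset[OF x] support_subset[OF y]
    by (auto simp: A_def)
  have "lift g (x \<oplus>\<^bsub>F\<^esub> y) = (\<Sum>b\<in>A. rep (x b \<oplus>\<^bsub>R\<^esub> y b) * g b)"
    using A by (subst lift_superset[of A]) (auto simp: A_def)
  moreover have "lift g x = (\<Sum>b\<in>A. rep (x b) * g b)" "lift g y = (\<Sum>b\<in>A. rep (y b) * g b)"
    using A by (subst lift_superset[of A]; auto simp: A_def)+
  ultimately have "lift g (x \<oplus>\<^bsub>F\<^esub> y) - (lift g x + lift g y) =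
      (\<Sum>b\<in>A. (rep (x b \<oplus>\<^bsub>R\<^esub> y b) - (rep (x b) + rep (y b))) * g b)"
    by (simp add: sum.distrib sum_subtractf algebra_simps)
  also have "\<dots> \<in> J"
  proof (rule poly_ideal_sum[OF ideal_J])
    fix b assume b: "b \<in> A"
    have r: "rep (x b) \<in> polys n" "rep (y b) \<in> polys n" using x y coeff rep_polys by blast+
    have "x b \<oplus>\<^bsub>R\<^esub> y b = cl (rep (x b) + rep (y b))"
      using cl_add[OF r] cl_rep[OF coeff[OF x]] cl_rep[OF coeff[OF y]] by metis
    then have "rep (x b \<oplus>\<^bsub>R\<^esub> y b) - (rep (x b) + rep (y b)) \<in> J"
      using rep_cl[OF polys_add[OF r]] I_subset_J by auto
    then show "(rep (x b \<oplus>\<^bsub>R\<^esub> y b) - (rep (x b) + rep (y b))) * g b \<in> J"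
      using b A by (intro poly_ideal_mult2[OF ideal_J] g_polys) auto
  qed
  finally show ?thesis .
qed

lemma lift_smult:
  assumes x: "x \<in> carrier F" and a: "a \<in> polys n"
  shows "lift g (cl a \<odot>\<^bsub>F\<^esub> x) - a * lift g x \<in> J"
proof -
  define A where "A = {b. x b \<noteq> \<zero>\<^bsub>R\<^esub>}"
  have A: "finite A" "A \<subseteq> B"
    using finite_support[OF x] support_subset[OF x] by (auto simp: A_def)
  have mult: "cl a \<otimes>\<^bsub>R\<^esub> x b = cl (a * rep (x b))" for b
    using cl_mult[OF a rep_polys[OF coeff[OF x]]] cl_rep[OF coeff[OF x]] by metis
  have "cl a \<otimes>\<^bsub>R\<^esub> \<zero>\<^bsub>R\<^esub> = \<zero>\<^bsub>R\<^esub>"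
    using cl_mult[OF a polys_zero] by (simp only: zero_R mult_zero_right)
  then have "x b \<noteq> \<zero>\<^bsub>R\<^esub>" if "cl a \<otimes>\<^bsub>R\<^esub> x b \<noteq> \<zero>\<^bsub>R\<^esub>" for b
    using that by metis
  then have "{b. cl a \<otimes>\<^bsub>R\<^esub> x b \<noteq> \<zero>\<^bsub>R\<^esub>} \<subseteq> A"
    unfolding A_def by blast
  then have "lift g (cl a \<odot>\<^bsub>F\<^esub> x) = (\<Sum>b\<in>A. rep (cl a \<otimes>\<^bsub>R\<^esub> x b) * g b)"
    using lift_superset[OF A(1), of "cl a \<odot>\<^bsub>F\<^esub> x"] by simp
  then have "lift g (cl a \<odot>\<^bsub>F\<^esub> x) - a * lift g x = (\<Sum>b\<in>A. (rep (cl a \<otimes>\<^bsub>R\<^esub> x b) - a * rep (x b)) * g b)"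
    by (simp add: lift_def A_def sum_subtractf sum_distrib_left algebra_simps)
  also have "\<dots> \<in> J"
  proof (rule poly_ideal_sum[OF ideal_J])
    fix b assume b: "b \<in> A"
    have "rep (cl a \<otimes>\<^bsub>R\<^esub> x b) - a * rep (x b) \<in> J"
      unfolding mult using rep_cl[OF polys_mult[OF a rep_polys[OF coeff[OF x]]]] I_subset_J by auto
    then show "(rep (cl a \<otimes>\<^bsub>R\<^esub> x b) - a * rep (x b)) * g b \<in> J"
      using b A by (intro poly_ideal_mult2[OF ideal_J] g_polys) auto
  qed
  finally show ?thesis .
qed

lemma lift_smult_mem:
  assumes "x \<in> carrier F" "C \<in> carrier R"
  shows "lift g (C \<odot>\<^bsub>F\<^esub> x) - rep C * lift g x \<in> J"
  using lift_smult[OF assms(1) rep_polys[OF assms(2)]] cl_rep[OF assms(2)] by metis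

lemma lift_gen:
  assumes "b \<in> B"
  shows "lift g (free_gen R b) - g b \<in> J"
proof -
  have "lift g (free_gen R b) = rep \<one>\<^bsub>R\<^esub> * g b"
    by (subst lift_superset[of "{b}"]) (auto simp: free_gen_def)
  then have "lift g (free_gen R b) - g b = (rep (cl 1) - 1) * g b"
    by (simp add: one_R algebra_simps)
  moreover have "rep (cl 1) - 1 \<in> J" using rep_cl[of 1] I_subset_J by auto
  ultimately show ?thesis using g_polys[OF assms] poly_ideal_mult2[OF ideal_J] by metis
qed

lemma lift_minus:
  assumes x: "x \<in> carrier F" and y: "y \<in> carrier F"
  shows "lift g (x \<ominus>\<^bsub>F\<^esub> y) - (lift g x - lift g y) \<in> J"
proof -
  have "(x \<ominus>\<^bsub>F\<^esub> y) \<oplus>\<^bsub>F\<^esub> y = x"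
    using x y by (simp only: a_minus_def F.M.a_assoc F.M.a_inv_closed F.M.l_neg F.M.r_zero)
  then have "lift g x - (lift g (x \<ominus>\<^bsub>F\<^esub> y) + lift g y) \<in> J"
    using lift_add[OF F.M.minus_closed[OF x y] y] by metis
  then have "- (lift g x - (lift g (x \<ominus>\<^bsub>F\<^esub> y) + lift g y)) \<in> J"
    by (rule poly_ideal_uminus[OF ideal_J])
  then show ?thesis by (simp add: algebra_simps)
qed

text \<open>The elements whose \<open>lift\<close> falls in \<open>J\<close> form a submodule. So a
  linear form descends to a quotient module once its values on the defining relations lie in
  \<open>J\<close>.\<close>

lemma lift_span:
  assumes S: "S \<subseteq> carrier F" and "\<And>x. x \<in> S \<Longrightarrow> lift g x \<in> J" and x: "x \<in> LinearCombinations.module.span R F S"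
  shows "lift g x \<in> J"
proof -
  have "submodule R {x \<in> carrier F. lift g x \<in> J} F"
    unfolding submodule_def
  proof (intro conjI allI impI)
    show "Module.module R F" by (rule F.module_axioms)
    show "{x \<in> carrier F. lift g x \<in> J} \<subseteq> carrier F" by blast
    show "\<zero>\<^bsub>F\<^esub> \<in> {x \<in> carrier F. lift g x \<in> J}"
      using poly_ideal_zero[OF ideal_J] by (simp add: lift_def)
  next
    fix v w assume "v \<in> {x \<in> carrier F. lift g x \<in> J}" "w \<in> {x \<in> carrier F. lift g x \<in> J}"
    then have vw: "v \<in> carrier F" "w \<in> carrier F" "lift g v \<in> J" "lift g w \<in> J" by blast+
    have "lift g (v \<oplus>\<^bsub>F\<^esub> w) - (lift g v + lift g w) + (lift g v + lift g w) \<in> J"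
      by (intro poly_ideal_add[OF ideal_J] lift_add vw)
    then show "v \<oplus>\<^bsub>F\<^esub> w \<in> {x \<in> carrier F. lift g x \<in> J}"
      using F.M.a_closed[OF vw(1,2)] by (simp del: free_module_simps)
  next
    fix C v assume C: "C \<in> carrier R" and "v \<in> {x \<in> carrier F. lift g x \<in> J}"
    then have v: "v \<in> carrier F" "lift g v \<in> J" by blast+
    have "lift g (C \<odot>\<^bsub>F\<^esub> v) - rep C * lift g v + rep C * lift g v \<in> J"
      by (intro poly_ideal_add[OF ideal_J] poly_ideal_mult[OF ideal_J] lift_smult_mem v C rep_polys)
    then show "C \<odot>\<^bsub>F\<^esub> v \<in> {x \<in> carrier F. lift g x \<in> J}"
      using F.smult_closed[OF C v(1)] by (simp del: free_module_simps)
  qed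
  moreover have "S \<subseteq> {x \<in> carrier F. lift g x \<in> J}" using assms by blast
  ultimately have "LinearCombinations.module.span R F S \<subseteq> {x \<in> carrier F. lift g x \<in> J}"
    by (intro F.span_is_subset)
  then show ?thesis using x by blast
qed

end

subsection \<open>Determinants modulo an ideal\<close>

text \<open>The Leibniz formula on plain functions, since congruences modulo an ideal can be checked
  term by term on the sum. The matrix determinant supplies only equal rows and the identity.\<close>

definition leibniz_det :: "nat \<Rightarrow> (nat \<Rightarrow> nat \<Rightarrow> 'a::comm_ring_1) \<Rightarrow> 'a" where
  "leibniz_det m A = (\<Sum>p | p permutes {0..<m}. of_int (sign p) * (\<Prod>i = 0..<m. A i (p i)))"

lemma leibniz_det_eq: "leibniz_det m A = det (mat m m (\<lambda>(i, j). A i j))"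
  unfolding leibniz_det_def
  by (subst det_def'[of _ m]) (auto intro!: sum.cong prod.cong simp: permutes_in_image)

lemma leibniz_det_identical_rows:
  assumes "i < m" "j < m" "i \<noteq> j" "\<And>k. A i k = A j k"
  shows "leibniz_det m A = 0"
  unfolding leibniz_det_eq
  by (rule det_identical_rows[of _ m i j]) (use assms in \<open>auto intro!: eq_vecI\<close>)

lemma leibniz_det_one: "leibniz_det m (\<lambda>i j. if i = j then 1 else 0) = 1"
proof -
  have "mat m m (\<lambda>(i, j). if i = j then 1 else 0) = (1\<^sub>m m :: 'a mat)"
    by (rule eq_matI) auto
  then show ?thesis by (simp add: leibniz_det_eq)
qed

lemma polys_of_int [simp, intro]: "of_int k \<in> polys n"
  by (cases k) (auto intro!: polys_diff)

lemma leibniz_det_polys: "(\<And>i j. A i j \<in> polys n) \<Longrightarrow> leibniz_det m A \<in> polys n"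
  unfolding leibniz_det_def by (intro polys_sum polys_mult polys_prod) auto

lemma poly_ideal_cong_prod:
  assumes J: "ideal J (poly_alg n)" and "finite T"
    and "\<And>t. t \<in> T \<Longrightarrow> f t \<in> polys n" "\<And>t. t \<in> T \<Longrightarrow> g t \<in> polys n" "\<And>t. t \<in> T \<Longrightarrow> f t - g t \<in> J"
  shows "prod f T - prod g T \<in> J"
  using assms(2-)
proof (induction T)
  case empty
  then show ?case using poly_ideal_zero[OF J] by simp
next
  case (insert t T)
  have "f t * prod f T - g t * prod g T \<in> J"
    using insert by (intro poly_ideal_cong_mult[OF J]) (auto intro!: polys_prod)
  then show ?case using insert by simp
qed

lemma leibniz_det_cong:
  assumes J: "ideal J (poly_alg n)" and A: "\<And>i j. A i j \<in> polys n" "\<And>i j. A' i j \<in> polys n"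
    and cong: "\<And>i j. i < m \<Longrightarrow> j < m \<Longrightarrow> A i j - A' i j \<in> J"
  shows "leibniz_det m A - leibniz_det m A' \<in> J"
proof -
  have "leibniz_det m A - leibniz_det m A' =
      (\<Sum>p | p permutes {0..<m}. of_int (sign p) * ((\<Prod>i = 0..<m. A i (p i)) - (\<Prod>i = 0..<m. A' i (p i))))"
    by (simp add: leibniz_det_def sum_subtractf algebra_simps)
  also have "\<dots> \<in> J"
  proof (intro poly_ideal_sum[OF J] poly_ideal_mult[OF J] polys_of_int poly_ideal_cong_prod[OF J])
    fix p i assume "p \<in> {p. p permutes {0..<m}}" "i \<in> {0..<m}"
    then have "p i < m" using permutes_in_image[of p "{0..<m}" i] by auto
    then show "A i (p i) - A' i (p i) \<in> J" using cong \<open>i \<in> {0..<m}\<close> by simp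
  qed (auto simp: A)
  finally show ?thesis .
qed

text \<open>Each permutation contributes exactly one entry of row i, which is factored out of the
  product. Coefficients 1, 1 give additivity in a row, and coefficients \<open>a\<close>, 0 give
  homogeneity.\<close>

lemma leibniz_det_row_linear:
  assumes J: "ideal J (poly_alg n)" and i: "i < m"
    and pol: "\<And>i j. A i j \<in> polys n"
    and row: "\<And>j. A i j - (a * A1 i j + b * A2 i j) \<in> J"
    and other: "\<And>i' j. i' \<noteq> i \<Longrightarrow> A1 i' j = A i' j" "\<And>i' j. i' \<noteq> i \<Longrightarrow> A2 i' j = A i' j"
  shows "leibniz_det m A - (a * leibniz_det m A1 + b * leibniz_det m A2) \<in> J"
proof -
  have split: "(\<Prod>k = 0..<m. M k (p k)) = M i (p i) * (\<Prod>k\<in>{0..<m} - {i}. M k (p k))"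
    for M :: "nat \<Rightarrow> nat \<Rightarrow> 'a mpoly" and p
    using i by (intro prod.remove) auto
  have o1: "(\<Prod>k\<in>{0..<m} - {i}. A1 k (p k)) = (\<Prod>k\<in>{0..<m} - {i}. A k (p k))" for p
    using other by (intro prod.cong) auto
  have o2: "(\<Prod>k\<in>{0..<m} - {i}. A2 k (p k)) = (\<Prod>k\<in>{0..<m} - {i}. A k (p k))" for p
    using other by (intro prod.cong) auto
  have "leibniz_det m A - (a * leibniz_det m A1 + b * leibniz_det m A2) =
    (\<Sum>p | p permutes {0..<m}. of_int (sign p) *
       ((A i (p i) - (a * A1 i (p i) + b * A2 i (p i))) * (\<Prod>k\<in>{0..<m} - {i}. A k (p k))))"
    by (simp add: leibniz_det_def split o1 o2 sum_subtractf sum.distrib sum_distrib_left algebra_simps)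
  also have "\<dots> \<in> J"
    by (intro poly_ideal_sum[OF J] poly_ideal_mult[OF J] poly_ideal_mult2[OF J] polys_of_int polys_prod pol row)
  finally show ?thesis .
qed

section \<open>The differentials dx_i and the top form\<close>

context poly_quotient
begin

abbreviation "Om \<equiv> kaehler class_ring R"
abbreviation dx where "dx i \<equiv> univ_deriv class_ring R (cl (poly_var i))"

lemmas Om_smult_closed = Module.module.smult_closed[OF RA.module_kaehler]
  and Om_add_closed = abelian_monoid.a_closed[OF abelian_group.axioms(1)[OF Module.module.axioms(2)[OF RA.module_kaehler]]]

lemma exterior_power_Om: "exterior_power R Om"
  unfolding exterior_power_def by (rule RA.module_kaehler)

definition top_form where "top_form = wedge R Om (map dx [0..<Suc n])"

sublocale W: exterior_power R Om "Suc n"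
  by (rule exterior_power_Om)

lemma dx_carrier: "i \<le> n \<Longrightarrow> dx i \<in> carrier Om"
  by (intro RA.d_carrier \<pi>_carrier polys_var)

lemma top_tuple: "map dx [0..<Suc n] \<in> tuples Om (Suc n)"
  using dx_carrier by (auto simp: tuples_def)

lemma top_form_carrier: "top_form \<in> carrier W.E"
  unfolding top_form_def by (rule W.wedge_carrier[OF top_tuple])

end

text \<open>Abstracts the pair I_{\<nu>+1}, I_\<nu>. The condition on derivatives is what makes the
  partial derivatives of a residue class well defined modulo \<open>J\<close>.\<close>

locale poly_quotient_pair = poly_quotient n I for n and I :: "'k::field mpoly set" +
  fixes J :: "'k mpoly set"
  assumes ideal_J: "ideal J (poly_alg n)" and I_subset_J: "I \<subseteq> J"
    and partial_I: "\<And>f i. f \<in> I \<Longrightarrow> i \<le> n \<Longrightarrow> partial i f \<in> J"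
begin

text \<open>The coefficient of dx_j, computed on the free module before dividing by the Kaehler
  relations: the generator of a class goes to the derivative of a representative.\<close>

abbreviation gradF where "gradF j \<equiv> lift (\<lambda>C. partial j (rep C))"

lemma grad_form: "poly_quotient_form n I J (carrier R) (\<lambda>C. partial j (rep C))"
  using ideal_I ideal_J I_subset_J rep_polys
  by (auto simp: poly_quotient_form_def poly_quotient_form_axioms_def poly_quotient_def)

lemmas gradF_add = poly_quotient_form.lift_add[OF grad_form]
  and gradF_smult = poly_quotient_form.lift_smult_mem[OF grad_form]
  and gradF_gen = poly_quotient_form.lift_gen[OF grad_form]
  and gradF_minus = poly_quotient_form.lift_minus[OF grad_form]
  and gradF_polys = poly_quotient_form.lift_polys[OF grad_form]
  and gradF_span = poly_quotient_form.lift_span[OF grad_form]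

lemmas J_add = poly_ideal_add[OF ideal_J] and J_diff = poly_ideal_diff[OF ideal_J]
  and J_mult = poly_ideal_mult[OF ideal_J] and J_trans = poly_ideal_trans[OF ideal_J]
  and J_comm = poly_ideal_minus_commute[OF ideal_J]

lemma J_cong_diff: "a - a' \<in> J \<Longrightarrow> b - b' \<in> J \<Longrightarrow> (a - b) - (a' - b') \<in> J"
  using J_diff[of "a - a'" "b - b'"] by (simp add: algebra_simps)

lemma J_cong_add: "a - a' \<in> J \<Longrightarrow> b - b' \<in> J \<Longrightarrow> (a + b) - (a' + b') \<in> J"
  using J_add[of "a - a'" "b - b'"] by (simp add: algebra_simps)

lemma J_cong_mult: "b - b' \<in> J \<Longrightarrow> a \<in> polys n \<Longrightarrow> a * b - a * b' \<in> J"
  using J_mult[of a "b - b'"] by (simp add: algebra_simps)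

lemma J_cong_mem: "a - b \<in> J \<Longrightarrow> b \<in> J \<Longrightarrow> a \<in> J"
  using J_add[of "a - b" b] by simp

lemma rep_add:
  assumes "a \<in> carrier R" "b \<in> carrier R"
  shows "rep (a \<oplus>\<^bsub>R\<^esub> b) - (rep a + rep b) \<in> I"
  using rep_cl[OF polys_add[OF rep_polys[OF assms(1)] rep_polys[OF assms(2)]]]
    cl_add[OF rep_polys[OF assms(1)] rep_polys[OF assms(2)]] by (simp only: cl_rep assms)

lemma rep_mult:
  assumes "a \<in> carrier R" "b \<in> carrier R"
  shows "rep (a \<otimes>\<^bsub>R\<^esub> b) - rep a * rep b \<in> I"
  using rep_cl[OF polys_mult[OF rep_polys[OF assms(1)] rep_polys[OF assms(2)]]]
    cl_mult[OF rep_polys[OF assms(1)] rep_polys[OF assms(2)]] by (simp only: cl_rep assms)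

text \<open>Partial derivatives satisfy additivity and the product rule exactly. What remains is
  that the representative of a sum, a product or a constant differs from the expected polynomial by
  an element of \<open>I\<close>, whose derivatives lie in \<open>J\<close>.\<close>

lemma gradF_rels:
  assumes "r \<in> kaehler_rels class_ring R" and j: "j \<le> n"
  shows "gradF j r \<in> J"
proof -
  note gc = RA.gen_carrier
  consider (add) a b where "a \<in> carrier R" "b \<in> carrier R"
      "r = free_gen R (a \<oplus>\<^bsub>R\<^esub> b) \<ominus>\<^bsub>RA.FA\<^esub> (free_gen R a \<oplus>\<^bsub>RA.FA\<^esub> free_gen R b)"
    | (mult) a b where "a \<in> carrier R" "b \<in> carrier R"
      "r = free_gen R (a \<otimes>\<^bsub>R\<^esub> b) \<ominus>\<^bsub>RA.FA\<^esub> (a \<odot>\<^bsub>RA.FA\<^esub> free_gen R b \<oplus>\<^bsub>RA.FA\<^esub> b \<odot>\<^bsub>RA.FA\<^esub> free_gen R a)"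
    | (scalar) c where "r = free_gen R (c \<odot>\<^bsub>R\<^esub> \<one>\<^bsub>R\<^esub>)"
    using assms(1) unfolding kaehler_rels_def Let_def by blast
  then show ?thesis
  proof cases
    case add
    have c: "a \<oplus>\<^bsub>R\<^esub> b \<in> carrier R" using add by (intro RA.A.M.a_closed)
    have 1: "gradF j r - (partial j (rep (a \<oplus>\<^bsub>R\<^esub> b)) - (partial j (rep a) + partial j (rep b))) \<in> J"
      unfolding add(3)
      by (rule J_trans[OF gradF_minus], (intro gc c RA.FA.M.a_closed add)+,
          intro J_cong_diff gradF_gen c J_trans[OF gradF_add] gc add J_cong_add)
    have "partial j (rep (a \<oplus>\<^bsub>R\<^esub> b) - (rep a + rep b)) \<in> J"
      by (rule partial_I[OF rep_add[OF add(1,2)] j])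
    then show ?thesis using J_cong_mem[OF 1] by simp
  next
    case mult
    have c: "a \<otimes>\<^bsub>R\<^esub> b \<in> carrier R" using mult by (intro RA.A.m_closed)
    have sm: "gradF j (x \<odot>\<^bsub>RA.FA\<^esub> free_gen R y) - rep x * partial j (rep y) \<in> J"
      if "x \<in> carrier R" "y \<in> carrier R" for x y
      by (rule J_trans[OF gradF_smult], (intro gc that)+, intro J_cong_mult gradF_gen rep_polys that)
    have 1: "gradF j r - (partial j (rep (a \<otimes>\<^bsub>R\<^esub> b)) - (rep a * partial j (rep b) + rep b * partial j (rep a))) \<in> J"
      unfolding mult(3)
      by (rule J_trans[OF gradF_minus], (intro gc c RA.FA.M.a_closed RA.FA.smult_closed mult)+,
          intro J_cong_diff gradF_gen c, rule J_trans[OF gradF_add],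
          (intro gc RA.FA.smult_closed mult)+, intro J_cong_add sm mult)
    have "partial j (rep (a \<otimes>\<^bsub>R\<^esub> b) - rep a * rep b) \<in> J"
      by (rule partial_I[OF rep_mult[OF mult(1,2)] j])
    then show ?thesis using J_cong_mem[OF 1] by (simp add: partial_mult algebra_simps)
  next
    case scalar
    have e: "c \<odot>\<^bsub>R\<^esub> \<one>\<^bsub>R\<^esub> = cl (Poly_Mapping.single 0 c)"
      using cl_smult[OF polys_one, of c] by (simp add: one_R)
    have 1: "gradF j r - partial j (rep (cl (Poly_Mapping.single 0 c))) \<in> J"
      unfolding scalar e by (intro gradF_gen \<pi>_carrier polys_const)
    have "partial j (rep (cl (Poly_Mapping.single 0 c)) - Poly_Mapping.single 0 c) \<in> J"
      by (intro partial_I rep_cl polys_const j)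
    then show ?thesis using J_cong_mem[OF 1] by simp
  qed
qed

lemma gradF_kernel: "x \<in> kaehler_kernel class_ring R \<Longrightarrow> j \<le> n \<Longrightarrow> gradF j x \<in> J"
  unfolding kaehler_kernel_def
  by (rule gradF_span[OF RA.kaehler_rels_carrier gradF_rels])

text \<open>An arbitrary preimage in the free module is chosen; by \<open>gradF_kernel\<close>
  another choice changes the value only by an element of \<open>J\<close>.\<close>

definition grad where
  "grad j w = gradF j (SOME x. x \<in> carrier RA.FA \<and> RA.\<Omega>.\<pi> x = w)"

lemma grad_cong:
  assumes x: "x \<in> carrier RA.FA" and j: "j \<le> n"
  shows "grad j (RA.\<Omega>.\<pi> x) - gradF j x \<in> J" and "grad j (RA.\<Omega>.\<pi> x) \<in> polys n"
proof -
  define y where "y = (SOME y. y \<in> carrier RA.FA \<and> RA.\<Omega>.\<pi> y = RA.\<Omega>.\<pi> x)"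
  have y: "y \<in> carrier RA.FA \<and> RA.\<Omega>.\<pi> y = RA.\<Omega>.\<pi> x"
    unfolding y_def by (rule someI[of _ x]) (use x in blast)
  then have "y \<ominus>\<^bsub>RA.FA\<^esub> x \<in> kaehler_kernel class_ring R"
    using RA.\<Omega>.\<pi>_eq_iff[of y x] x by blast
  then have "gradF j (y \<ominus>\<^bsub>RA.FA\<^esub> x) \<in> J" using j by (rule gradF_kernel)
  then have "gradF j y - gradF j x \<in> J"
    using J_cong_mem[OF J_comm[OF gradF_minus[of y x]]] x y by blast
  then show "grad j (RA.\<Omega>.\<pi> x) - gradF j x \<in> J" by (simp only: grad_def y_def)
  show "grad j (RA.\<Omega>.\<pi> x) \<in> polys n"
    unfolding grad_def y_def[symmetric] using y gradF_polys by blast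
qed

lemma Om_cases:
  assumes "w \<in> carrier Om"
  obtains x where "x \<in> carrier RA.FA" "w = RA.\<Omega>.\<pi> x"
  using assms RA.\<Omega>.Q_cases unfolding kaehler_def by blast

lemma grad_polys: "w \<in> carrier Om \<Longrightarrow> j \<le> n \<Longrightarrow> grad j w \<in> polys n"
  by (elim Om_cases) (simp only: grad_cong)

lemma grad_add:
  assumes "v \<in> carrier Om" "w \<in> carrier Om" and j: "j \<le> n"
  shows "grad j (v \<oplus>\<^bsub>Om\<^esub> w) - (grad j v + grad j w) \<in> J"
proof -
  obtain x y where x: "x \<in> carrier RA.FA" "v = RA.\<Omega>.\<pi> x" and y: "y \<in> carrier RA.FA" "w = RA.\<Omega>.\<pi> y"
    using assms by (elim Om_cases)
  have e: "v \<oplus>\<^bsub>Om\<^esub> w = RA.\<Omega>.\<pi> (x \<oplus>\<^bsub>RA.FA\<^esub> y)"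
    unfolding x(2) y(2) kaehler_def by (rule RA.\<Omega>.\<pi>_add[OF x(1) y(1)])
  have 1: "grad j (RA.\<Omega>.\<pi> (x \<oplus>\<^bsub>RA.FA\<^esub> y)) - gradF j (x \<oplus>\<^bsub>RA.FA\<^esub> y) \<in> J"
    by (intro grad_cong RA.FA.M.a_closed x y j)
  have 2: "gradF j (x \<oplus>\<^bsub>RA.FA\<^esub> y) - (gradF j x + gradF j y) \<in> J"
    by (intro gradF_add x y)
  have 3: "(gradF j x + gradF j y) - (grad j v + grad j w) \<in> J"
    unfolding x(2) y(2) by (intro J_cong_add J_comm[OF grad_cong(1)] x y j)
  show ?thesis unfolding e by (rule J_trans[OF 1 J_trans[OF 2 3]])
qed

lemma grad_smult:
  assumes "a \<in> carrier R" "w \<in> carrier Om" and j: "j \<le> n"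
  shows "grad j (a \<odot>\<^bsub>Om\<^esub> w) - rep a * grad j w \<in> J"
proof -
  obtain x where x: "x \<in> carrier RA.FA" "w = RA.\<Omega>.\<pi> x"
    using assms by (elim Om_cases)
  have e: "a \<odot>\<^bsub>Om\<^esub> w = RA.\<Omega>.\<pi> (a \<odot>\<^bsub>RA.FA\<^esub> x)"
    unfolding x(2) kaehler_def by (rule RA.\<Omega>.\<pi>_smult[OF assms(1) x(1)])
  have 1: "grad j (RA.\<Omega>.\<pi> (a \<odot>\<^bsub>RA.FA\<^esub> x)) - gradF j (a \<odot>\<^bsub>RA.FA\<^esub> x) \<in> J"
    by (intro grad_cong RA.FA.smult_closed assms x j)
  have 2: "gradF j (a \<odot>\<^bsub>RA.FA\<^esub> x) - rep a * gradF j x \<in> J"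
    by (intro gradF_smult x assms)
  have 3: "rep a * gradF j x - rep a * grad j w \<in> J"
    unfolding x(2) by (intro J_cong_mult J_comm[OF grad_cong(1)] x j rep_polys assms)
  show ?thesis unfolding e by (rule J_trans[OF 1 J_trans[OF 2 3]])
qed

lemma grad_d:
  assumes f: "f \<in> polys n" and j: "j \<le> n"
  shows "grad j (univ_deriv class_ring R (cl f)) - partial j f \<in> J"
proof -
  have c: "cl f \<in> carrier R" using f by (rule \<pi>_carrier)
  have 1: "grad j (univ_deriv class_ring R (cl f)) - gradF j (free_gen R (cl f)) \<in> J"
    unfolding univ_deriv_def by (rule grad_cong(1)[OF RA.gen_carrier[OF c] j])
  have 2: "gradF j (free_gen R (cl f)) - partial j (rep (cl f)) \<in> J"
    by (rule gradF_gen[OF c])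
  have 3: "partial j (rep (cl f)) - partial j f \<in> J"
    using partial_I[OF rep_cl[OF f] j] by simp
  show ?thesis by (rule J_trans[OF 1 J_trans[OF 2 3]])
qed

text \<open>Entries outside the square of size n + 1 are set to 0 because the determinant lemmas ask
  for polynomial entries at all indices.\<close>

definition jacobian where
  "jacobian ws = leibniz_det (Suc n) (\<lambda>i j. if i \<le> n \<and> j \<le> n then grad j (ws ! i) else 0)"

lemma tuple_nth: "ws \<in> tuples Om (Suc n) \<Longrightarrow> i \<le> n \<Longrightarrow> ws ! i \<in> carrier Om"
  by (auto simp: tuples_def)

lemma entry_polys:
  "ws \<in> tuples Om (Suc n) \<Longrightarrow> (if i \<le> n \<and> j \<le> n then grad j (ws ! i) else 0) \<in> polys n"
  using grad_polys tuple_nth by auto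

lemma jacobian_polys: "ws \<in> tuples Om (Suc n) \<Longrightarrow> jacobian ws \<in> polys n"
  unfolding jacobian_def by (intro leibniz_det_polys entry_polys)

lemma jacobian_form: "poly_quotient_form n I J (tuples Om (Suc n)) jacobian"
  using ideal_I ideal_J I_subset_J jacobian_polys
  by (auto simp: poly_quotient_form_def poly_quotient_form_axioms_def poly_quotient_def)

lemma jacobian_add:
  assumes ws: "ws \<in> tuples Om (Suc n)" and i: "i < Suc n" and x: "x \<in> carrier Om" and y: "y \<in> carrier Om"
  shows "jacobian (ws[i := x \<oplus>\<^bsub>Om\<^esub> y]) - (jacobian (ws[i := x]) + jacobian (ws[i := y])) \<in> J"
proof -
  have len: "length ws = Suc n" using ws by (simp add: tuples_def)
  have "jacobian (ws[i := x \<oplus>\<^bsub>Om\<^esub> y]) - (1 * jacobian (ws[i := x]) + 1 * jacobian (ws[i := y])) \<in> J"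
    unfolding jacobian_def
  proof (rule leibniz_det_row_linear[OF ideal_J i])
    show "(if i' \<le> n \<and> j \<le> n then grad j (ws[i := x \<oplus>\<^bsub>Om\<^esub> y] ! i') else 0) \<in> polys n" for i' j
      by (intro entry_polys W.tuples_update ws Om_add_closed x y)
    show "(if i \<le> n \<and> j \<le> n then grad j (ws[i := x \<oplus>\<^bsub>Om\<^esub> y] ! i) else 0) -
        (1 * (if i \<le> n \<and> j \<le> n then grad j (ws[i := x] ! i) else 0) +
         1 * (if i \<le> n \<and> j \<le> n then grad j (ws[i := y] ! i) else 0)) \<in> J" for j
      using grad_add[OF x y, of j] i len poly_ideal_zero[OF ideal_J] by simp
  qed simp_all
  then show ?thesis by simp
qed

lemma jacobian_smult:
  assumes ws: "ws \<in> tuples Om (Suc n)" and i: "i < Suc n" and a: "a \<in> carrier R" and x: "x \<in> carrier Om"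
  shows "jacobian (ws[i := a \<odot>\<^bsub>Om\<^esub> x]) - rep a * jacobian (ws[i := x]) \<in> J"
proof -
  have len: "length ws = Suc n" using ws by (simp add: tuples_def)
  \<comment> \<open>The summand with coefficient 0 is a dummy that brings the claim into the shape
    of \<open>leibniz_det_row_linear\<close>.\<close>
  have "jacobian (ws[i := a \<odot>\<^bsub>Om\<^esub> x]) - (rep a * jacobian (ws[i := x]) + 0 * jacobian (ws[i := x])) \<in> J"
    unfolding jacobian_def
  proof (rule leibniz_det_row_linear[OF ideal_J i])
    show "(if i' \<le> n \<and> j \<le> n then grad j (ws[i := a \<odot>\<^bsub>Om\<^esub> x] ! i') else 0) \<in> polys n" for i' j
      by (intro entry_polys W.tuples_update ws Om_smult_closed x a)
    show "(if i \<le> n \<and> j \<le> n then grad j (ws[i := a \<odot>\<^bsub>Om\<^esub> x] ! i) else 0) -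
        (rep a * (if i \<le> n \<and> j \<le> n then grad j (ws[i := x] ! i) else 0) +
         0 * (if i \<le> n \<and> j \<le> n then grad j (ws[i := x] ! i) else 0)) \<in> J" for j
      using grad_smult[OF a x, of j] i len poly_ideal_zero[OF ideal_J] by simp
  qed simp_all
  then show ?thesis by simp
qed

lemma jacobian_repeat:
  assumes "i < j" "j < Suc n" "ws ! i = ws ! j"
  shows "jacobian ws = 0"
  unfolding jacobian_def
  by (rule leibniz_det_identical_rows[of i _ j]) (use assms in auto)

lemma jacobian_top: "jacobian (map dx [0..<Suc n]) - 1 \<in> J"
proof -
  let ?A' = "\<lambda>i j. if i = j then 1 else 0 :: 'k mpoly"
  have "jacobian (map dx [0..<Suc n]) - leibniz_det (Suc n) ?A' \<in> J"
    unfolding jacobian_def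
  proof (rule leibniz_det_cong[OF ideal_J])
    show "(if i \<le> n \<and> j \<le> n then grad j (map dx [0..<Suc n] ! i) else 0) \<in> polys n" for i j
      by (intro entry_polys top_tuple)
    show "(if i \<le> n \<and> j \<le> n then grad j (map dx [0..<Suc n] ! i) else 0) - ?A' i j \<in> J"
      if "i < Suc n" "j < Suc n" for i j
    proof -
      have "map dx [0..<Suc n] ! i = dx i" using that(1) by (simp del: upt_Suc)
      moreover have "partial j (poly_var i) = ?A' i j" by (auto simp: partial_var)
      ultimately show ?thesis
        using grad_d[of "poly_var i" j] that by (simp del: upt_Suc add: less_Suc_eq_le)
    qed
  qed auto
  then show ?thesis by (simp only: leibniz_det_one)
qed

lemmas lift_J_minus = poly_quotient_form.lift_minus[OF jacobian_form]
  and lift_J_add = poly_quotient_form.lift_add[OF jacobian_form]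
  and lift_J_smult = poly_quotient_form.lift_smult[OF jacobian_form]
  and lift_J_smult_mem = poly_quotient_form.lift_smult_mem[OF jacobian_form]
  and lift_J_gen = poly_quotient_form.lift_gen[OF jacobian_form]
  and lift_J_span = poly_quotient_form.lift_span[OF jacobian_form]

text \<open>The three kinds of relations match additivity in a row, homogeneity in a row and
  vanishing for equal rows.\<close>

lemma lift_jacobian_rels:
  assumes "r \<in> ext_rels R Om (Suc n)"
  shows "lift jacobian r \<in> J"
proof -
  note gc = W.gen_carrier and tu = W.tuples_update
  consider (add) ws i x y where "ws \<in> tuples Om (Suc n)" "i < Suc n" "x \<in> carrier Om" "y \<in> carrier Om"
      "r = free_gen R (ws[i := x \<oplus>\<^bsub>Om\<^esub> y]) \<ominus>\<^bsub>W.FT\<^esub> (free_gen R (ws[i := x]) \<oplus>\<^bsub>W.FT\<^esub> free_gen R (ws[i := y]))"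
    | (smult) ws i a x where "ws \<in> tuples Om (Suc n)" "i < Suc n" "a \<in> carrier R" "x \<in> carrier Om"
      "r = free_gen R (ws[i := a \<odot>\<^bsub>Om\<^esub> x]) \<ominus>\<^bsub>W.FT\<^esub> (a \<odot>\<^bsub>W.FT\<^esub> free_gen R (ws[i := x]))"
    | (rep) ws i j where "ws \<in> tuples Om (Suc n)" "i < j" "j < Suc n" "ws ! i = ws ! j" "r = free_gen R ws"
    using assms unfolding ext_rels_def Let_def
    by (elim UnE CollectE exE conjE)
      ((rule that(1), assumption+) | (rule that(2), assumption+) | (rule that(3), assumption+))+
  then show ?thesis
  proof cases
    case add
    have c: "ws[i := x \<oplus>\<^bsub>Om\<^esub> y] \<in> tuples Om (Suc n)" "ws[i := x] \<in> tuples Om (Suc n)" "ws[i := y] \<in> tuples Om (Suc n)"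
      by (rule tu[OF add(1)], (intro Om_add_closed add(3,4))[1])+
    have "lift jacobian r - (jacobian (ws[i := x \<oplus>\<^bsub>Om\<^esub> y]) - (jacobian (ws[i := x]) + jacobian (ws[i := y]))) \<in> J"
      unfolding add(5)
      by (rule J_trans[OF lift_J_minus], (intro gc c W.FT.M.a_closed)+,
          intro J_cong_diff lift_J_gen c, rule J_trans[OF lift_J_add], (intro gc c)+,
          intro J_cong_add lift_J_gen c)
    then show ?thesis using jacobian_add[OF add(1-4)] by (rule J_cong_mem)
  next
    case smult
    have c: "ws[i := a \<odot>\<^bsub>Om\<^esub> x] \<in> tuples Om (Suc n)" "ws[i := x] \<in> tuples Om (Suc n)"
      by (rule tu[OF smult(1)], (intro Om_smult_closed smult(3,4))[1])+
    have "lift jacobian r - (jacobian (ws[i := a \<odot>\<^bsub>Om\<^esub> x]) - rep a * jacobian (ws[i := x])) \<in> J"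
      unfolding smult(5)
      by (rule J_trans[OF lift_J_minus], (intro gc c W.FT.smult_closed smult)+,
          intro J_cong_diff lift_J_gen c, rule J_trans[OF lift_J_smult_mem], (intro gc c smult)+,
          intro J_cong_mult lift_J_gen c rep_polys smult)
    then show ?thesis using jacobian_smult[OF smult(1-4)] by (rule J_cong_mem)
  next
    case rep
    then show ?thesis using lift_J_gen[OF rep(1)] jacobian_repeat[OF rep(2-4)] by simp
  qed
qed

text \<open>Evaluate the Jacobian on the tuple of the dx_i scaled by \<open>f\<close>: the result is
  congruent to \<open>f\<close>, because the Jacobian matrix of the dx_i is the identity, and it
  lies in \<open>J\<close>, because the scaled tuple is in the span of the relations.\<close>

lemma top_form_zeroD:
  assumes f: "f \<in> polys n" and z: "cl f \<odot>\<^bsub>W.E\<^esub> top_form = \<zero>\<^bsub>W.E\<^esub>"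
  shows "f \<in> J"
proof -
  let ?t = "map dx [0..<Suc n]"
  have c: "cl f \<in> carrier R" using f by (rule \<pi>_carrier)
  have g: "free_gen R ?t \<in> carrier W.FT" by (rule W.gen_carrier[OF top_tuple])
  have "W.E.\<pi> (cl f \<odot>\<^bsub>W.FT\<^esub> free_gen R ?t) = cl f \<odot>\<^bsub>W.E\<^esub> top_form"
    unfolding top_form_def W.wedge_eq[OF top_tuple] ext_power_def by (rule W.E.\<pi>_smult[OF c g, symmetric])
  then have "cl f \<odot>\<^bsub>W.FT\<^esub> free_gen R ?t \<in> ext_kernel R Om (Suc n)"
    using z W.E.\<pi>_zero_iff[OF W.FT.smult_closed[OF c g]] unfolding ext_power_def by metis
  then have x: "cl f \<odot>\<^bsub>W.FT\<^esub> free_gen R ?t \<in> W.FT.span (ext_rels R Om (Suc n))"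
    unfolding ext_kernel_def .
  have "lift jacobian (cl f \<odot>\<^bsub>W.FT\<^esub> free_gen R ?t) \<in> J"
    by (rule lift_J_span[OF W.ext_rels_carrier _ x]) (rule lift_jacobian_rels)
  moreover have "lift jacobian (cl f \<odot>\<^bsub>W.FT\<^esub> free_gen R ?t) - f * 1 \<in> J"
    by (rule J_trans[OF lift_J_smult[OF g f]], rule J_cong_mult[OF J_trans[OF lift_J_gen[OF top_tuple] jacobian_top] f])
  ultimately have "lift jacobian (cl f \<odot>\<^bsub>W.FT\<^esub> free_gen R ?t) - (lift jacobian (cl f \<odot>\<^bsub>W.FT\<^esub> free_gen R ?t) - f * 1) \<in> J"
    by (rule J_diff)
  then show ?thesis by simp
qed

end

section \<open>The graded module of top forms\<close>

context exterior_power
begin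

text \<open>The relations impose only vanishing on repetitions. Antisymmetry follows by expanding
  the wedge with u + v in both positions.\<close>

lemma wedge_swap:
  assumes xs: "xs \<in> tuples M m" and ij: "i < m" "j < m" "i \<noteq> j"
  shows "wedge R M (xs[i := xs ! j, j := xs ! i]) = \<ominus>\<^bsub>E\<^esub> wedge R M xs"
proof -
  interpret EM: Module.module R E by (rule module_ext_power)
  define w where "w x y = wedge R M (xs[i := x, j := y])" for x y
  have len: "length xs = m" using xs by (simp add: tuples_def)
  have nth: "xs ! k \<in> carrier M" if "k < m" for k using xs that by (auto simp: tuples_def)
  let ?u = "xs ! i" and ?v = "xs ! j"
  have u: "?u \<in> carrier M" and v: "?v \<in> carrier M" using nth ij by auto
  have t: "xs[i := x, j := y] \<in> tuples M m" if "x \<in> carrier M" "y \<in> carrier M" for x y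
    using xs that by (intro tuples_update)
  have wc: "w x y \<in> carrier E" if "x \<in> carrier M" "y \<in> carrier M" for x y
    unfolding w_def using that by (intro wedge_carrier t)
  have wz: "w x x = \<zero>\<^bsub>E\<^esub>" if "x \<in> carrier M" for x
    unfolding w_def using ij len that by (intro wedge_repeat[of _ i j] t) simp_all
  have w2: "w x (y \<oplus>\<^bsub>M\<^esub> z) = w x y \<oplus>\<^bsub>E\<^esub> w x z" if "x \<in> carrier M" "y \<in> carrier M" "z \<in> carrier M" for x y z
    unfolding w_def using that ij xs by (intro wedge_add tuples_update)
  have w1: "w (x \<oplus>\<^bsub>M\<^esub> y) z = w x z \<oplus>\<^bsub>E\<^esub> w y z" if "x \<in> carrier M" "y \<in> carrier M" "z \<in> carrier M" for x y z
    unfolding w_def list_update_swap[OF ij(3)] using that ij xs by (intro wedge_add tuples_update)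
  have uv: "?u \<oplus>\<^bsub>M\<^esub> ?v \<in> carrier M" using u v by simp
  have "\<zero>\<^bsub>E\<^esub> = w (?u \<oplus>\<^bsub>M\<^esub> ?v) (?u \<oplus>\<^bsub>M\<^esub> ?v)" using wz[OF uv] by simp
  also have "\<dots> = (w ?u ?u \<oplus>\<^bsub>E\<^esub> w ?u ?v) \<oplus>\<^bsub>E\<^esub> (w ?v ?u \<oplus>\<^bsub>E\<^esub> w ?v ?v)"
    by (simp only: w1[OF u v uv] w2[OF u u v] w2[OF v u v])
  also have "\<dots> = w ?u ?v \<oplus>\<^bsub>E\<^esub> w ?v ?u"
    using wc[OF u v] wc[OF v u] by (simp add: wz[OF u] wz[OF v])
  finally have "w ?v ?u \<oplus>\<^bsub>E\<^esub> w ?u ?v = \<zero>\<^bsub>E\<^esub>"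
    using EM.M.a_comm[OF wc[OF u v] wc[OF v u]] by simp
  then have "\<ominus>\<^bsub>E\<^esub> w ?u ?v = w ?v ?u"
    by (intro EM.M.minus_equality wc u v)
  then show ?thesis by (simp add: w_def)
qed

end

section \<open>The annihilator of the top form\<close>

context poly_quotient
begin

lemma module_E: "Module.module R W.E"
  by (rule W.module_ext_power)

definition top_mult where "top_mult f = cl f \<odot>\<^bsub>W.E\<^esub> top_form"

lemmas E_smult_closed = Module.module.smult_closed[OF module_E]
  and E_smult_l_distr = Module.module.smult_l_distr[OF module_E]
  and E_smult_assoc = Module.module.smult_assoc1[OF module_E]
  and E_smult_one = Module.module.smult_one[OF module_E]
  and E_smult_zero = Module.module.smult_l_null[OF module_E]

lemma top_mult_carrier: "f \<in> polys n \<Longrightarrow> top_mult f \<in> carrier W.E"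
  unfolding top_mult_def by (intro E_smult_closed \<pi>_carrier top_form_carrier)

lemma top_mult_add: "f \<in> polys n \<Longrightarrow> g \<in> polys n \<Longrightarrow> top_mult (f + g) = top_mult f \<oplus>\<^bsub>W.E\<^esub> top_mult g"
  unfolding top_mult_def cl_add[symmetric] by (intro E_smult_l_distr \<pi>_carrier top_form_carrier)

lemma top_mult_mult: "a \<in> polys n \<Longrightarrow> f \<in> polys n \<Longrightarrow> top_mult (a * f) = cl a \<odot>\<^bsub>W.E\<^esub> top_mult f"
  unfolding top_mult_def cl_mult[symmetric] by (intro E_smult_assoc \<pi>_carrier top_form_carrier)

lemma top_mult_one: "top_mult 1 = top_form"
  unfolding top_mult_def one_R[symmetric] by (rule E_smult_one[OF top_form_carrier])

lemma top_mult_zero: "top_mult 0 = \<zero>\<^bsub>W.E\<^esub>"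
  unfolding top_mult_def zero_R[symmetric] by (rule E_smult_zero[OF top_form_carrier])

lemma top_mult_uminus: assumes "f \<in> polys n" shows "top_mult (- f) = \<ominus>\<^bsub>W.E\<^esub> top_mult f"
proof -
  interpret EM: abelian_group W.E by (rule Module.module.axioms(2)[OF module_E])
  have "top_mult (- f) \<oplus>\<^bsub>W.E\<^esub> top_mult f = \<zero>\<^bsub>W.E\<^esub>"
    using top_mult_add[OF polys_uminus[OF assms] assms] by (simp add: top_mult_zero)
  then show ?thesis using EM.minus_equality top_mult_carrier assms polys_uminus by metis
qed

text \<open>Taken in the polynomial ring and not in \<open>R\<close>, so that it can be compared
  directly with the ideals of fat points.\<close>

definition top_ann where "top_ann = {f \<in> polys n. top_mult f = \<zero>\<^bsub>W.E\<^esub>}"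

lemma ideal_top_ann: "ideal top_ann (poly_alg n)"
proof (rule poly_idealI)
  interpret EM: abelian_group W.E by (rule Module.module.axioms(2)[OF module_E])
  show "top_ann \<subseteq> polys n" by (auto simp: top_ann_def)
  show "0 \<in> top_ann" by (simp add: top_ann_def top_mult_zero)
  show "f + g \<in> top_ann" if "f \<in> top_ann" "g \<in> top_ann" for f g
    using that by (simp add: top_ann_def top_mult_add)
  show "a * f \<in> top_ann" if "a \<in> polys n" "f \<in> top_ann" for a f
    using that Module.module.smult_r_null[OF module_E \<pi>_carrier] by (simp add: top_ann_def top_mult_mult)
qed

lemma top_mult_eq_iff:
  assumes "f \<in> polys n" "g \<in> polys n"
  shows "top_mult f = top_mult g \<longleftrightarrow> f - g \<in> top_ann"
proof -
  interpret EM: abelian_group W.E by (rule Module.module.axioms(2)[OF module_E])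
  have c: "top_mult f \<in> carrier W.E" "top_mult g \<in> carrier W.E" using assms by (auto intro: top_mult_carrier)
  have "top_mult (f - g) = top_mult f \<oplus>\<^bsub>W.E\<^esub> \<ominus>\<^bsub>W.E\<^esub> top_mult g"
    using top_mult_add[OF assms(1) polys_uminus[OF assms(2)]] by (simp add: top_mult_uminus assms)
  moreover have "top_mult f \<oplus>\<^bsub>W.E\<^esub> \<ominus>\<^bsub>W.E\<^esub> top_mult g = \<zero>\<^bsub>W.E\<^esub> \<longleftrightarrow> top_mult f = top_mult g"
    using c EM.r_neg EM.minus_equality EM.minus_minus EM.a_inv_closed by metis
  ultimately show ?thesis using assms by (simp add: top_ann_def)
qed

lemma I_subset_top_ann: "I \<subseteq> top_ann"
proof
  fix f assume f: "f \<in> I"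
  have fp: "f \<in> polys n" by (rule poly_ideal_subset[OF ideal_I f])
  then have "cl f = \<zero>\<^bsub>R\<^esub>" using f by (simp add: cl_zero_iff)
  then show "f \<in> top_ann" using fp E_smult_zero[OF top_form_carrier] by (simp add: top_ann_def top_mult_def)
qed

text \<open>The wedge of \<open>w\<close> with all dx_j for j different from i. Keeping
  \<open>w\<close> in position i avoids any sign.\<close>

definition slot where "slot i w = wedge R Om ((map dx [0..<Suc n])[i := w])"

lemma slot_carrier: "i \<le> n \<Longrightarrow> w \<in> carrier Om \<Longrightarrow> slot i w \<in> carrier W.E"
  unfolding slot_def by (intro W.wedge_carrier W.tuples_update top_tuple)

lemma slot_add: "i \<le> n \<Longrightarrow> v \<in> carrier Om \<Longrightarrow> w \<in> carrier Om \<Longrightarrow> slot i (v \<oplus>\<^bsub>Om\<^esub> w) = slot i v \<oplus>\<^bsub>W.E\<^esub> slot i w"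
  unfolding slot_def by (intro W.wedge_add top_tuple) auto

lemma slot_smult: "i \<le> n \<Longrightarrow> a \<in> carrier R \<Longrightarrow> w \<in> carrier Om \<Longrightarrow> slot i (a \<odot>\<^bsub>Om\<^esub> w) = a \<odot>\<^bsub>W.E\<^esub> slot i w"
  unfolding slot_def by (intro W.wedge_smult top_tuple) auto

lemma dcl_carrier: "f \<in> polys n \<Longrightarrow> univ_deriv class_ring R (cl f) \<in> carrier Om"
  by (intro RA.d_carrier \<pi>_carrier)

lemma slot_zero: "i \<le> n \<Longrightarrow> slot i \<zero>\<^bsub>Om\<^esub> = \<zero>\<^bsub>W.E\<^esub>"
proof -
  assume i: "i \<le> n"
  have d: "dx i \<in> carrier Om" using i by (rule dx_carrier)
  have z: "\<zero>\<^bsub>R\<^esub> \<in> carrier R" unfolding zero_R by (intro \<pi>_carrier polys_zero)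
  have "slot i (\<zero>\<^bsub>R\<^esub> \<odot>\<^bsub>Om\<^esub> dx i) = \<zero>\<^bsub>R\<^esub> \<odot>\<^bsub>W.E\<^esub> slot i (dx i)"
    by (rule slot_smult[OF i z d])
  then show ?thesis
    using Module.module.smult_l_null[OF RA.module_kaehler d] E_smult_zero[OF slot_carrier[OF i d]] by simp
qed

lemma d_const: "univ_deriv class_ring R (cl (Poly_Mapping.single 0 c)) = \<zero>\<^bsub>Om\<^esub>"
proof -
  have "cl (Poly_Mapping.single 0 c) = c \<odot>\<^bsub>R\<^esub> \<one>\<^bsub>R\<^esub>"
    using cl_smult[OF polys_one, of c] by (simp add: one_R)
  then show ?thesis using RA.d_scalar[of c] by simp
qed

lemma slot_var:
  assumes i: "i \<le> n" and j: "j \<le> n"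
  shows "slot i (dx j) = top_mult (partial i (poly_var j))"
proof (cases "i = j")
  case True
  have "(map dx [0..<Suc n])[i := dx i] = map dx [0..<Suc n]"
    using i list_update_id[of "map dx [0..<Suc n]" i] by (simp del: upt_Suc)
  then show ?thesis using True by (simp add: slot_def partial_var top_mult_one top_form_def del: upt_Suc)
next
  case False
  have "slot i (dx j) = \<zero>\<^bsub>W.E\<^esub>" unfolding slot_def
    by (rule W.wedge_repeat[of _ i j])
      (use False i j in \<open>auto simp del: upt_Suc intro!: W.tuples_update top_tuple dx_carrier\<close>)
  then show ?thesis using False by (simp add: partial_var top_mult_zero)
qed

lemma slot_d_mult:
  assumes i: "i \<le> n" and fg: "f \<in> polys n" "g \<in> polys n"
    and f: "slot i (univ_deriv class_ring R (cl f)) = top_mult (partial i f)"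
    and g: "slot i (univ_deriv class_ring R (cl g)) = top_mult (partial i g)"
  shows "slot i (univ_deriv class_ring R (cl (f * g))) = top_mult (partial i (f * g))"
proof -
  have c: "cl f \<in> carrier R" "cl g \<in> carrier R" using fg by (auto intro: \<pi>_carrier)
  have "univ_deriv class_ring R (cl (f * g)) =
      cl f \<odot>\<^bsub>Om\<^esub> univ_deriv class_ring R (cl g) \<oplus>\<^bsub>Om\<^esub> cl g \<odot>\<^bsub>Om\<^esub> univ_deriv class_ring R (cl f)"
    using RA.d_mult[OF c] by (simp only: cl_mult fg)
  then have "slot i (univ_deriv class_ring R (cl (f * g))) =
      slot i (cl f \<odot>\<^bsub>Om\<^esub> univ_deriv class_ring R (cl g)) \<oplus>\<^bsub>W.E\<^esub> slot i (cl g \<odot>\<^bsub>Om\<^esub> univ_deriv class_ring R (cl f))"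
    by (simp only:) (intro slot_add Om_smult_closed dcl_carrier i c fg)
  also have "\<dots> = cl f \<odot>\<^bsub>W.E\<^esub> top_mult (partial i g) \<oplus>\<^bsub>W.E\<^esub> cl g \<odot>\<^bsub>W.E\<^esub> top_mult (partial i f)"
    by (simp only: slot_smult[OF i c(1) dcl_carrier[OF fg(2)]] slot_smult[OF i c(2) dcl_carrier[OF fg(1)]] f g)
  also have "\<dots> = top_mult (f * partial i g + g * partial i f)"
    by (simp only: top_mult_add top_mult_mult polys_mult partial_polys fg)
  finally show ?thesis by (simp add: partial_mult algebra_simps)
qed

text \<open>Both sides are derivations in \<open>f\<close>, as \<open>slot i\<close> is linear over
  the ring; they agree on constants and on variables, hence on monomials by splitting off one
  variable at a time. This bypasses expanding df in the dx_j.\<close>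

lemma slot_d:
  assumes i: "i \<le> n" and f: "f \<in> polys n"
  shows "slot i (univ_deriv class_ring R (cl f)) = top_mult (partial i f)"
proof -
  have const: "slot i (univ_deriv class_ring R (cl (Poly_Mapping.single 0 c))) = top_mult (partial i (Poly_Mapping.single 0 c))" for c
    unfolding d_const by (simp add: slot_zero i top_mult_zero)
  have mono: "slot i (univ_deriv class_ring R (cl (Poly_Mapping.single t c))) = top_mult (partial i (Poly_Mapping.single t c))"
    if "Poly_Mapping.keys t \<subseteq> {..n}" "mon_degree t = d" for t c d
    using that
  proof (induction d arbitrary: t)
    case 0
    then have "t = 0"
      by (intro poly_mapping_eqI) (auto simp: mon_degree_def in_keys_iff)
    then show ?case using const by simp
  next
    case (Suc d)
    then obtain j where j: "j \<in> Poly_Mapping.keys t"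
      by (metis Zero_not_Suc all_not_in_conv mon_degree_def sum.empty)
    then have "1 \<le> Poly_Mapping.lookup t j" by (simp add: in_keys_iff Suc_le_eq)
    then obtain s where s: "Poly_Mapping.keys s \<subseteq> {..n}" "mon_degree t = 1 + mon_degree s"
        "Poly_Mapping.single t c = poly_var j ^ 1 * Poly_Mapping.single s c"
      using single_split Suc.prems(1) by blast
    have jn: "j \<le> n" using j Suc.prems by auto
    have "slot i (univ_deriv class_ring R (cl (poly_var j * Poly_Mapping.single s c))) =
        top_mult (partial i (poly_var j * Poly_Mapping.single s c))"
      using s Suc.prems jn by (intro slot_d_mult slot_var Suc.IH i polys_var polys_single) auto
    then show ?case by (simp only: s(3) power_one_right)
  qed
  show ?thesis using f
  proof (induction rule: poly_alg_induct)
    case zero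
    then show ?case using const[of 0] by simp
  next
    case (add f g)
    have "univ_deriv class_ring R (cl (f + g)) = univ_deriv class_ring R (cl f) \<oplus>\<^bsub>Om\<^esub> univ_deriv class_ring R (cl g)"
      using RA.d_add[OF \<pi>_carrier[OF add(1)] \<pi>_carrier[OF add(2)]] by (simp only: cl_add add(1,2))
    then have "slot i (univ_deriv class_ring R (cl (f + g))) =
        slot i (univ_deriv class_ring R (cl f)) \<oplus>\<^bsub>W.E\<^esub> slot i (univ_deriv class_ring R (cl g))"
      by (simp only:) (intro slot_add dcl_carrier i add)
    then show ?case by (simp only: add(3,4) top_mult_add partial_add partial_polys add(1,2))
  next
    case (single t c)
    then show ?case by (rule mono) simp
  qed
qed

text \<open>The class of \<open>f\<close> is 0, so its differential vanishes, and by
  \<open>slot_d\<close> its wedge with the other dx_j is \<open>partial i f\<close> times the top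
  form.\<close>

lemma partial_I_top_ann:
  assumes f: "f \<in> I" and i: "i \<le> n"
  shows "partial i f \<in> top_ann"
proof -
  have fp: "f \<in> polys n" by (rule poly_ideal_subset[OF ideal_I f])
  \<comment> \<open>Zero is written as a constant polynomial so that \<open>d_const\<close>
    applies.\<close>
  have "cl f = cl (Poly_Mapping.single 0 0)"
    using cl_zero_iff[OF fp] f by (simp add: zero_R)
  then have "univ_deriv class_ring R (cl f) = \<zero>\<^bsub>Om\<^esub>" by (simp only: d_const)
  then have "top_mult (partial i f) = \<zero>\<^bsub>W.E\<^esub>"
    using slot_d[OF i fp] slot_zero[OF i] by simp
  then show ?thesis using fp by (simp add: top_ann_def)
qed

end

section \<open>Homogeneous components of the module of top forms\<close>

context poly_quotient
begin

definition gr where "gr d = cl ` hom_polys n d"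
definition gr1 where "gr1 = grading_by_gens class_ring R gr Om {(dx i, 1) | i. i \<le> n}"

lemma scalar_R: "c \<odot>\<^bsub>R\<^esub> \<one>\<^bsub>R\<^esub> = cl (Poly_Mapping.single 0 c)"
  using cl_smult[OF polys_one, of c] by (simp add: one_R)

lemma module_K: "Module.module R N \<Longrightarrow> Module.module class_ring (restrict_scalars R N)"
  by (rule module_restrict_scalars[OF algebra_R])

text \<open>Each \<open>dx i\<close> has degree \<open>1\<close>, so the top form has degree \<open>Suc n\<close>.\<close>

definition top_coeffs where
  "top_coeffs e = (if e < Suc n then {0} else hom_polys n (e - Suc n))"

lemma top_coeffs_polys: "f \<in> top_coeffs e \<Longrightarrow> f \<in> polys n"
  by (auto simp: top_coeffs_def hom_polysD split: if_splits)

lemma top_coeffs_zero: "0 \<in> top_coeffs e"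
  by (simp add: top_coeffs_def)

lemma top_coeffs_add: "f \<in> top_coeffs e \<Longrightarrow> g \<in> top_coeffs e \<Longrightarrow> f + g \<in> top_coeffs e"
  by (auto simp: top_coeffs_def split: if_splits)

lemma top_coeffs_mult: "a \<in> hom_polys n i \<Longrightarrow> f \<in> top_coeffs e \<Longrightarrow> a * f \<in> top_coeffs (i + e)"
  using hom_polys_mult[of a n i f "e - Suc n"] by (auto simp: top_coeffs_def split: if_splits)

text \<open>A concrete candidate for the degree \<open>e\<close> component: homogeneous multiples of
  the top form. \<open>ext_power_grading_eq\<close> identifies it with the component given by
  generators.\<close>

definition top_gr where "top_gr e = top_mult ` top_coeffs e"

lemma top_gr_add: "v \<in> top_gr e \<Longrightarrow> w \<in> top_gr e \<Longrightarrow> v \<oplus>\<^bsub>W.E\<^esub> w \<in> top_gr e"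
proof -
  assume "v \<in> top_gr e" "w \<in> top_gr e"
  then obtain f g where fg: "f \<in> top_coeffs e" "g \<in> top_coeffs e" "v = top_mult f" "w = top_mult g"
    by (auto simp: top_gr_def)
  have "v \<oplus>\<^bsub>W.E\<^esub> w = top_mult (f + g)"
    unfolding fg(3,4)
    by (rule top_mult_add[symmetric, OF top_coeffs_polys[OF fg(1)] top_coeffs_polys[OF fg(2)]])
  then show ?thesis using top_coeffs_add[OF fg(1,2)] by (simp add: top_gr_def)
qed

lemma top_gr_mult:
  assumes "a \<in> hom_polys n i" "v \<in> top_gr e"
  shows "cl a \<odot>\<^bsub>W.E\<^esub> v \<in> top_gr (i + e)"
proof -
  obtain f where f: "f \<in> top_coeffs e" "v = top_mult f" using assms(2) by (auto simp: top_gr_def)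
  have "cl a \<odot>\<^bsub>W.E\<^esub> v = top_mult (a * f)"
    unfolding f(2) by (rule top_mult_mult[symmetric, OF hom_polysD[OF assms(1)] top_coeffs_polys[OF f(1)]])
  then show ?thesis using top_coeffs_mult[OF assms(1) f(1)] by (simp add: top_gr_def)
qed

lemma top_gr_zero: "\<zero>\<^bsub>W.E\<^esub> \<in> top_gr e"
  unfolding top_gr_def top_mult_zero[symmetric] using top_coeffs_zero by (rule imageI)

lemma top_gr_scalar: "v \<in> top_gr e \<Longrightarrow> (c \<odot>\<^bsub>R\<^esub> \<one>\<^bsub>R\<^esub>) \<odot>\<^bsub>W.E\<^esub> v \<in> top_gr e"
  using top_gr_mult[OF hom_polys_const, of v e c] by (simp add: scalar_R)

lemma submodule_top_gr: "submodule class_ring (top_gr e) (restrict_scalars R W.E)"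
  unfolding submodule_def
proof (intro conjI allI impI)
  show "Module.module class_ring (restrict_scalars R W.E)" by (rule module_K[OF module_E])
  have "top_mult f \<in> carrier W.E" if "f \<in> top_coeffs e" for f
    using that by (intro top_mult_carrier top_coeffs_polys)
  then show "top_gr e \<subseteq> carrier (restrict_scalars R W.E)"
    unfolding top_gr_def restrict_scalars_fields by (rule image_subsetI)
qed (simp_all only: restrict_scalars_fields top_gr_add top_gr_zero top_gr_scalar)

text \<open>Composing on the left with a transposition of the values a and b exchanges the list
  entries at the positions where \<open>p\<close> takes these values.\<close>

lemma dx_list_update:
  assumes p: "p permutes {0..<Suc n}" and ab: "a \<in> {0..<Suc n}" "b \<in> {0..<Suc n}" "a \<noteq> b"
  shows "\<exists>i j. i < Suc n \<and> j < Suc n \<and> i \<noteq> j \<and>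
    map (dx \<circ> (Transposition.transpose a b \<circ> p)) [0..<Suc n] =
    (map (dx \<circ> p) [0..<Suc n])[i := map (dx \<circ> p) [0..<Suc n] ! j, j := map (dx \<circ> p) [0..<Suc n] ! i]"
proof (intro exI conjI)
  let ?i = "inv_into UNIV p a" and ?j = "inv_into UNIV p b"
  have pi: "p ?i = a" "p ?j = b" using permutes_inverses[OF p] by auto
  show i: "?i < Suc n" and j: "?j < Suc n"
    using permutes_in_image[OF permutes_inv[OF p]] ab by auto
  show ne: "?i \<noteq> ?j" using pi ab(3) by metis
  have inj: "p k = a \<longleftrightarrow> k = ?i" "p k = b \<longleftrightarrow> k = ?j" for k
    using permutes_inverses[OF p] by metis+
  show "map (dx \<circ> (Transposition.transpose a b \<circ> p)) [0..<Suc n] =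
    (map (dx \<circ> p) [0..<Suc n])[?i := map (dx \<circ> p) [0..<Suc n] ! ?j, ?j := map (dx \<circ> p) [0..<Suc n] ! ?i]"
  proof (rule nth_equalityI)
    fix k assume "k < length (map (dx \<circ> (Transposition.transpose a b \<circ> p)) [0..<Suc n])"
    then have k: "k < Suc n" by simp
    show "map (dx \<circ> (Transposition.transpose a b \<circ> p)) [0..<Suc n] ! k =
      (map (dx \<circ> p) [0..<Suc n])[?i := map (dx \<circ> p) [0..<Suc n] ! ?j, ?j := map (dx \<circ> p) [0..<Suc n] ! ?i] ! k"
      using i j k pi inj[of k] ab(3) ne
      by (auto simp add: nth_list_update Transposition.transpose_def simp del: upt_Suc)
  qed simp
qed

text \<open>Each transposition negates the wedge. Only the fact that a sign appears is recorded,
  since \<open>top_gr\<close> is closed under negation and the sign itself is irrelevant.\<close>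

lemma wedge_dx_permutation:
  assumes "p permutes {0..<Suc n}"
  shows "wedge R Om (map (dx \<circ> p) [0..<Suc n]) \<in> {top_mult 1, top_mult (- 1)}"
  using assms finite_atLeastLessThan
proof (induction rule: permutes_induct)
  case id
  then show ?case by (simp add: top_mult_one top_form_def del: upt_Suc)
next
  case (swap a b p)
  let ?xs = "map (dx \<circ> p) [0..<Suc n]"
  have "p k < Suc n" if "k < Suc n" for k using permutes_in_image[OF swap(4)] that by auto
  then have t: "?xs \<in> tuples Om (Suc n)"
    using dx_carrier by (auto simp: tuples_def less_Suc_eq_le simp del: upt_Suc)
  obtain i j where ij: "i < Suc n" "j < Suc n" "i \<noteq> j"
    "map (dx \<circ> (Transposition.transpose a b \<circ> p)) [0..<Suc n] = ?xs[i := ?xs ! j, j := ?xs ! i]"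
    using dx_list_update[OF swap(4,1,2,3)] by blast
  have e: "wedge R Om (map (dx \<circ> (Transposition.transpose a b \<circ> p)) [0..<Suc n]) = \<ominus>\<^bsub>W.E\<^esub> wedge R Om ?xs"
    unfolding ij(4) by (rule W.wedge_swap[OF t ij(1-3)])
  have "\<ominus>\<^bsub>W.E\<^esub> top_mult 1 = top_mult (- 1)" "\<ominus>\<^bsub>W.E\<^esub> top_mult (- 1) = top_mult 1"
    using top_mult_uminus[of 1] top_mult_uminus[of "- 1"] by simp_all
  then have "\<ominus>\<^bsub>W.E\<^esub> w \<in> {top_mult 1, top_mult (- 1)}" if "w \<in> {top_mult 1, top_mult (- 1)}" for w
    using that by blast
  then show ?case unfolding e using swap(5) by blast
qed

text \<open>Either the indices form a permutation and the wedge is the top form up to sign, or some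
  index repeats and the wedge is 0.\<close>

lemma wedge_dx:
  assumes c: "\<And>i. i \<le> n \<Longrightarrow> c i \<le> n"
  shows "wedge R Om (map (dx \<circ> c) [0..<Suc n]) \<in> top_gr (Suc n)"
proof (cases "inj_on c {0..<Suc n}")
  case True
  \<comment> \<open>A function that permutes a set in the sense of \<open>permutes\<close> has to be
    the identity outside of it.\<close>
  define p where "p i = (if i < Suc n then c i else i)" for i
  have "c i \<in> {0..<Suc n}" if "i \<in> {0..<Suc n}" for i
    using c[of i] that by simp
  then have "c ` {0..<Suc n} \<subseteq> {0..<Suc n}" by blast
  then have "bij_betw c {0..<Suc n} {0..<Suc n}"
    using True endo_inj_surj[OF finite_atLeastLessThan _ True] unfolding bij_betw_def by blast
  moreover have pc: "p i = c i" if "i \<in> {0..<Suc n}" for i using that by (simp add: p_def)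
  ultimately have "bij_betw p {0..<Suc n} {0..<Suc n}"
    using bij_betw_cong[of "{0..<Suc n}" p c "{0..<Suc n}"] by blast
  then have perm: "p permutes {0..<Suc n}" by (rule bij_imp_permutes) (simp add: p_def)
  have m: "map (dx \<circ> c) [0..<Suc n] = map (dx \<circ> p) [0..<Suc n]"
    by (rule map_cong[OF refl]) (simp add: pc del: upt_Suc)
  have "wedge R Om (map (dx \<circ> c) [0..<Suc n]) \<in> {top_mult 1, top_mult (- 1)}"
    unfolding m by (rule wedge_dx_permutation[OF perm])
  moreover have "1 \<in> top_coeffs (Suc n)" "- 1 \<in> top_coeffs (Suc n)"
    using hom_polys_one[of n] hom_polys_uminus[OF hom_polys_one[of n]] by (simp_all add: top_coeffs_def)
  ultimately show ?thesis unfolding top_gr_def by blast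
next
  case False
  then obtain i j where ij: "i < Suc n" "j < Suc n" "i \<noteq> j" "c i = c j" by (auto simp: inj_on_def)
  have t: "map (dx \<circ> c) [0..<Suc n] \<in> tuples Om (Suc n)"
    using dx_carrier c by (auto simp: tuples_def less_Suc_eq_le simp del: upt_Suc)
  have "wedge R Om (map (dx \<circ> c) [0..<Suc n]) = \<zero>\<^bsub>W.E\<^esub>"
    by (rule W.wedge_repeat[OF t ij(1-3)]) (use ij in \<open>simp del: upt_Suc\<close>)
  then show ?thesis using top_gr_zero by simp
qed

lemma gr1_eq: "gr1 e = LinearCombinations.module.span class_ring (restrict_scalars R Om)
    {cl a \<odot>\<^bsub>Om\<^esub> dx c | a c. c \<le> n \<and> (\<exists>i. a \<in> hom_polys n i \<and> i + 1 = e)}"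
  unfolding gr1_def grading_by_gens_def gr_def
  by (rule arg_cong[where f = "LinearCombinations.module.span class_ring (restrict_scalars R Om)"]) blast

lemma gr1_gens_carrier:
  "{cl a \<odot>\<^bsub>Om\<^esub> dx c | a c. c \<le> n \<and> (\<exists>i. a \<in> hom_polys n i \<and> i + 1 = e)} \<subseteq> carrier (restrict_scalars R Om)"
  using Om_smult_closed dx_carrier \<pi>_carrier hom_polysD by fastforce

lemma gr1_carrier: "gr1 e \<subseteq> carrier Om"
  unfolding gr1_eq using LinearCombinations.module.span_is_subset2[OF module_K[OF RA.module_kaehler] gr1_gens_carrier] by simp

lemma dx_gr1: assumes "i \<le> n" shows "dx i \<in> gr1 1"
proof -
  have "dx i = cl 1 \<odot>\<^bsub>Om\<^esub> dx i"
    using Module.module.smult_one[OF RA.module_kaehler dx_carrier[OF assms]] by (simp add: one_R)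
  then have "dx i \<in> {cl a \<odot>\<^bsub>Om\<^esub> dx c | a c. c \<le> n \<and> (\<exists>i. a \<in> hom_polys n i \<and> i + 1 = (1::nat))}"
    using assms hom_polys_one[of n] by fastforce
  then show ?thesis
    unfolding gr1_eq using LinearCombinations.module.in_own_span[OF module_K[OF RA.module_kaehler] gr1_gens_carrier] by blast
qed

text \<open>Since \<open>gr1\<close> is a span, this reduces a claim about an arbitrary homogeneous
  entry to the generators a dx_c.\<close>

lemma slot_submodule:
  assumes xs: "xs \<in> tuples Om (Suc n)" and k: "k < Suc n"
  shows "submodule class_ring {y \<in> carrier Om. wedge R Om (xs[k := y]) \<in> top_gr e} (restrict_scalars R Om)"
  unfolding submodule_def
proof (intro conjI allI impI)
  show "Module.module class_ring (restrict_scalars R Om)" by (rule module_K[OF RA.module_kaehler])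
  show "{y \<in> carrier Om. wedge R Om (xs[k := y]) \<in> top_gr e} \<subseteq> carrier (restrict_scalars R Om)" by auto
  have z: "\<zero>\<^bsub>R\<^esub> \<in> carrier R" unfolding zero_R by (intro \<pi>_carrier polys_zero)
  \<comment> \<open>The zero 1-form is written as 0 times dx_0, so that homogeneity of the wedge
    shows that a zero entry gives 0.\<close>
  have d: "dx 0 \<in> carrier Om" by (rule dx_carrier) simp
  have "wedge R Om (xs[k := \<zero>\<^bsub>R\<^esub> \<odot>\<^bsub>Om\<^esub> dx 0]) = \<zero>\<^bsub>R\<^esub> \<odot>\<^bsub>W.E\<^esub> wedge R Om (xs[k := dx 0])"
    by (rule W.wedge_smult[OF xs k z d])
  then have "wedge R Om (xs[k := \<zero>\<^bsub>Om\<^esub>]) = \<zero>\<^bsub>W.E\<^esub>"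
    using Module.module.smult_l_null[OF RA.module_kaehler d]
      E_smult_zero[OF W.wedge_carrier[OF W.tuples_update[OF xs d]]] by simp
  moreover have "\<zero>\<^bsub>Om\<^esub> \<in> carrier Om"
    using Om_smult_closed[OF z d] Module.module.smult_l_null[OF RA.module_kaehler d] by simp
  ultimately show "\<zero>\<^bsub>restrict_scalars R Om\<^esub> \<in> {y \<in> carrier Om. wedge R Om (xs[k := y]) \<in> top_gr e}"
    using top_gr_zero by simp
next
  fix v w assume "v \<in> {y \<in> carrier Om. wedge R Om (xs[k := y]) \<in> top_gr e}"
    "w \<in> {y \<in> carrier Om. wedge R Om (xs[k := y]) \<in> top_gr e}"
  then show "v \<oplus>\<^bsub>restrict_scalars R Om\<^esub> w \<in> {y \<in> carrier Om. wedge R Om (xs[k := y]) \<in> top_gr e}"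
    using W.wedge_add[OF xs k] Om_add_closed top_gr_add by simp
next
  fix c v assume v: "v \<in> {y \<in> carrier Om. wedge R Om (xs[k := y]) \<in> top_gr e}"
  have s: "c \<odot>\<^bsub>R\<^esub> \<one>\<^bsub>R\<^esub> \<in> carrier R" unfolding scalar_R by (intro \<pi>_carrier polys_const)
  have "(c \<odot>\<^bsub>R\<^esub> \<one>\<^bsub>R\<^esub>) \<odot>\<^bsub>Om\<^esub> v \<in> carrier Om"
    using v by (intro Om_smult_closed s) blast
  moreover have "wedge R Om (xs[k := (c \<odot>\<^bsub>R\<^esub> \<one>\<^bsub>R\<^esub>) \<odot>\<^bsub>Om\<^esub> v]) = (c \<odot>\<^bsub>R\<^esub> \<one>\<^bsub>R\<^esub>) \<odot>\<^bsub>W.E\<^esub> wedge R Om (xs[k := v])"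
    using v by (intro W.wedge_smult[OF xs k s]) blast
  moreover have "(c \<odot>\<^bsub>R\<^esub> \<one>\<^bsub>R\<^esub>) \<odot>\<^bsub>W.E\<^esub> wedge R Om (xs[k := v]) \<in> top_gr e"
    using v by (intro top_gr_scalar) blast
  ultimately show "c \<odot>\<^bsub>restrict_scalars R Om\<^esub> v \<in> {y \<in> carrier Om. wedge R Om (xs[k := y]) \<in> top_gr e}"
    by (simp only: restrict_scalars_fields mem_Collect_eq)
qed

text \<open>A hybrid statement for induction: the first k entries are arbitrary homogeneous 1-forms,
  the others are already some dx_c. In one step entry k is replaced by a generator a dx_c, and a is
  moved in front of the wedge.\<close>

lemma wedge_graded_aux:
  assumes "k \<le> Suc n" "length xs = Suc n" "length es = Suc n"
    and "\<And>i. i < Suc n \<Longrightarrow> if i < k then xs ! i \<in> gr1 (es ! i) else (\<exists>c\<le>n. xs ! i = dx c) \<and> es ! i = 1"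
  shows "wedge R Om xs \<in> top_gr (sum_list es)"
  using assms
proof (induction k arbitrary: xs es)
  case 0
  have "\<forall>i. \<exists>c. i \<le> n \<longrightarrow> c \<le> n \<and> xs ! i = dx c" using 0(4) by (auto simp: less_Suc_eq_le)
  then obtain c where c: "\<And>i. i \<le> n \<Longrightarrow> c i \<le> n \<and> xs ! i = dx (c i)" by metis
  have "xs = map (dx \<circ> c) [0..<Suc n]"
    using 0(2) c by (intro nth_equalityI) (auto simp: less_Suc_eq_le simp del: upt_Suc)
  moreover have "es = replicate (Suc n) 1"
    using 0(3,4) by (intro nth_equalityI) (auto simp del: replicate_Suc)
  then have "sum_list es = Suc n" by (simp add: sum_list_replicate del: replicate_Suc)
  ultimately show ?case using wedge_dx[of c] c by simp
next
  case (Suc k)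
  have k: "k < Suc n" using Suc.prems(1) by simp
  have nth: "xs ! i \<in> carrier Om" if "i < Suc n" for i
    using Suc.prems(4)[OF that] gr1_carrier dx_carrier by (auto split: if_splits)
  have t: "xs \<in> tuples Om (Suc n)"
    using Suc.prems(2) nth by (auto simp: tuples_def in_set_conv_nth)
  let ?N = "{y \<in> carrier Om. wedge R Om (xs[k := y]) \<in> top_gr (sum_list es)}"
  have "gr1 (es ! k) \<subseteq> ?N"
    unfolding gr1_eq
  proof (rule LinearCombinations.module.span_is_subset[OF module_K[OF RA.module_kaehler] _ slot_submodule[OF t k]])
    show "{cl a \<odot>\<^bsub>Om\<^esub> dx c | a c. c \<le> n \<and> (\<exists>i. a \<in> hom_polys n i \<and> i + 1 = es ! k)} \<subseteq> ?N"
    proof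
      fix y assume "y \<in> {cl a \<odot>\<^bsub>Om\<^esub> dx c | a c. c \<le> n \<and> (\<exists>i. a \<in> hom_polys n i \<and> i + 1 = es ! k)}"
      then obtain a c i where y: "y = cl a \<odot>\<^bsub>Om\<^esub> dx c" and c: "c \<le> n" and a: "a \<in> hom_polys n i" "i + 1 = es ! k"
        by blast
      have ca: "cl a \<in> carrier R" by (intro \<pi>_carrier hom_polysD[OF a(1)])
      have "wedge R Om (xs[k := dx c]) \<in> top_gr (sum_list (es[k := 1]))"
      proof (rule Suc.IH)
        fix i assume i: "i < Suc n"
        show "if i < k then xs[k := dx c] ! i \<in> gr1 (es[k := 1] ! i)
          else (\<exists>c'\<le>n. xs[k := dx c] ! i = dx c') \<and> es[k := 1] ! i = 1"
          using Suc.prems(4)[OF i] Suc.prems(2,3) k c i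
          by (cases "i = k") (auto split: if_splits)
      qed (use Suc.prems in auto)
      then have "cl a \<odot>\<^bsub>W.E\<^esub> wedge R Om (xs[k := dx c]) \<in> top_gr (i + sum_list (es[k := 1]))"
        by (rule top_gr_mult[OF a(1)])
      \<comment> \<open>The coefficient takes over degree i, leaving degree 1 at entry k, so the
        total degree is preserved.\<close>
      moreover have "i + sum_list (es[k := 1]) = sum_list es"
        using a(2) Suc.prems(3) k elem_le_sum_list[of k es] by (simp add: sum_list_update)
      moreover have "wedge R Om (xs[k := y]) = cl a \<odot>\<^bsub>W.E\<^esub> wedge R Om (xs[k := dx c])"
        unfolding y by (rule W.wedge_smult[OF t k ca dx_carrier[OF c]])
      moreover have "y \<in> carrier Om" unfolding y by (rule Om_smult_closed[OF ca dx_carrier[OF c]])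
      ultimately show "y \<in> ?N" by simp
    qed
  qed
  moreover have "xs ! k \<in> gr1 (es ! k)" using Suc.prems(4)[OF k] by simp
  ultimately have "wedge R Om (xs[k := xs ! k]) \<in> top_gr (sum_list es)" by blast
  then show ?case by simp
qed

text \<open>By \<open>wedge_graded_aux\<close> all generators are homogeneous multiples of the top
  form. Conversely such a multiple is itself a generator, with all entries dx_i and all degrees
  1.\<close>

lemma ext_power_grading_eq:
  "ext_power_grading class_ring R gr Om gr1 (Suc n) d = top_gr d"
proof -
  let ?V = "restrict_scalars R W.E"
  let ?S = "{a \<odot>\<^bsub>W.E\<^esub> g | a g i e. a \<in> gr i \<and>
     (g, e) \<in> {(wedge R Om xs, sum_list es) | xs es. length xs = Suc n \<and> length es = Suc n \<and>
        (\<forall>i<Suc n. xs ! i \<in> gr1 (es ! i))} \<and> i + e = d}"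
  have mK: "Module.module class_ring ?V" by (rule module_K[OF module_E])
  have S: "?S \<subseteq> top_gr d"
  proof
    fix v assume "v \<in> ?S"
    then obtain a i xs es where v: "v = cl a \<odot>\<^bsub>W.E\<^esub> wedge R Om xs" "a \<in> hom_polys n i"
      and xs: "length xs = Suc n" "length es = Suc n" "\<forall>i<Suc n. xs ! i \<in> gr1 (es ! i)"
      and d: "i + sum_list es = d"
      unfolding gr_def by blast
    have "wedge R Om xs \<in> top_gr (sum_list es)"
      using xs by (intro wedge_graded_aux[of "Suc n"]) auto
    then show "v \<in> top_gr d" unfolding v(1) d[symmetric] by (rule top_gr_mult[OF v(2)])
  qed
  have "top_gr d \<subseteq> carrier ?V" using submodule_top_gr[of d] by (simp add: submodule_def)
  then have Sc: "?S \<subseteq> carrier ?V" using S by blast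
  have "LinearCombinations.module.span class_ring ?V ?S = top_gr d"
  proof
    show "LinearCombinations.module.span class_ring ?V ?S \<subseteq> top_gr d"
      by (rule LinearCombinations.module.span_is_subset[OF mK S submodule_top_gr])
    show "top_gr d \<subseteq> LinearCombinations.module.span class_ring ?V ?S"
    proof
      fix v assume "v \<in> top_gr d"
      then obtain f where f: "f \<in> top_coeffs d" "v = top_mult f" by (auto simp: top_gr_def)
      show "v \<in> LinearCombinations.module.span class_ring ?V ?S"
      proof (cases "d < Suc n")
        case True
        then have "v = \<zero>\<^bsub>?V\<^esub>" using f by (simp add: top_coeffs_def top_mult_zero)
        then show ?thesis
          using LinearCombinations.module.span_is_submodule[OF mK Sc] by (simp add: submodule_def)
      next
        case False
        then have fh: "f \<in> hom_polys n (d - Suc n)" using f by (simp add: top_coeffs_def)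
        have "v \<in> ?S"
        proof (intro CollectI exI conjI)
          show "v = cl f \<odot>\<^bsub>W.E\<^esub> top_form" by (simp add: f(2) top_mult_def)
          show "cl f \<in> gr (d - Suc n)" using fh by (simp add: gr_def)
          show "(top_form, Suc n) = (wedge R Om (map dx [0..<Suc n]), sum_list (replicate (Suc n) 1))"
            by (simp add: top_form_def sum_list_replicate del: upt_Suc replicate_Suc)
          show "length (map dx [0..<Suc n]) = Suc n" "length (replicate (Suc n) (1::nat)) = Suc n" by simp_all
          show "\<forall>i<Suc n. map dx [0..<Suc n] ! i \<in> gr1 (replicate (Suc n) 1 ! i)"
            using dx_gr1 by (simp add: less_Suc_eq_le del: upt_Suc replicate_Suc)
          show "d - Suc n + Suc n = d" using False by simp
        qed
        then show ?thesis using LinearCombinations.module.in_own_span[OF mK Sc] by blast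
      qed
    qed
  qed
  then show ?thesis by (simp only: ext_power_grading_def grading_by_gens_def)
qed

end

section \<open>Comparison of the Hilbert functions\<close>

text \<open>Since the dimension is the least cardinality of a finite generating set, transferring generating
  sets makes any finiteness assumption unnecessary.\<close>

lemma gen_set_transfer:
  assumes V: "vectorspace K V" and W: "vectorspace K W"
    and cV: "carrier V = \<alpha> ` H" and cW: "carrier W = \<beta> ` H"
    and add: "\<And>f g. f \<in> H \<Longrightarrow> g \<in> H \<Longrightarrow> \<exists>h\<in>H. \<alpha> h = \<alpha> f \<oplus>\<^bsub>V\<^esub> \<alpha> g \<and> \<beta> h = \<beta> f \<oplus>\<^bsub>W\<^esub> \<beta> g"
    and smult: "\<And>c f. c \<in> carrier K \<Longrightarrow> f \<in> H \<Longrightarrow> \<exists>h\<in>H. \<alpha> h = c \<odot>\<^bsub>V\<^esub> \<alpha> f \<and> \<beta> h = c \<odot>\<^bsub>W\<^esub> \<beta> f"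
    and fib: "\<And>f g. f \<in> H \<Longrightarrow> g \<in> H \<Longrightarrow> \<alpha> f = \<alpha> g \<longleftrightarrow> \<beta> f = \<beta> g"
    and A: "finite A" "card A = m" "A \<subseteq> carrier V" "LinearCombinations.module.span K V A = carrier V"
  shows "\<exists>A. finite A \<and> card A = m \<and> A \<subseteq> carrier W \<and> LinearCombinations.module.span K W A = carrier W"
proof -
  interpret V: vectorspace K V by fact
  interpret W: vectorspace K W by fact
  \<comment> \<open>Choosing one parameter in \<open>H\<close> for each element of \<open>A\<close>
    lets the same parameters describe the candidate generating set of \<open>W\<close>.\<close>
  obtain B where B: "B \<subseteq> H" "inj_on \<alpha> B" "A = \<alpha> ` B"
    using A(3) unfolding cV subset_image_inj by blast
  have inj: "inj_on \<beta> B"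
    using B fib unfolding inj_on_def by blast
  have fin: "finite B" using A(1) B(2,3) finite_imageD by blast
  have bc: "\<beta> ` B \<subseteq> carrier W" using B(1) cW by blast
  define N where "N = W.span (\<beta> ` B)"
  have N: "submodule K N W" unfolding N_def by (rule W.span_is_submodule[OF bc])
  have N_add: "x \<oplus>\<^bsub>W\<^esub> y \<in> N" if "x \<in> N" "y \<in> N" for x y using N that by (simp add: submodule_def)
  have N_smult: "c \<odot>\<^bsub>W\<^esub> x \<in> N" if "c \<in> carrier K" "x \<in> N" for c x using N that by (simp add: submodule_def)
  \<comment> \<open>The part of \<open>V\<close> that corresponds to the span \<open>N\<close> in
    \<open>W\<close>. It is a submodule containing the generators \<open>A\<close>, hence all of
    \<open>V\<close>; equality of fibres then turns this into \<open>N\<close> being all of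
    \<open>W\<close>.\<close>
  let ?P = "\<alpha> ` {f \<in> H. \<beta> f \<in> N}"
  have "submodule K ?P V"
    unfolding submodule_def
  proof (intro conjI allI impI)
    show "Module.module K V" by (rule V.module_axioms)
    show "?P \<subseteq> carrier V" unfolding cV by blast
    \<comment> \<open>A parameter for the zero vectors is found by scaling any element of
      \<open>H\<close> by 0.\<close>
    have "H \<noteq> {}" using V.M.zero_closed cV by blast
    then obtain f where f: "f \<in> H" by blast
    obtain h where h: "h \<in> H" "\<alpha> h = \<zero>\<^bsub>K\<^esub> \<odot>\<^bsub>V\<^esub> \<alpha> f" "\<beta> h = \<zero>\<^bsub>K\<^esub> \<odot>\<^bsub>W\<^esub> \<beta> f"
      using smult[OF V.R.zero_closed f] by blast
    have "\<alpha> h = \<zero>\<^bsub>V\<^esub>" "\<beta> h = \<zero>\<^bsub>W\<^esub>" unfolding h(2,3) using f cV cW by auto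
    moreover have "\<zero>\<^bsub>W\<^esub> \<in> N" using N by (simp add: submodule_def)
    ultimately show "\<zero>\<^bsub>V\<^esub> \<in> ?P" using h(1) by (intro image_eqI[of _ _ h]) simp_all
  next
    fix v w assume "v \<in> ?P" "w \<in> ?P"
    then obtain f g where fg: "f \<in> H" "g \<in> H" "\<beta> f \<in> N" "\<beta> g \<in> N" "v = \<alpha> f" "w = \<alpha> g" by blast
    obtain h where "h \<in> H" "\<alpha> h = \<alpha> f \<oplus>\<^bsub>V\<^esub> \<alpha> g" "\<beta> h = \<beta> f \<oplus>\<^bsub>W\<^esub> \<beta> g"
      using add[OF fg(1,2)] by blast
    then show "v \<oplus>\<^bsub>V\<^esub> w \<in> ?P" using fg N_add by (intro image_eqI[of _ _ h]) simp_all
  next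
    fix c v assume c: "c \<in> carrier K" and "v \<in> ?P"
    then obtain f where f: "f \<in> H" "\<beta> f \<in> N" "v = \<alpha> f" by blast
    obtain h where "h \<in> H" "\<alpha> h = c \<odot>\<^bsub>V\<^esub> \<alpha> f" "\<beta> h = c \<odot>\<^bsub>W\<^esub> \<beta> f"
      using smult[OF c f(1)] by blast
    then show "c \<odot>\<^bsub>V\<^esub> v \<in> ?P" using f N_smult[OF c] by (intro image_eqI[of _ _ h]) simp_all
  qed
  moreover have "A \<subseteq> ?P"
    unfolding B(3) N_def using W.in_own_span[OF bc] B(1) by blast
  ultimately have "carrier V \<subseteq> ?P"
    using V.span_is_subset A(4) by metis
  have "carrier W \<subseteq> N"
  proof
    fix w assume "w \<in> carrier W"
    then obtain f where f: "f \<in> H" "w = \<beta> f" using cW by blast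
    then have "\<alpha> f \<in> ?P" using cV \<open>carrier V \<subseteq> ?P\<close> by blast
    then obtain g where "g \<in> H" "\<beta> g \<in> N" "\<alpha> f = \<alpha> g" by blast
    then show "w \<in> N" using fib f by metis
  qed
  then have "N = carrier W" using N by (auto simp: submodule_def)
  moreover have "card (\<beta> ` B) = m"
    using A(2) B(2,3) inj by (simp add: card_image)
  ultimately show ?thesis using fin bc unfolding N_def by blast
qed

text \<open>Equal fibres mean that sending \<open>\<alpha> f\<close> to \<open>\<beta> f\<close> is
  a linear bijection. The hypotheses are symmetric in the two spaces, so generating sets transfer
  both ways.\<close>

lemma dim_eq_of_same_fibres:
  assumes V: "vectorspace K V" and W: "vectorspace K W"
    and cV: "carrier V = \<alpha> ` H" and cW: "carrier W = \<beta> ` H"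
    and add: "\<And>f g. f \<in> H \<Longrightarrow> g \<in> H \<Longrightarrow> \<exists>h\<in>H. \<alpha> h = \<alpha> f \<oplus>\<^bsub>V\<^esub> \<alpha> g \<and> \<beta> h = \<beta> f \<oplus>\<^bsub>W\<^esub> \<beta> g"
    and smult: "\<And>c f. c \<in> carrier K \<Longrightarrow> f \<in> H \<Longrightarrow> \<exists>h\<in>H. \<alpha> h = c \<odot>\<^bsub>V\<^esub> \<alpha> f \<and> \<beta> h = c \<odot>\<^bsub>W\<^esub> \<beta> f"
    and fib: "\<And>f g. f \<in> H \<Longrightarrow> g \<in> H \<Longrightarrow> \<alpha> f = \<alpha> g \<longleftrightarrow> \<beta> f = \<beta> g"
  shows "vectorspace.dim K V = vectorspace.dim K W"
proof -
  have add': "\<exists>h\<in>H. \<beta> h = \<beta> f \<oplus>\<^bsub>W\<^esub> \<beta> g \<and> \<alpha> h = \<alpha> f \<oplus>\<^bsub>V\<^esub> \<alpha> g" if "f \<in> H" "g \<in> H" for f g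
    using add[OF that] by blast
  have smult': "\<exists>h\<in>H. \<beta> h = c \<odot>\<^bsub>W\<^esub> \<beta> f \<and> \<alpha> h = c \<odot>\<^bsub>V\<^esub> \<alpha> f" if "c \<in> carrier K" "f \<in> H" for c f
    using smult[OF that] by blast
  have fib': "\<beta> f = \<beta> g \<longleftrightarrow> \<alpha> f = \<alpha> g" if "f \<in> H" "g \<in> H" for f g
    using fib[OF that] by blast
  have "(\<exists>A. finite A \<and> card A = m \<and> A \<subseteq> carrier V \<and> LinearCombinations.module.span K V A = carrier V) \<longleftrightarrow>
      (\<exists>A. finite A \<and> card A = m \<and> A \<subseteq> carrier W \<and> LinearCombinations.module.span K W A = carrier W)" for m
  proof
    assume "\<exists>A. finite A \<and> card A = m \<and> A \<subseteq> carrier V \<and> LinearCombinations.module.span K V A = carrier V"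
    then show "\<exists>A. finite A \<and> card A = m \<and> A \<subseteq> carrier W \<and> LinearCombinations.module.span K W A = carrier W"
      by (elim exE conjE) (rule gen_set_transfer[OF V W cV cW add smult fib])
  next
    assume "\<exists>A. finite A \<and> card A = m \<and> A \<subseteq> carrier W \<and> LinearCombinations.module.span K W A = carrier W"
    then show "\<exists>A. finite A \<and> card A = m \<and> A \<subseteq> carrier V \<and> LinearCombinations.module.span K V A = carrier V"
      by (elim exE conjE) (rule gen_set_transfer[OF W V cW cV add' smult' fib'])
  qed
  then show ?thesis
    by (simp only: vectorspace.dim_def[OF V] vectorspace.dim_def[OF W])
qed

lemma is_hilbert_poly_cong:
  assumes "\<forall>\<^sub>F d in sequentially. vectorspace.dim K (V\<lparr>carrier := a d\<rparr>) = vectorspace.dim L (W\<lparr>carrier := b d\<rparr>)"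
  shows "is_hilbert_poly K V a p \<longleftrightarrow> is_hilbert_poly L W b p"
  unfolding is_hilbert_poly_def using assms by (intro eventually_subst) (auto elim: eventually_mono)

lemma carrier_update_fields:
  fixes M :: "('r, 'm, 'e) module_scheme"
  shows "add (M\<lparr>carrier := N\<rparr>) = add M" "smult (M\<lparr>carrier := N\<rparr>) = smult M"
  by simp_all

lemma vectorspace_submodule:
  assumes "Module.module (class_ring :: 'k::field ring) V" "submodule class_ring N V"
  shows "vectorspace class_ring (V\<lparr>carrier := N\<rparr>)"
  unfolding vectorspace_def
  using LinearCombinations.module.submodule_is_module[OF assms] class_field by blast

section \<open>Graded pieces of the quotient ring as vector spaces\<close>

context poly_quotient
begin

lemma submodule_gr: "submodule class_ring (gr d) R"
  unfolding submodule_def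
proof (intro conjI allI impI)
  show "Module.module class_ring R" by (rule module_Q)
  show "gr d \<subseteq> carrier R" unfolding gr_def by (intro image_subsetI \<pi>_carrier hom_polysD)
  show "\<zero>\<^bsub>R\<^esub> \<in> gr d" unfolding gr_def zero_R by (intro imageI hom_polys_zero)
next
  fix v w assume "v \<in> gr d" "w \<in> gr d"
  then obtain f g where fg: "f \<in> hom_polys n d" "g \<in> hom_polys n d" "v = cl f" "w = cl g"
    by (auto simp: gr_def)
  have "v \<oplus>\<^bsub>R\<^esub> w = cl (f + g)"
    unfolding fg(3,4) by (rule cl_add[OF hom_polysD[OF fg(1)] hom_polysD[OF fg(2)]])
  then show "v \<oplus>\<^bsub>R\<^esub> w \<in> gr d" using fg(1,2) by (auto simp: gr_def)
next
  fix c v assume "v \<in> gr d"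
  then obtain f where f: "f \<in> hom_polys n d" "v = cl f" by (auto simp: gr_def)
  then show "c \<odot>\<^bsub>R\<^esub> v \<in> gr d"
    unfolding gr_def by (intro image_eqI[of _ _ "Poly_Mapping.single 0 c * f"])
      (simp_all only: cl_smult[OF hom_polysD[OF f(1)]] hom_polys_smult)
qed

end

theorem theorem8p3:
  fixes X :: "(nat \<Rightarrow> 'k::field_char_0) set set" and n s \<nu> :: nat
  assumes "n \<ge> 1"
    and "X \<subseteq> proj_space n" and "finite X" and "card X = s"
    and "\<forall>P\<in>X. \<forall>v\<in>P. v 0 \<noteq> 0"
    and "\<nu> \<ge> 1"
  shows "HP_Omega n (\<nu> + 1) X (n + 1) = HP_fat n \<nu> X"
proof -
  obtain p where "fat_points n X p" using fat_points_ex[OF assms(2,3,5)] by blast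
  then interpret fat_points n X p .
  let ?I = "fat_ideal n (Suc \<nu>) X" and ?I' = "fat_ideal n \<nu> X"
  \<comment> \<open>\<open>A\<close> is the ring whose top forms are studied, with the Jacobian read
    modulo I_\<nu>; \<open>B\<close> below is the ring of the scheme with multiplicity
    \<nu>.\<close>
  interpret A: poly_quotient_pair n ?I ?I'
  proof (rule poly_quotient_pair.intro[OF poly_quotient.intro poly_quotient_pair_axioms.intro])
    show "ideal ?I (poly_alg n)" "ideal ?I' (poly_alg n)" by (rule ideal_fat_ideal)+
    show "?I \<subseteq> ?I'" by (auto dest: fat_ideal_decr)
    show "partial i f \<in> ?I'" if "f \<in> ?I" for f i using that by (rule partial_fat_ideal)
  qed
  interpret B: poly_quotient n ?I' by (rule poly_quotient.intro[OF ideal_fat_ideal])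
  have ann: "A.top_ann \<subseteq> ?I'"
    using A.top_form_zeroD by (auto simp: A.top_ann_def A.top_mult_def)
  obtain D where D: "\<And>d f. d \<ge> D \<Longrightarrow> f \<in> hom_polys n d \<Longrightarrow> f \<in> ?I' \<Longrightarrow> f \<in> A.top_ann"
    using fat_ideal_eventually_subset[OF A.ideal_top_ann A.I_subset_top_ann A.partial_I_top_ann assms(6) ann]
    by blast
  let ?V = "restrict_scalars A.R A.W.E"
  \<comment> \<open>In the bound, \<open>D\<close> guarantees that annihilator and I_\<nu> agree in
    degree d - (n + 1), while the other summands allow the factor X_0^(n+1) to be extracted in
    degree d.\<close>
  have dim_eq: "vectorspace.dim class_ring (?V\<lparr>carrier := A.top_gr d\<rparr>) =
      vectorspace.dim class_ring (B.R\<lparr>carrier := B.gr d\<rparr>)"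
    if d: "d \<ge> D + n * (card X * \<nu>) + Suc n" for d
  proof (rule dim_eq_of_same_fibres)
    \<comment> \<open>A polynomial f of degree d - (n + 1) is sent to f times the top form on one
      side and to the class of X_0^(n+1) f on the other; the power of X_0 makes up the degree of the
      top form.\<close>
    let ?H = "hom_polys n (d - Suc n)" and ?\<beta> = "\<lambda>f. B.cl (X0 ^ Suc n * f)"
    have Hp: "f \<in> polys n" "X0 ^ Suc n * f \<in> polys n" if "f \<in> ?H" for f
      using hom_polysD[OF that] by (auto intro: polys_mult polys_power polys_var)
    show "vectorspace class_ring (?V\<lparr>carrier := A.top_gr d\<rparr>)"
      by (rule vectorspace_submodule[OF A.module_K[OF A.module_E] A.submodule_top_gr])
    show "vectorspace class_ring (B.R\<lparr>carrier := B.gr d\<rparr>)"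
      by (rule vectorspace_submodule[OF B.module_Q B.submodule_gr])
    show "carrier (?V\<lparr>carrier := A.top_gr d\<rparr>) = A.top_mult ` ?H"
      using d by (simp add: A.top_gr_def A.top_coeffs_def)
    have "B.gr d = ?\<beta> ` ?H"
    proof
      have "X0 ^ Suc n * f \<in> hom_polys n d" if "f \<in> ?H" for f
        using hom_polys_mult[OF hom_polys_power[OF hom_polys_var[of 0 n], of "Suc n"] that] d by simp
      then show "?\<beta> ` ?H \<subseteq> B.gr d" unfolding B.gr_def by blast
      show "B.gr d \<subseteq> ?\<beta> ` ?H"
      proof
        fix v assume "v \<in> B.gr d"
        then obtain f where f: "f \<in> hom_polys n d" "v = B.cl f" by (auto simp: B.gr_def)
        have "n * (card X * \<nu>) + Suc n \<le> d" using d by simp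
        then obtain h where h: "h \<in> ?H" "f - X0 ^ Suc n * h \<in> ?I'"
          using fat_ideal_reduce[OF f(1) assms(6)] by blast
        then have "v = ?\<beta> h"
          unfolding f(2) using B.cl_eq_iff[OF hom_polysD[OF f(1)] Hp(2)[OF h(1)]] by blast
        then show "v \<in> ?\<beta> ` ?H" using h(1) by blast
      qed
    qed
    then show "carrier (B.R\<lparr>carrier := B.gr d\<rparr>) = ?\<beta> ` ?H" by simp
  next
    fix f g :: "'k mpoly" assume fg: "f \<in> hom_polys n (d - Suc n)" "g \<in> hom_polys n (d - Suc n)"
    have fgp: "f \<in> polys n" "g \<in> polys n" "X0 ^ Suc n * f \<in> polys n" "X0 ^ Suc n * g \<in> polys n"
      using hom_polysD[OF fg(1)] hom_polysD[OF fg(2)] by (auto intro: polys_mult polys_power polys_var)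
    have "A.top_mult (f + g) = A.top_mult f \<oplus>\<^bsub>A.W.E\<^esub> A.top_mult g" by (rule A.top_mult_add[OF fgp(1,2)])
    moreover have "B.cl (X0 ^ Suc n * (f + g)) = B.cl (X0 ^ Suc n * f) \<oplus>\<^bsub>B.R\<^esub> B.cl (X0 ^ Suc n * g)"
      unfolding distrib_left by (rule B.cl_add[OF fgp(3,4), symmetric])
    ultimately show "\<exists>h\<in>hom_polys n (d - Suc n).
        A.top_mult h = A.top_mult f \<oplus>\<^bsub>?V\<lparr>carrier := A.top_gr d\<rparr>\<^esub> A.top_mult g \<and>
        B.cl (X0 ^ Suc n * h) = B.cl (X0 ^ Suc n * f) \<oplus>\<^bsub>B.R\<lparr>carrier := B.gr d\<rparr>\<^esub> B.cl (X0 ^ Suc n * g)"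
      by (intro bexI[of _ "f + g"] hom_polys_add fg conjI)
        (simp_all only: carrier_update_fields restrict_scalars_fields)
    \<comment> \<open>Equality of fibres: the first equivalence is the agreement of the two ideals
      in large degree, the second is cancellation of X_0 modulo I_\<nu>.\<close>
    have "f - g \<in> A.top_ann \<longleftrightarrow> f - g \<in> ?I'"
      using ann D[of "d - Suc n" "f - g"] hom_polys_diff[OF fg] d by auto
    also have "\<dots> \<longleftrightarrow> X0 ^ Suc n * (f - g) \<in> ?I'"
      using fat_ideal_cancel_X0[OF hom_polys_diff[OF fg], of "Suc n" \<nu>]
        poly_ideal_mult[OF B.ideal_I polys_power[OF polys_var[of 0 n]], of "f - g" "Suc n"] by blast
    finally show "A.top_mult f = A.top_mult g \<longleftrightarrow> B.cl (X0 ^ Suc n * f) = B.cl (X0 ^ Suc n * g)"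
      unfolding A.top_mult_eq_iff[OF fgp(1,2)] B.cl_eq_iff[OF fgp(3,4)] right_diff_distrib .
  next
    fix c :: 'k and f :: "'k mpoly" assume f: "f \<in> hom_polys n (d - Suc n)"
    have fp: "f \<in> polys n" "X0 ^ Suc n * f \<in> polys n"
      using hom_polysD[OF f] by (auto intro: polys_mult polys_power polys_var)
    have "A.top_mult (Poly_Mapping.single 0 c * f) = (c \<odot>\<^bsub>A.R\<^esub> \<one>\<^bsub>A.R\<^esub>) \<odot>\<^bsub>A.W.E\<^esub> A.top_mult f"
      unfolding A.scalar_R by (rule A.top_mult_mult[OF polys_const fp(1)])
    moreover have "B.cl (X0 ^ Suc n * (Poly_Mapping.single 0 c * f)) = c \<odot>\<^bsub>B.R\<^esub> B.cl (X0 ^ Suc n * f)"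
      unfolding B.cl_smult[OF fp(2)] by (simp only: mult.left_commute)
    ultimately show "\<exists>h\<in>hom_polys n (d - Suc n).
        A.top_mult h = c \<odot>\<^bsub>?V\<lparr>carrier := A.top_gr d\<rparr>\<^esub> A.top_mult f \<and>
        B.cl (X0 ^ Suc n * h) = c \<odot>\<^bsub>B.R\<lparr>carrier := B.gr d\<rparr>\<^esub> B.cl (X0 ^ Suc n * f)"
      by (intro bexI[of _ "Poly_Mapping.single 0 c * f"] hom_polys_smult f conjI)
        (simp_all only: carrier_update_fields restrict_scalars_fields)
  qed
  have "\<forall>\<^sub>F d in sequentially. vectorspace.dim class_ring (?V\<lparr>carrier := A.top_gr d\<rparr>) =
      vectorspace.dim class_ring (B.R\<lparr>carrier := B.gr d\<rparr>)"
    using dim_eq unfolding eventually_sequentially by blast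
  \<comment> \<open>\<open>hilbert_poly\<close> is a definite description, so equivalence of the
    predicates for every \<open>q\<close> yields equality of the polynomials.\<close>
  then have "is_hilbert_poly class_ring ?V A.top_gr q \<longleftrightarrow> is_hilbert_poly class_ring B.R B.gr q" for q
    by (rule is_hilbert_poly_cong)
  then have "hilbert_poly class_ring ?V A.top_gr = hilbert_poly class_ring B.R B.gr"
    by (simp only: hilbert_poly_def)
  moreover have "HP_fat n \<nu> X = hilbert_poly class_ring B.R B.gr"
    by (simp add: HP_fat_def fat_ring_def fat_grading_def[abs_def] fat_class_def[abs_def] B.gr_def[abs_def])
  moreover have "HP_Omega n (\<nu> + 1) X (n + 1) = hilbert_poly class_ring ?V A.top_gr"
  proof -
    have ring: "fat_ring n (Suc \<nu>) X = A.R" by (simp only: fat_ring_def)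
    have gr: "fat_grading n (Suc \<nu>) X = A.gr"
      by (simp only: fat_grading_def[abs_def] fat_class_def[abs_def] A.gr_def[abs_def])
    have gr1: "Omega1_grading n (Suc \<nu>) X = A.gr1"
      by (simp only: Omega1_grading_def Omega1_def ring gr A.gr1_def fat_class_def)
    have "Omega_grading n (Suc \<nu>) X (Suc n) d = A.top_gr d" for d
      unfolding A.ext_power_grading_eq[symmetric]
      by (simp only: Omega_grading_def Omega1_def ring gr gr1)
    then have "Omega_grading n (Suc \<nu>) X (Suc n) = A.top_gr" by (rule ext)
    then show ?thesis by (simp only: HP_Omega_def Omega_def Omega1_def ring Suc_eq_plus1[symmetric])
  qed
  ultimately show ?thesis by simp
qed

end
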